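(* Any abelian track theory is equivalent to a strong one. More precisely, if $\mathcal T$ is an abelian track theory, then there exist a strong abelian track theory $\mathcal T'$, an abelian track theory $\mathcal T''$, and weak equivalences $\mathcal T\leftarrow\mathcal T''\rightarrow\mathcal T'$, as well as a lax equivalence $\mathcal T'\to\mathcal T$.
   Context: A track category $\mathcal T$ is a category enriched in groupoids, i.e. a 2-category all of whose 2-arrows are invertible. For objects $X,Y$, $[\![X,Y]\!]_{\mathcal T}$ (or $[\![X,Y]\!]$) denotes the Hom-groupoid; its objects are the 1-arrows $X\to Y$, its morphisms the 2-arrows (tracks) $f\Rightarrow g$. $\mathcal T$ is abelian if for every 1-arrow $f$ the group $\mathrm{Aut}(f)$ of tracks $f\Rightarrow f$ is abelian. Two 1-arrows $f,g:X\to Y$ are homotopic if there is a track $f\Rightarrow g$; the homotopy category $\mathcal T_\simeq$ has the same objects as $\mathcal T$ and homotopy classes of 1-arrows as morphisms. Objects $X,Y$ are homotopy equivalent if they are isomorphic in $\mathcal T_\simeq$. A track functor is a groupoid-enriched (strict) functor $F:\mathcal T\to\mathcal T'$. It is a weak equivalence if all induced functors $[\![X,Y]\!]_{\mathcal T}\to[\![FX,FY]\!]_{\mathcal T'}$ are equivalences of groupoids and every object of $\mathcal T'$ is homotopy equivalent to one of the form $FX$. $\mathcal T$ has finite lax products if for any finite (possibly empty) collection of objects $X_1,\dots,X_n$ there are an object $X$ and 1-arrows $p_k:X\to X_k$, $k=1,\dots,n$, such that for every object $Y$ the functor $[\![Y,X]\!]\to[\![Y,X_1]\!]\times\cdots\times[\![Y,X_n]\!]$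 induced by the $p_k$ is an equivalence of groupoids. A track theory is a track category with finite lax products; it is strong if for any finite (possibly empty) collection of objects $X_1,\dots,X_n$ there are an object $X$ and 1-arrows $p_k:X\to X_k$, $k=1,\dots,n$, such that for every object $Y$ the functor $[\![Y,X]\!]\to[\![Y,X_1]\!]\times\cdots\times[\![Y,X_n]\!]$ induced by the $p_k$ is in fact an isomorphism of groupoids. Morphisms of track theories are track functors compatible with lax products. An equivalence of track theories is a track theory morphism which is a weak equivalence; two track theories are called equivalent if they are related by the smallest equivalence relation generated by equivalences of track theories. A lax functor $F:\mathcal T\to\mathcal T'$ between track categories consists of a map on objects, functors $F_{X,Y}:[\![X,Y]\!]_{\mathcal T}\to[\![FX,FY]\!]_{\mathcal T'}$, 2-arrows $o_X:\mathrm{id}_{FX}\Rightarrow F(\mathrm{id}_X)$ for each object $X$, and 2-arrows $a_{f,g}:(Ff)(Fg)\Rightarrow F(fg)$, natural in $f$ and $g$, for composable 1-arrows $f,g$, subject to the coherence conditions (vertical composition of 2-arrows being written additively, $\beta+\alpha$ meaning first $\alpha$ then $\beta$): $a_{\mathrm{id}_Y,f}+o_Y(Ff)$ and $a_{f,\mathrm{id}_X}+(Ff)o_X$ are the identity 2-arrow of $Ff$ for $f:X\to Y$, and $a_{f,gh}+(Ff)a_{g,h}=a_{fg,h}+a_{f,g}(Fh)$ for composable $f,g,h$. A lax functor $F$ between track categories is a lax equivalence if the induced functor $F_\simeq:\mathcal T_\simeq\to\mathcal T'_\simeq$ is an equivalence of categories and all induced homomorphisms $\mathrm{Aut}(f)\to\mathrm{Aut}(Ff)$,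 $f$ a 1-arrow of $\mathcal T$, are isomorphisms. *)

theory Defs
  imports "HOL-Algebra.Group"
begin

section \<open>Categories, functors, groupoids\<close>

text \<open>Composition is written in the usual order: \<open>Cmp C g f\<close> is ``first \<open>f\<close>, then \<open>g\<close>''.
  All conditions are relative to the carriers \<open>Obj C\<close> and \<open>Mor C\<close>; values of the operations
  outside the carriers are irrelevant.\<close>

record ('o, 'm) category =
  Obj :: "'o set"
  Mor :: "'m set"
  Src :: "'m \<Rightarrow> 'o"
  Tgt :: "'m \<Rightarrow> 'o"
  Idt :: "'o \<Rightarrow> 'm"
  Cmp :: "'m \<Rightarrow> 'm \<Rightarrow> 'm"

definition Hom :: "('o, 'm, 'z) category_scheme \<Rightarrow> 'o \<Rightarrow> 'o \<Rightarrow> 'm set" where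
  "Hom C X Y = {f \<in> Mor C. Src C f = X \<and> Tgt C f = Y}"

locale category =
  fixes C :: "('o, 'm, 'z) category_scheme"
  assumes Src_in: "f \<in> Mor C \<Longrightarrow> Src C f \<in> Obj C"
    and Tgt_in: "f \<in> Mor C \<Longrightarrow> Tgt C f \<in> Obj C"
    and Idt_in: "X \<in> Obj C \<Longrightarrow> Idt C X \<in> Hom C X X"
    and Cmp_in: "g \<in> Hom C Y Z \<Longrightarrow> f \<in> Hom C X Y \<Longrightarrow> Cmp C g f \<in> Hom C X Z"
    and Idt_left: "f \<in> Hom C X Y \<Longrightarrow> Cmp C (Idt C Y) f = f"
    and Idt_right: "f \<in> Hom C X Y \<Longrightarrow> Cmp C f (Idt C X) = f"
    and Cmp_assoc: "h \<in> Hom C Y Z \<Longrightarrow> g \<in> Hom C X Y \<Longrightarrow> f \<in> Hom C W X \<Longrightarrow>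
      Cmp C h (Cmp C g f) = Cmp C (Cmp C h g) f"

definition isomorphism :: "('o, 'm, 'z) category_scheme \<Rightarrow> 'm \<Rightarrow> bool" where
  "isomorphism C f \<longleftrightarrow> f \<in> Mor C \<and>
    (\<exists>g \<in> Hom C (Tgt C f) (Src C f).
      Cmp C g f = Idt C (Src C f) \<and> Cmp C f g = Idt C (Tgt C f))"

definition isomorphic :: "('o, 'm, 'z) category_scheme \<Rightarrow> 'o \<Rightarrow> 'o \<Rightarrow> bool" where
  "isomorphic C X Y \<longleftrightarrow> (\<exists>f \<in> Hom C X Y. isomorphism C f)"

locale groupoid = category +
  assumes all_isomorphism: "f \<in> Mor C \<Longrightarrow> isomorphism C f"

record ('o, 'm, 'p, 'n) func =
  fob :: "'o \<Rightarrow> 'p"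
  fmor :: "'m \<Rightarrow> 'n"

locale cat_functor = S: category C + T: category D
  for C :: "('o, 'm, 'z) category_scheme" and D :: "('p, 'n, 'y) category_scheme" +
  fixes F :: "('o, 'm, 'p, 'n) func"
  assumes fob_in: "X \<in> Obj C \<Longrightarrow> fob F X \<in> Obj D"
    and fmor_in: "f \<in> Hom C X Y \<Longrightarrow> fmor F f \<in> Hom D (fob F X) (fob F Y)"
    and fmor_Idt: "X \<in> Obj C \<Longrightarrow> fmor F (Idt C X) = Idt D (fob F X)"
    and fmor_Cmp: "g \<in> Hom C Y Z \<Longrightarrow> f \<in> Hom C X Y \<Longrightarrow>
      fmor F (Cmp C g f) = Cmp D (fmor F g) (fmor F f)"

definition id_func :: "('o, 'm, 'o, 'm) func" where
  "id_func = \<lparr>fob = (\<lambda>X. X), fmor = (\<lambda>f. f)\<rparr>"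

definition comp_func ::
    "('p, 'n, 'q, 'l) func \<Rightarrow> ('o, 'm, 'p, 'n) func \<Rightarrow> ('o, 'm, 'q, 'l) func" where
  "comp_func G F = \<lparr>fob = fob G \<circ> fob F, fmor = fmor G \<circ> fmor F\<rparr>"

definition naturally_isomorphic :: "('o, 'm, 'z) category_scheme \<Rightarrow> ('p, 'n, 'y) category_scheme \<Rightarrow>
    ('o, 'm, 'p, 'n) func \<Rightarrow> ('o, 'm, 'p, 'n) func \<Rightarrow> bool" where
  "naturally_isomorphic C D F G \<longleftrightarrow>
    (\<exists>\<eta>. (\<forall>X \<in> Obj C. \<eta> X \<in> Hom D (fob F X) (fob G X) \<and> isomorphism D (\<eta> X)) \<and>
      (\<forall>f \<in> Mor C. Cmp D (fmor G f) (\<eta> (Src C f)) = Cmp D (\<eta> (Tgt C f)) (fmor F f)))"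

definition equivalence_of_categories ::
    "('o, 'm, 'z) category_scheme \<Rightarrow> ('p, 'n, 'y) category_scheme \<Rightarrow> ('o, 'm, 'p, 'n) func \<Rightarrow> bool" where
  "equivalence_of_categories C D F \<longleftrightarrow> cat_functor C D F \<and>
    (\<exists>G. cat_functor D C G \<and>
      naturally_isomorphic C C (comp_func G F) id_func \<and>
      naturally_isomorphic D D (comp_func F G) id_func)"

definition isomorphism_of_categories ::
    "('o, 'm, 'z) category_scheme \<Rightarrow> ('p, 'n, 'y) category_scheme \<Rightarrow> ('o, 'm, 'p, 'n) func \<Rightarrow> bool" where
  "isomorphism_of_categories C D F \<longleftrightarrow> cat_functor C D F \<and>
    (\<exists>G. cat_functor D C G \<and>
      (\<forall>X \<in> Obj C. fob G (fob F X) = X) \<and> (\<forall>f \<in> Mor C. fmor G (fmor F f) = f) \<and>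
      (\<forall>Y \<in> Obj D. fob F (fob G Y) = Y) \<and> (\<forall>g \<in> Mor D. fmor F (fmor G g) = g))"

definition pair_category ::
    "('o, 'm, 'z) category_scheme \<Rightarrow> ('p, 'n, 'y) category_scheme \<Rightarrow> ('o \<times> 'p, 'm \<times> 'n) category" where
  "pair_category C D =
    \<lparr>Obj = Obj C \<times> Obj D,
     Mor = Mor C \<times> Mor D,
     Src = map_prod (Src C) (Src D),
     Tgt = map_prod (Tgt C) (Tgt D),
     Idt = map_prod (Idt C) (Idt D),
     Cmp = (\<lambda>(g, g') (f, f'). (Cmp C g f, Cmp D g' f'))\<rparr>"

text \<open>The product of a finite list of categories: objects and morphisms are lists whose \<open>k\<close>-th
  entry belongs to the \<open>k\<close>-th factor; the empty list gives the category with one morphism.\<close>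

definition list_category :: "('o, 'm) category list \<Rightarrow> ('o list, 'm list) category" where
  "list_category Cs =
    \<lparr>Obj = listset (map Obj Cs),
     Mor = listset (map Mor Cs),
     Src = map2 Src Cs,
     Tgt = map2 Tgt Cs,
     Idt = map2 Idt Cs,
     Cmp = (\<lambda>gs fs. map2 (\<lambda>C (g, f). Cmp C g f) Cs (zip gs fs))\<rparr>"


section \<open>Track categories\<close>

text \<open>The inherited fields are the underlying category of objects and 1-arrows. \<open>VCmp T \<beta> \<alpha>\<close> is the
  vertical composite \<open>\<beta> + \<alpha>\<close> (first \<open>\<alpha>\<close>, then \<open>\<beta>\<close>), \<open>HCmp T \<beta> \<alpha> : gf \<Rightarrow> g'f'\<close> the horizontal
  composite of \<open>\<alpha> : f \<Rightarrow> f'\<close> and \<open>\<beta> : g \<Rightarrow> g'\<close>. The whiskerings \<open>g\<alpha>\<close> and \<open>\<beta>f\<close> are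
  \<open>HCmp T (TId T g) \<alpha>\<close> and \<open>HCmp T \<beta> (TId T f)\<close>.\<close>

record ('o, 'a, 't) track_category = "('o, 'a) category" +
  Trk :: "'t set"
  TSrc :: "'t \<Rightarrow> 'a"
  TTgt :: "'t \<Rightarrow> 'a"
  TId :: "'a \<Rightarrow> 't"
  VCmp :: "'t \<Rightarrow> 't \<Rightarrow> 't"
  HCmp :: "'t \<Rightarrow> 't \<Rightarrow> 't"

definition tracks :: "('o, 'a, 't) track_category \<Rightarrow> 'a \<Rightarrow> 'a \<Rightarrow> 't set" where
  "tracks T f g = {\<alpha> \<in> Trk T. TSrc T \<alpha> = f \<and> TTgt T \<alpha> = g}"

definition hom_groupoid :: "('o, 'a, 't) track_category \<Rightarrow> 'o \<Rightarrow> 'o \<Rightarrow> ('a, 't) category" where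
  "hom_groupoid T X Y =
    \<lparr>Obj = Hom T X Y,
     Mor = {\<alpha> \<in> Trk T. TSrc T \<alpha> \<in> Hom T X Y},
     Src = TSrc T,
     Tgt = TTgt T,
     Idt = TId T,
     Cmp = VCmp T\<rparr>"

definition comp_functor :: "('o, 'a, 't) track_category \<Rightarrow> ('a \<times> 'a, 't \<times> 't, 'a, 't) func" where
  "comp_functor T = \<lparr>fob = (\<lambda>(g, f). Cmp T g f), fmor = (\<lambda>(\<beta>, \<alpha>). HCmp T \<beta> \<alpha>)\<rparr>"

locale track_category = category T
  for T :: "('o, 'a, 't) track_category" +
  assumes TSrc_in: "\<alpha> \<in> Trk T \<Longrightarrow> TSrc T \<alpha> \<in> Mor T"
    and hom_groupoid: "X \<in> Obj T \<Longrightarrow> Y \<in> Obj T \<Longrightarrow> groupoid (hom_groupoid T X Y)"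
    and comp_functor: "X \<in> Obj T \<Longrightarrow> Y \<in> Obj T \<Longrightarrow> Z \<in> Obj T \<Longrightarrow>
      cat_functor (pair_category (hom_groupoid T Y Z) (hom_groupoid T X Y)) (hom_groupoid T X Z)
        (comp_functor T)"
    and HCmp_Idt_left: "\<alpha> \<in> Mor (hom_groupoid T X Y) \<Longrightarrow> HCmp T (TId T (Idt T Y)) \<alpha> = \<alpha>"
    and HCmp_Idt_right: "\<alpha> \<in> Mor (hom_groupoid T X Y) \<Longrightarrow> HCmp T \<alpha> (TId T (Idt T X)) = \<alpha>"
    and HCmp_assoc: "\<gamma> \<in> Mor (hom_groupoid T Y Z) \<Longrightarrow> \<beta> \<in> Mor (hom_groupoid T X Y) \<Longrightarrow>
      \<alpha> \<in> Mor (hom_groupoid T W X) \<Longrightarrow> HCmp T \<gamma> (HCmp T \<beta> \<alpha>) = HCmp T (HCmp T \<gamma> \<beta>) \<alpha>"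

definition Aut :: "('o, 'a, 't) track_category \<Rightarrow> 'a \<Rightarrow> 't monoid" where
  "Aut T f = \<lparr>carrier = tracks T f f, mult = VCmp T, one = TId T f\<rparr>"

definition abelian :: "('o, 'a, 't) track_category \<Rightarrow> bool" where
  "abelian T \<longleftrightarrow> (\<forall>f \<in> Mor T. comm_group (Aut T f))"

definition homotopy :: "('o, 'a, 't) track_category \<Rightarrow> ('a \<times> 'a) set" where
  "homotopy T = {(f, g). f \<in> Mor T \<and> g \<in> Mor T \<and> tracks T f g \<noteq> {}}"

definition homotopy_category :: "('o, 'a, 't) track_category \<Rightarrow> ('o, 'a set) category" where
  "homotopy_category T =
    \<lparr>Obj = Obj T,
     Mor = Mor T // homotopy T,
     Src = (\<lambda>c. the_elem (Src T ` c)),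
     Tgt = (\<lambda>c. the_elem (Tgt T ` c)),
     Idt = (\<lambda>X. homotopy T `` {Idt T X}),
     Cmp = (\<lambda>d c. homotopy T `` {Cmp T g f | g f. g \<in> d \<and> f \<in> c})\<rparr>"

definition homotopy_equivalent :: "('o, 'a, 't) track_category \<Rightarrow> 'o \<Rightarrow> 'o \<Rightarrow> bool" where
  "homotopy_equivalent T X Y \<longleftrightarrow> isomorphic (homotopy_category T) X Y"


section \<open>Track functors and weak equivalences\<close>

record ('o, 'a, 't, 'p, 'b, 's) track_map =
  on_ob :: "'o \<Rightarrow> 'p"
  on_arr :: "'a \<Rightarrow> 'b"
  on_trk :: "'t \<Rightarrow> 's"

definition hom_func :: "('o, 'a, 't, 'p, 'b, 's, 'z) track_map_scheme \<Rightarrow> ('a, 't, 'b, 's) func" where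
  "hom_func F = \<lparr>fob = on_arr F, fmor = on_trk F\<rparr>"

locale track_functor = S: track_category S + T: track_category T
  for S :: "('o, 'a, 't) track_category" and T :: "('p, 'b, 's) track_category" +
  fixes F :: "('o, 'a, 't, 'p, 'b, 's) track_map"
  assumes underlying_functor: "cat_functor S T \<lparr>fob = on_ob F, fmor = on_arr F\<rparr>"
    and hom_functor: "X \<in> Obj S \<Longrightarrow> Y \<in> Obj S \<Longrightarrow>
      cat_functor (hom_groupoid S X Y) (hom_groupoid T (on_ob F X) (on_ob F Y)) (hom_func F)"
    and on_trk_HCmp: "\<beta> \<in> Mor (hom_groupoid S Y Z) \<Longrightarrow> \<alpha> \<in> Mor (hom_groupoid S X Y) \<Longrightarrow>
      on_trk F (HCmp S \<beta> \<alpha>) = HCmp T (on_trk F \<beta>) (on_trk F \<alpha>)"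

definition weak_equivalence :: "('o, 'a, 't) track_category \<Rightarrow> ('p, 'b, 's) track_category \<Rightarrow>
    ('o, 'a, 't, 'p, 'b, 's) track_map \<Rightarrow> bool" where
  "weak_equivalence S T F \<longleftrightarrow> track_functor S T F \<and>
    (\<forall>X \<in> Obj S. \<forall>Y \<in> Obj S.
      equivalence_of_categories (hom_groupoid S X Y) (hom_groupoid T (on_ob F X) (on_ob F Y))
        (hom_func F)) \<and>
    (\<forall>Y \<in> Obj T. \<exists>X \<in> Obj S. homotopy_equivalent T Y (on_ob F X))"


section \<open>Track theories\<close>

text \<open>A finite collection of objects is a list, possibly empty and possibly with repetitions. A cone
  over \<open>Xs\<close> is an object together with one 1-arrow to each entry of \<open>Xs\<close>.\<close>

definition cone :: "('o, 'a, 't) track_category \<Rightarrow> 'o list \<Rightarrow> 'o \<Rightarrow> 'a list \<Rightarrow> bool" where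
  "cone T Xs P ps \<longleftrightarrow> P \<in> Obj T \<and> list_all2 (\<lambda>p X. p \<in> Hom T P X) ps Xs"

definition induced_func :: "('o, 'a, 't) track_category \<Rightarrow> 'a list \<Rightarrow> ('a, 't, 'a list, 't list) func" where
  "induced_func T ps =
    \<lparr>fob = (\<lambda>f. map (\<lambda>p. Cmp T p f) ps), fmor = (\<lambda>\<alpha>. map (\<lambda>p. HCmp T (TId T p) \<alpha>) ps)\<rparr>"

definition lax_product :: "('o, 'a, 't) track_category \<Rightarrow> 'o list \<Rightarrow> 'o \<Rightarrow> 'a list \<Rightarrow> bool" where
  "lax_product T Xs P ps \<longleftrightarrow> cone T Xs P ps \<and>
    (\<forall>Y \<in> Obj T. equivalence_of_categories (hom_groupoid T Y P)
      (list_category (map (hom_groupoid T Y) Xs)) (induced_func T ps))"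

definition strong_product :: "('o, 'a, 't) track_category \<Rightarrow> 'o list \<Rightarrow> 'o \<Rightarrow> 'a list \<Rightarrow> bool" where
  "strong_product T Xs P ps \<longleftrightarrow> cone T Xs P ps \<and>
    (\<forall>Y \<in> Obj T. isomorphism_of_categories (hom_groupoid T Y P)
      (list_category (map (hom_groupoid T Y) Xs)) (induced_func T ps))"

definition track_theory :: "('o, 'a, 't) track_category \<Rightarrow> bool" where
  "track_theory T \<longleftrightarrow> track_category T \<and>
    (\<forall>Xs. set Xs \<subseteq> Obj T \<longrightarrow> (\<exists>P ps. lax_product T Xs P ps))"

definition strong_track_theory :: "('o, 'a, 't) track_category \<Rightarrow> bool" where
  "strong_track_theory T \<longleftrightarrow> track_theory T \<and>
    (\<forall>Xs. set Xs \<subseteq> Obj T \<longrightarrow> (\<exists>P ps. strong_product T Xs P ps))"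

definition track_theory_morphism :: "('o, 'a, 't) track_category \<Rightarrow> ('p, 'b, 's) track_category \<Rightarrow>
    ('o, 'a, 't, 'p, 'b, 's) track_map \<Rightarrow> bool" where
  "track_theory_morphism S T F \<longleftrightarrow> track_theory S \<and> track_theory T \<and> track_functor S T F \<and>
    (\<forall>Xs P ps. set Xs \<subseteq> Obj S \<and> lax_product S Xs P ps \<longrightarrow>
      lax_product T (map (on_ob F) Xs) (on_ob F P) (map (on_arr F) ps))"

definition equivalence_of_track_theories ::
    "('o, 'a, 't) track_category \<Rightarrow> ('p, 'b, 's) track_category \<Rightarrow>
     ('o, 'a, 't, 'p, 'b, 's) track_map \<Rightarrow> bool" where
  "equivalence_of_track_theories S T F \<longleftrightarrow> track_theory_morphism S T F \<and> weak_equivalence S T F"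

text \<open>The generated equivalence relation relates track theories over a common triple of types.\<close>

definition equivalent_track_theories ::
    "('o, 'a, 't) track_category \<Rightarrow> ('o, 'a, 't) track_category \<Rightarrow> bool" where
  "equivalent_track_theories S T \<longleftrightarrow> track_theory S \<and> track_theory T \<and>
    equivclp (\<lambda>U V. \<exists>F. equivalence_of_track_theories U V F) S T"


section \<open>Lax functors and lax equivalences\<close>

record ('o, 'a, 't, 'p, 'b, 's) lax_map = "('o, 'a, 't, 'p, 'b, 's) track_map" +
  unit_trk :: "'o \<Rightarrow> 's"
  comp_trk :: "'a \<Rightarrow> 'a \<Rightarrow> 's"

locale lax_functor = S: track_category S + T: track_category T
  for S :: "('o, 'a, 't) track_category" and T :: "('p, 'b, 's) track_category" +
  fixes F :: "('o, 'a, 't, 'p, 'b, 's) lax_map"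
  assumes on_ob_in: "X \<in> Obj S \<Longrightarrow> on_ob F X \<in> Obj T"
    and hom_functor: "X \<in> Obj S \<Longrightarrow> Y \<in> Obj S \<Longrightarrow>
      cat_functor (hom_groupoid S X Y) (hom_groupoid T (on_ob F X) (on_ob F Y)) (hom_func F)"
    and unit_trk_in: "X \<in> Obj S \<Longrightarrow>
      unit_trk F X \<in> tracks T (Idt T (on_ob F X)) (on_arr F (Idt S X))"
    and comp_trk_in: "f \<in> Hom S Y Z \<Longrightarrow> g \<in> Hom S X Y \<Longrightarrow>
      comp_trk F f g \<in> tracks T (Cmp T (on_arr F f) (on_arr F g)) (on_arr F (Cmp S f g))"
    and comp_trk_natural: "f \<in> Hom S Y Z \<Longrightarrow> f' \<in> Hom S Y Z \<Longrightarrow> g \<in> Hom S X Y \<Longrightarrow> g' \<in> Hom S X Y \<Longrightarrow>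
      \<beta> \<in> tracks S f f' \<Longrightarrow> \<alpha> \<in> tracks S g g' \<Longrightarrow>
      VCmp T (comp_trk F f' g') (HCmp T (on_trk F \<beta>) (on_trk F \<alpha>)) =
      VCmp T (on_trk F (HCmp S \<beta> \<alpha>)) (comp_trk F f g)"
    and left_unit: "f \<in> Hom S X Y \<Longrightarrow>
      VCmp T (comp_trk F (Idt S Y) f) (HCmp T (unit_trk F Y) (TId T (on_arr F f))) =
      TId T (on_arr F f)"
    and right_unit: "f \<in> Hom S X Y \<Longrightarrow>
      VCmp T (comp_trk F f (Idt S X)) (HCmp T (TId T (on_arr F f)) (unit_trk F X)) =
      TId T (on_arr F f)"
    and associativity: "f \<in> Hom S Y Z \<Longrightarrow> g \<in> Hom S X Y \<Longrightarrow> h \<in> Hom S W X \<Longrightarrow>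
      VCmp T (comp_trk F f (Cmp S g h)) (HCmp T (TId T (on_arr F f)) (comp_trk F g h)) =
      VCmp T (comp_trk F (Cmp S f g) h) (HCmp T (comp_trk F f g) (TId T (on_arr F h)))"

definition homotopy_func :: "('p, 'b, 's) track_category \<Rightarrow>
    ('o, 'a, 't, 'p, 'b, 's, 'z) track_map_scheme \<Rightarrow> ('o, 'a set, 'p, 'b set) func" where
  "homotopy_func T F = \<lparr>fob = on_ob F, fmor = (\<lambda>c. homotopy T `` (on_arr F ` c))\<rparr>"

definition lax_equivalence :: "('o, 'a, 't) track_category \<Rightarrow> ('p, 'b, 's) track_category \<Rightarrow>
    ('o, 'a, 't, 'p, 'b, 's) lax_map \<Rightarrow> bool" where
  "lax_equivalence S T F \<longleftrightarrow> lax_functor S T F \<and>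
    equivalence_of_categories (homotopy_category S) (homotopy_category T) (homotopy_func T F) \<and>
    (\<forall>f \<in> Mor S. on_trk F \<in> iso (Aut S f) (Aut T (on_arr F f)))"


section \<open>A common universe\<close>

text \<open>HOL cannot quantify existentially over types, so the track theories to be constructed from \<open>T\<close>
  need carrier types fixed in advance. Their objects, 1-arrows and tracks are all taken from
  one type: finite formal expressions in the cells of \<open>T\<close>. This
  bounds their size by that of \<open>T\<close> (or by a countable set, if that is larger), and the universe
  also contains a copy of \<open>T\<close> itself.\<close>

datatype ('o, 'a, 't) cell =
  ObjCell 'o | ArrCell 'a | TrkCell 't | Form "('o, 'a, 't) cell list"

type_synonym ('o, 'a, 't) cell_track_category =
  "(('o, 'a, 't) cell, ('o, 'a, 't) cell, ('o, 'a, 't) cell) track_category"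

text \<open>Transport of structure along (injective) renamings of objects, 1-arrows and tracks.\<close>

definition rename :: "('o \<Rightarrow> 'p) \<Rightarrow> ('a \<Rightarrow> 'b) \<Rightarrow> ('t \<Rightarrow> 's) \<Rightarrow>
    ('o, 'a, 't) track_category \<Rightarrow> ('p, 'b, 's) track_category" where
  "rename i j k T =
    \<lparr>Obj = i ` Obj T,
     Mor = j ` Mor T,
     Src = (\<lambda>f. i (Src T (inv_into UNIV j f))),
     Tgt = (\<lambda>f. i (Tgt T (inv_into UNIV j f))),
     Idt = (\<lambda>X. j (Idt T (inv_into UNIV i X))),
     Cmp = (\<lambda>g f. j (Cmp T (inv_into UNIV j g) (inv_into UNIV j f))),
     Trk = k ` Trk T,
     TSrc = (\<lambda>\<alpha>. j (TSrc T (inv_into UNIV k \<alpha>))),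
     TTgt = (\<lambda>\<alpha>. j (TTgt T (inv_into UNIV k \<alpha>))),
     TId = (\<lambda>f. k (TId T (inv_into UNIV j f))),
     VCmp = (\<lambda>\<beta> \<alpha>. k (VCmp T (inv_into UNIV k \<beta>) (inv_into UNIV k \<alpha>))),
     HCmp = (\<lambda>\<beta> \<alpha>. k (HCmp T (inv_into UNIV k \<beta>) (inv_into UNIV k \<alpha>)))\<rparr>"

end

theory Submission
  imports Defs
begin

text \<open>Strict products are obtained by making products free. Fix for every list of objects of \<open>T\<close> a lax
product. The objects of \<open>T'\<close> are lists of objects of \<open>T\<close>, and a 1-arrow from \<open>Xs\<close> to \<open>Ys\<close> is a list of
terms, one for each entry of \<open>Ys\<close>; a term is a variable, which names an entry of \<open>Xs\<close>, or a 1-arrow \<open>f\<close>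
of \<open>T\<close> out of a chosen product, applied to a list of terms whose types are the factors. Composition is
substitution, which is strictly associative, and concatenation of lists is a strict product: a list
of terms is split into blocks in exactly one way.

Terms can be evaluated in \<open>T\<close>: a variable becomes a projection, a list of terms becomes a 1-arrow into
the chosen product, and \<open>f\<close> applied to a list becomes a composite. Since tupling commutes with
precomposition only up to a track, evaluation takes substitution to composition only up to a
comparison track. This track is built by recursion on terms from the universal property, which
determines it uniquely, so it is coherent (\<open>comparisons_vars\<close>, \<open>comparisons_unit_right\<close>,
\<open>comparisons_assoc\<close>): evaluation is a pseudofunctor from the category of terms to \<open>T\<close>.

Along any pseudofunctor \<open>E\<close> from a plain category the tracks of \<open>T\<close> can be pulled back: a track
\<open>f \<Rightarrow> g\<close> is a track \<open>E f \<Rightarrow> E g\<close>, composed horizontally by conjugation with the comparison tracks. This is a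
track category (\<open>track_category_tracks_along\<close>) with a lax functor to \<open>T\<close> that is bijective on tracks. For
the category of terms this defines \<open>T'\<close>. Every 1-arrow between chosen products is homotopic to the value
of a list of terms, so the lax functor is a lax equivalence (\<open>lax_equivalence_T'\<close>). The product
property of \<open>T'\<close> is strict on 1-arrows by construction of the terms, and on tracks it is the full
faithfulness of the chosen lax products (\<open>coord_lift\<close>, \<open>strong_product_blocks\<close>).

The comparison tracks are what keeps \<open>T'\<close> from mapping strictly to \<open>T\<close>; on the terms
\<open>f\<^sub>1 (f\<^sub>2 (\<dots> x))\<close> in a single variable they can be avoided. If the chosen product of a list with one entry
is that entry, with the identity as projection, then evaluation of these unary terms is
composition on the nose. So \<open>T''\<close>, the part of \<open>T'\<close> given by one-element lists and unary terms, has strict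
functors to \<open>T\<close> and to \<open>T'\<close>. Both are weak equivalences, because every 1-arrow of \<open>T\<close> is the value of a
unary term and every list is homotopy equivalent to the one-element list on its chosen product.
Weak equivalences preserve and reflect lax products (\<open>weak_equivalence_preserves_lax_products\<close>,
\<open>weak_equivalence_reflects_lax_products\<close>), so \<open>T''\<close> is a track theory and the two functors are morphisms of
track theories. Commutativity of the groups of tracks passes along functors that are bijective on
tracks.\<close>

section \<open>Functors that are fully faithful and essentially surjective\<close>

definition fully_faithful ::
    "('o, 'm, 'z) category_scheme \<Rightarrow> ('p, 'n, 'y) category_scheme \<Rightarrow> ('o, 'm, 'p, 'n) func \<Rightarrow> bool" where
  "fully_faithful C D F \<longleftrightarrow> (\<forall>X \<in> Obj C. \<forall>Y \<in> Obj C.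
    bij_betw (fmor F) (Hom C X Y) (Hom D (fob F X) (fob F Y)))"

lemma (in category) Hom_objects: "f \<in> Hom C X Y \<Longrightarrow> X \<in> Obj C \<and> Y \<in> Obj C"
  using Src_in Tgt_in unfolding Hom_def by blast

lemma (in category) Mor_Hom: "f \<in> Mor C \<Longrightarrow> f \<in> Hom C (Src C f) (Tgt C f)"
  unfolding Hom_def by blast

lemma HomD: "f \<in> Hom C X Y \<Longrightarrow> f \<in> Mor C \<and> Src C f = X \<and> Tgt C f = Y"
  unfolding Hom_def by blast

lemma isomorphismI:
  assumes "f \<in> Hom C X Y" "g \<in> Hom C Y X" "Cmp C g f = Idt C X" "Cmp C f g = Idt C Y"
  shows "isomorphism C f"
  using assms unfolding isomorphism_def Hom_def by auto

lemma isomorphismE: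
  assumes "isomorphism C f" "f \<in> Hom C X Y"
  obtains g where "g \<in> Hom C Y X" "Cmp C g f = Idt C X" "Cmp C f g = Idt C Y"
  using assms unfolding isomorphism_def Hom_def by auto

context category
begin

text \<open>The axioms in terms of sources and targets, a form in which the simplifier can use them.\<close>

lemma Cmp_Mor: "g \<in> Mor C \<Longrightarrow> f \<in> Mor C \<Longrightarrow> Src C g = Tgt C f \<Longrightarrow> Cmp C g f \<in> Mor C"
  and Src_Cmp: "g \<in> Mor C \<Longrightarrow> f \<in> Mor C \<Longrightarrow> Src C g = Tgt C f \<Longrightarrow> Src C (Cmp C g f) = Src C f"
  and Tgt_Cmp: "g \<in> Mor C \<Longrightarrow> f \<in> Mor C \<Longrightarrow> Src C g = Tgt C f \<Longrightarrow> Tgt C (Cmp C g f) = Tgt C g"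
  using Cmp_in[of g "Tgt C f" "Tgt C g" f "Src C f"] unfolding Hom_def by auto

lemma Idt_Mor: "X \<in> Obj C \<Longrightarrow> Idt C X \<in> Mor C"
  and Src_Idt: "X \<in> Obj C \<Longrightarrow> Src C (Idt C X) = X"
  and Tgt_Idt: "X \<in> Obj C \<Longrightarrow> Tgt C (Idt C X) = X"
  using Idt_in[of X] unfolding Hom_def by auto

lemma Cmp_Idt_left: "f \<in> Mor C \<Longrightarrow> Tgt C f = Y \<Longrightarrow> Cmp C (Idt C Y) f = f"
  and Cmp_Idt_right: "f \<in> Mor C \<Longrightarrow> Src C f = Y \<Longrightarrow> Cmp C f (Idt C Y) = f"
  using Idt_left[OF Mor_Hom] Idt_right[OF Mor_Hom] by blast+

lemma Cmp_Cmp: "h \<in> Mor C \<Longrightarrow> g \<in> Mor C \<Longrightarrow> f \<in> Mor C \<Longrightarrow> Src C h = Tgt C g \<Longrightarrow> Src C g = Tgt C f \<Longrightarrow>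
    Cmp C (Cmp C h g) f = Cmp C h (Cmp C g f)"
  using Cmp_assoc[of h "Tgt C g" "Tgt C h" g "Tgt C f" f "Src C f"] unfolding Hom_def by auto

lemmas cat_simps = Cmp_Mor Src_Cmp Tgt_Cmp Idt_Mor Src_Idt Tgt_Idt Cmp_Idt_left Cmp_Idt_right Cmp_Cmp
  Src_in Tgt_in

lemma Cmp_cancel: "Cmp C d e = Idt C X \<Longrightarrow> d \<in> Mor C \<Longrightarrow> e \<in> Mor C \<Longrightarrow> Src C d = Tgt C e \<Longrightarrow> f \<in> Mor C \<Longrightarrow>
    Tgt C f = X \<Longrightarrow> Src C e = X \<Longrightarrow> Cmp C d (Cmp C e f) = f"
  using Cmp_Cmp[of d e f] Cmp_Idt_left by simp

lemma iso_cancel_left: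
  assumes "isomorphism C e" "e \<in> Hom C Y Z" "f \<in> Hom C X Y" "g \<in> Hom C X Y" "Cmp C e f = Cmp C e g"
  shows "f = g"
proof -
  obtain d where d: "d \<in> Hom C Z Y" "Cmp C d e = Idt C Y"
    using isomorphismE[OF assms(1,2)] by blast
  note typed = HomD[OF assms(2)] HomD[OF assms(3)] HomD[OF assms(4)] HomD[OF d(1)]
  have "Cmp C d (Cmp C e f) = f" "Cmp C d (Cmp C e g) = g"
    by (rule Cmp_cancel[OF d(2)]; use typed in simp)+
  then show ?thesis unfolding assms(5) by (rule trans[OF sym])
qed

lemma iso_cancel_right:
  assumes "isomorphism C e" "e \<in> Hom C X Y" "f \<in> Hom C Y Z" "g \<in> Hom C Y Z" "Cmp C f e = Cmp C g e"
  shows "f = g"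
proof -
  obtain d where d: "d \<in> Hom C Y X" "Cmp C e d = Idt C Y"
    using isomorphismE[OF assms(1,2)] by blast
  note typed = HomD[OF assms(2)] HomD[OF assms(3)] HomD[OF assms(4)] HomD[OF d(1)]
  have "Cmp C (Cmp C f e) d = f" "Cmp C (Cmp C g e) d = g"
    using typed d(2) by (simp_all add: cat_simps)
  then show ?thesis unfolding assms(5) by (rule trans[OF sym])
qed

end

lemma (in cat_functor) fmor_Mor: "f \<in> Mor C \<Longrightarrow> fmor F f \<in> Mor D"
  and Src_fmor: "f \<in> Mor C \<Longrightarrow> Src D (fmor F f) = fob F (Src C f)"
  and Tgt_fmor: "f \<in> Mor C \<Longrightarrow> Tgt D (fmor F f) = fob F (Tgt C f)"
  using fmor_in[OF S.Mor_Hom] unfolding Hom_def by auto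

lemma (in cat_functor) fmor_Cmp': "g \<in> Mor C \<Longrightarrow> f \<in> Mor C \<Longrightarrow> Src C g = Tgt C f \<Longrightarrow>
    fmor F (Cmp C g f) = Cmp D (fmor F g) (fmor F f)"
  using fmor_Cmp[of g "Tgt C f" "Tgt C g" f "Src C f"] unfolding Hom_def by auto

lemmas (in cat_functor) fun_simps = fmor_Mor Src_fmor Tgt_fmor fmor_Cmp' fmor_Idt fob_in

text \<open>Choose for every object \<open>Y\<close> of \<open>D\<close> an isomorphism from the image of some \<open>g Y\<close> to \<open>Y\<close>. Conjugation by
  these isomorphisms followed by the inverse of \<open>F\<close> on morphisms is a functor, because \<open>F\<close> is faithful.\<close>

lemma (in cat_functor) equivalence_of_categoriesI:
  assumes ff: "fully_faithful C D F"
    and eso: "\<And>Y. Y \<in> Obj D \<Longrightarrow> \<exists>X \<in> Obj C. isomorphic D (fob F X) Y"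
  shows "equivalence_of_categories C D F"
proof -
  have "\<forall>Y. \<exists>X e e'. Y \<in> Obj D \<longrightarrow> X \<in> Obj C \<and> e \<in> Hom D (fob F X) Y \<and> e' \<in> Hom D Y (fob F X) \<and>
      Cmp D e' e = Idt D (fob F X) \<and> Cmp D e e' = Idt D Y"
    using eso unfolding isomorphic_def by (metis isomorphismE)
  then obtain g e e' where ch: "\<And>Y. Y \<in> Obj D \<Longrightarrow> g Y \<in> Obj C \<and> e Y \<in> Hom D (fob F (g Y)) Y \<and>
      e' Y \<in> Hom D Y (fob F (g Y)) \<and> Cmp D (e' Y) (e Y) = Idt D (fob F (g Y)) \<and>
      Cmp D (e Y) (e' Y) = Idt D Y"
    by metis
  define G where "G = \<lparr>fob = g, fmor = (\<lambda>f. inv_into (Hom C (g (Src D f)) (g (Tgt D f))) (fmor F)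
      (Cmp D (e' (Tgt D f)) (Cmp D f (e (Src D f)))))\<rparr>"
  have fob_G[simp]: "fob G = g" by (simp add: G_def)
  have inj: "a = b" if "a \<in> Hom C X Y" "b \<in> Hom C X Y" "fmor F a = fmor F b" for a b X Y
    using that ff S.Hom_objects[OF that(1)] unfolding fully_faithful_def bij_betw_def inj_on_def by blast
  have surj: "\<exists>f \<in> Hom C X Y. fmor F f = h"
    if "X \<in> Obj C" "Y \<in> Obj C" "h \<in> Hom D (fob F X) (fob F Y)" for X Y h
    using that ff unfolding fully_faithful_def bij_betw_def by (metis imageE)
  have conj_in: "Cmp D (e' Z) (Cmp D f (e Y)) \<in> Hom D (fob F (g Y)) (fob F (g Z))"
    if "f \<in> Hom D Y Z" for f Y Z
    using ch T.Hom_objects[OF that] T.Cmp_in[OF _ T.Cmp_in[OF that]] by blast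
  have G_mor: "fmor G f \<in> Hom C (g Y) (g Z) \<and> fmor F (fmor G f) = Cmp D (e' Z) (Cmp D f (e Y))"
    if f: "f \<in> Hom D Y Z" for f Y Z
  proof -
    have "Cmp D (e' Z) (Cmp D f (e Y)) \<in> fmor F ` Hom C (g Y) (g Z)"
      using surj[OF _ _ conj_in[OF f]] ch T.Hom_objects[OF f] by (metis image_eqI)
    then show ?thesis using HomD[OF f] unfolding G_def
      by (auto simp: inv_into_into f_inv_into_f)
  qed
  have e_iso: "isomorphism D (e Y)" "isomorphism D (e' Y)" if "Y \<in> Obj D" for Y
    using ch[OF that] isomorphismI by metis+
  have eG: "Cmp D (e Z) (fmor F (fmor G f)) = Cmp D f (e Y)" if f: "f \<in> Hom D Y Z" for f Y Z
  proof -
    have o: "Y \<in> Obj D" "Z \<in> Obj D" using T.Hom_objects[OF f] by auto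
    have "Cmp D (e Z) (Cmp D (e' Z) (Cmp D f (e Y))) = Cmp D f (e Y)"
      by (rule T.Cmp_cancel[of _ _ Z]; use ch[OF o(1)] ch[OF o(2)] f in \<open>simp add: Hom_def T.cat_simps\<close>)
    then show ?thesis using G_mor[OF f] by simp
  qed
  interpret G: cat_functor D C G
  proof
    show "fob G X \<in> Obj C" if "X \<in> Obj D" for X using ch[OF that] by simp
    show "fmor G f \<in> Hom C (fob G X) (fob G Y)" if "f \<in> Hom D X Y" for f X Y
      using G_mor[OF that] by simp
    show "fmor G (Idt D X) = Idt C (fob G X)" if X: "X \<in> Obj D" for X
    proof -
      have "fmor F (fmor G (Idt D X)) = fmor F (Idt C (g X))"
        using G_mor[OF T.Idt_in[OF X]] ch[OF X] fmor_Idt[of "g X"] T.Idt_left[of "e X" "fob F (g X)" X] by simp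
      then show ?thesis using inj[of _ "g X" "g X"] G_mor[OF T.Idt_in[OF X]] S.Idt_in ch[OF X]
        by (metis fob_G)
    qed
    show "fmor G (Cmp D h f) = Cmp C (fmor G h) (fmor G f)"
      if h: "h \<in> Hom D Y Z" and f: "f \<in> Hom D X Y" for h f X Y Z
    proof -
      have hf: "Cmp D h f \<in> Hom D X Z" using h f T.Cmp_in by blast
      have o: "X \<in> Obj D" "Y \<in> Obj D" "Z \<in> Obj D" using T.Hom_objects h f by blast+
      note Gh = G_mor[OF h] and Gf = G_mor[OF f] and Ghf = G_mor[OF hf]
      have in1: "fmor F (fmor G h) \<in> Hom D (fob F (g Y)) (fob F (g Z))"
        "fmor F (fmor G f) \<in> Hom D (fob F (g X)) (fob F (g Y))"
        "fmor F (fmor G (Cmp D h f)) \<in> Hom D (fob F (g X)) (fob F (g Z))"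
        using Gh Gf Ghf fmor_in by blast+
      note e_in = ch[OF o(1), THEN conjunct2, THEN conjunct1] ch[OF o(2), THEN conjunct2, THEN conjunct1]
        ch[OF o(3), THEN conjunct2, THEN conjunct1]
      have "Cmp D (e Z) (Cmp D (fmor F (fmor G h)) (fmor F (fmor G f)))
          = Cmp D (Cmp D h (e Y)) (fmor F (fmor G f))"
        using eG[OF h] T.Cmp_assoc[OF e_in(3) in1(1) in1(2)] by simp
      also have "\<dots> = Cmp D h (Cmp D f (e X))"
        using eG[OF f] T.Cmp_assoc[OF h e_in(2) in1(2)] by simp
      also have "\<dots> = Cmp D (e Z) (fmor F (fmor G (Cmp D h f)))"
        using eG[OF hf] T.Cmp_assoc[OF h f e_in(1)] by simp
      finally have "Cmp D (fmor F (fmor G h)) (fmor F (fmor G f)) = fmor F (fmor G (Cmp D h f))"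
        using T.iso_cancel_left[OF e_iso(1)[OF o(3)] e_in(3) T.Cmp_in[OF in1(1) in1(2)] in1(3)] by blast
      then show ?thesis
        using inj[OF _ S.Cmp_in] Gh Gf Ghf fmor_Cmp[of "fmor G h" _ _ "fmor G f"] by (metis (no_types))
    qed
  qed
  have "naturally_isomorphic D D (comp_func F G) id_func"
    unfolding naturally_isomorphic_def comp_func_def id_func_def
    using ch e_iso eG[OF T.Mor_Hom] by (intro exI[of _ e]) (auto)
  moreover have "naturally_isomorphic C C (comp_func G F) id_func"
  proof -
    have "\<forall>X. \<exists>d. X \<in> Obj C \<longrightarrow> d \<in> Hom C (g (fob F X)) X \<and> fmor F d = e (fob F X)"
      using surj ch fob_in by metis
    then obtain d where d: "\<And>X. X \<in> Obj C \<Longrightarrow> d X \<in> Hom C (g (fob F X)) X \<and> fmor F (d X) = e (fob F X)"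
      by metis
    have iso: "isomorphism C (d X)" if X: "X \<in> Obj C" for X
    proof -
      let ?Y = "fob F X"
      have Y: "?Y \<in> Obj D" using X fob_in by blast
      obtain d' where d': "d' \<in> Hom C X (g ?Y)" "fmor F d' = e' ?Y"
        using surj ch[OF Y] X by metis
      have "fmor F (Cmp C d' (d X)) = fmor F (Idt C (g ?Y))"
        using d[OF X] d'(2) fmor_Cmp[OF d'(1), of "d X" "g ?Y"] ch[OF Y] fmor_Idt[of "g ?Y"] by simp
      then have 1: "Cmp C d' (d X) = Idt C (g ?Y)"
        using inj[OF S.Cmp_in[OF d'(1)] S.Idt_in] d[OF X] ch[OF Y] by blast
      have "fmor F (Cmp C (d X) d') = fmor F (Idt C X)"
        using d[OF X] d'(2) fmor_Cmp[OF _ d'(1), of "d X" X] ch[OF Y] fmor_Idt[OF X] by simp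
      then have 2: "Cmp C (d X) d' = Idt C X"
        using inj[OF S.Cmp_in[OF _ d'(1)] S.Idt_in] d[OF X] X by blast
      show ?thesis using isomorphismI[OF _ d'(1) 1 2] d[OF X] by blast
    qed
    have nat: "Cmp C f (d X) = Cmp C (d Y) (fmor G (fmor F f))" if f: "f \<in> Hom C X Y" for f X Y
    proof -
      note o = S.Hom_objects[OF f]
      note Gf = G_mor[OF fmor_in[OF f]]
      have dX: "d X \<in> Hom C (g (fob F X)) X" and dY: "d Y \<in> Hom C (g (fob F Y)) Y" using d o by auto
      have "fmor F (Cmp C f (d X)) = fmor F (Cmp C (d Y) (fmor G (fmor F f)))"
        using fmor_Cmp[OF f dX] fmor_Cmp[OF dY Gf[THEN conjunct1]] d o eG[OF fmor_in[OF f]] by simp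
      then show ?thesis using inj[OF S.Cmp_in[OF f dX] S.Cmp_in[OF dY Gf[THEN conjunct1]]] by blast
    qed
    show ?thesis
      unfolding naturally_isomorphic_def comp_func_def id_func_def
      using d iso nat[OF S.Mor_Hom] by (intro exI[of _ d]) auto
  qed
  ultimately show ?thesis
    unfolding equivalence_of_categories_def using cat_functor_axioms G.cat_functor_axioms by blast
qed

lemma equivalence_of_categoriesD:
  assumes "equivalence_of_categories C D F"
  shows "cat_functor C D F" and "fully_faithful C D F"
    and "\<And>Y. Y \<in> Obj D \<Longrightarrow> \<exists>X \<in> Obj C. isomorphic D (fob F X) Y"
proof -
  show F: "cat_functor C D F" using assms unfolding equivalence_of_categories_def by blast
  interpret F: cat_functor C D F by (fact F)
  obtain G where G: "cat_functor D C G"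
    and GF: "naturally_isomorphic C C (comp_func G F) id_func"
    and FG: "naturally_isomorphic D D (comp_func F G) id_func"
    using assms unfolding equivalence_of_categories_def by blast
  obtain \<eta> where \<eta>: "\<And>X. X \<in> Obj C \<Longrightarrow> \<eta> X \<in> Hom C (fob G (fob F X)) X \<and> isomorphism C (\<eta> X)"
    and \<eta>_nat: "\<And>f. f \<in> Mor C \<Longrightarrow> Cmp C f (\<eta> (Src C f)) = Cmp C (\<eta> (Tgt C f)) (fmor G (fmor F f))"
    using GF unfolding naturally_isomorphic_def comp_func_def id_func_def by auto
  obtain \<epsilon> where \<epsilon>: "\<And>X. X \<in> Obj D \<Longrightarrow> \<epsilon> X \<in> Hom D (fob F (fob G X)) X \<and> isomorphism D (\<epsilon> X)"
    and \<epsilon>_nat: "\<And>f. f \<in> Mor D \<Longrightarrow> Cmp D f (\<epsilon> (Src D f)) = Cmp D (\<epsilon> (Tgt D f)) (fmor F (fmor G f))"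
    using FG unfolding naturally_isomorphic_def comp_func_def id_func_def by auto
  interpret G: cat_functor D C G by (fact G)
  show "\<exists>X \<in> Obj C. isomorphic D (fob F X) Y" if "Y \<in> Obj D" for Y
    using \<epsilon>[OF that] G.fob_in[OF that] unfolding isomorphic_def by blast
  have inj_F: "a = b" if ab: "a \<in> Hom C X Y" "b \<in> Hom C X Y" "fmor F a = fmor F b" for a b X Y
  proof -
    have o: "X \<in> Obj C" "Y \<in> Obj C" using F.S.Hom_objects ab by blast+
    have "Cmp C a (\<eta> X) = Cmp C b (\<eta> X)" using \<eta>_nat[of a] \<eta>_nat[of b] ab HomD by metis
    then show ?thesis using F.S.iso_cancel_right[OF _ _ ab(1,2)] \<eta>[OF o(1)] by blast
  qed
  have inj_G: "a = b" if ab: "a \<in> Hom D X Y" "b \<in> Hom D X Y" "fmor G a = fmor G b" for a b X Y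
  proof -
    have o: "X \<in> Obj D" "Y \<in> Obj D" using F.T.Hom_objects ab by blast+
    have "Cmp D a (\<epsilon> X) = Cmp D b (\<epsilon> X)" using \<epsilon>_nat[of a] \<epsilon>_nat[of b] ab HomD by metis
    then show ?thesis using F.T.iso_cancel_right[OF _ _ ab(1,2)] \<epsilon>[OF o(1)] by blast
  qed
  show "fully_faithful C D F"
    unfolding fully_faithful_def bij_betw_def
  proof (intro ballI conjI equalityI subsetI)
    fix X Y assume o: "X \<in> Obj C" "Y \<in> Obj C"
    show "inj_on (fmor F) (Hom C X Y)" using inj_F by (meson inj_onI)
    show "h \<in> Hom D (fob F X) (fob F Y)" if "h \<in> fmor F ` Hom C X Y" for h
      using that F.fmor_in by blast
    fix h assume h: "h \<in> Hom D (fob F X) (fob F Y)"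
    obtain \<eta>' where \<eta>': "\<eta>' \<in> Hom C X (fob G (fob F X))" "Cmp C \<eta>' (\<eta> X) = Idt C (fob G (fob F X))"
      "Cmp C (\<eta> X) \<eta>' = Idt C X"
      using \<eta>[OF o(1)] isomorphismE by metis
    \<comment> \<open>The preimage of \<open>h\<close> is \<open>G h\<close> conjugated by the natural isomorphism of the identity with \<open>G F\<close>.\<close>
    define f where "f = Cmp C (\<eta> Y) (Cmp C (fmor G h) \<eta>')"
    note Gh = G.fmor_in[OF h]
    note typed = HomD[OF \<eta>[OF o(1), THEN conjunct1]] HomD[OF \<eta>[OF o(2), THEN conjunct1]]
      HomD[OF \<eta>'(1)] HomD[OF Gh]
    have f: "f \<in> Hom C X Y" unfolding f_def Hom_def using typed by (simp add: F.S.cat_simps)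
    have "Cmp C (\<eta> Y) (fmor G (fmor F f)) = Cmp C f (\<eta> X)"
      using \<eta>_nat[of f] HomD[OF f] by metis
    also have "\<dots> = Cmp C (\<eta> Y) (Cmp C (Cmp C (fmor G h) \<eta>') (\<eta> X))"
      unfolding f_def using typed by (simp add: F.S.cat_simps)
    also have "\<dots> = Cmp C (\<eta> Y) (fmor G h)"
      using typed \<eta>'(2) by (simp add: F.S.cat_simps)
    finally have "fmor G (fmor F f) = fmor G h"
      using F.S.iso_cancel_left[OF _ _ G.fmor_in[OF F.fmor_in[OF f]] Gh] \<eta>[OF o(2)] by blast
    then have "fmor F f = h" using inj_G F.fmor_in[OF f] h by metis
    then show "h \<in> fmor F ` Hom C X Y" using f by blast
  qed
qed

lemma (in cat_functor) isomorphism_of_categoriesI: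
  assumes ff: "fully_faithful C D F" and bij: "bij_betw (fob F) (Obj C) (Obj D)"
  shows "isomorphism_of_categories C D F"
proof -
  define g where "g = inv_into (Obj C) (fob F)"
  have g: "g Y \<in> Obj C" "fob F (g Y) = Y" if "Y \<in> Obj D" for Y
    using that bij unfolding g_def bij_betw_def by (auto simp: inv_into_into f_inv_into_f)
  have gF: "g (fob F X) = X" if "X \<in> Obj C" for X
    using that bij unfolding g_def bij_betw_def by simp
  define G where "G = \<lparr>fob = g, fmor = (\<lambda>f. inv_into (Hom C (g (Src D f)) (g (Tgt D f))) (fmor F) f)\<rparr>"
  have G_mor: "fmor G f \<in> Hom C (g Y) (g Z) \<and> fmor F (fmor G f) = f" if f: "f \<in> Hom D Y Z" for f Y Z
  proof -
    have o: "Y \<in> Obj D" "Z \<in> Obj D" using T.Hom_objects[OF f] by auto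
    have "f \<in> fmor F ` Hom C (g Y) (g Z)"
      using ff f g o unfolding fully_faithful_def bij_betw_def by metis
    then show ?thesis using HomD[OF f] unfolding G_def by (auto simp: inv_into_into f_inv_into_f)
  qed
  have inj: "a = b" if "a \<in> Hom C X Y" "b \<in> Hom C X Y" "fmor F a = fmor F b" for a b X Y
    using that ff S.Hom_objects[OF that(1)] unfolding fully_faithful_def bij_betw_def inj_on_def by blast
  have GF: "fmor G (fmor F f) = f" if "f \<in> Hom C X Y" for f X Y
    using inj G_mor fmor_in that gF S.Hom_objects[OF that] by metis
  have fob_G[simp]: "fob G = g" by (simp add: G_def)
  have "cat_functor D C G"
  proof
    show "fob G X \<in> Obj C" if "X \<in> Obj D" for X using g that by simp
    show "fmor G f \<in> Hom C (fob G X) (fob G Y)" if "f \<in> Hom D X Y" for f X Y using G_mor that by simp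
    show "fmor G (Idt D X) = Idt C (fob G X)" if X: "X \<in> Obj D" for X
      using GF[OF S.Idt_in] g[OF X] fmor_Idt by (metis fob_G)
    show "fmor G (Cmp D h f) = Cmp C (fmor G h) (fmor G f)"
      if h: "h \<in> Hom D Y Z" and f: "f \<in> Hom D X Y" for h f X Y Z
      using GF[OF S.Cmp_in] G_mor[OF h] G_mor[OF f] fmor_Cmp by metis
  qed
  moreover have "\<forall>X \<in> Obj C. fob G (fob F X) = X" "\<forall>Y \<in> Obj D. fob F (fob G Y) = Y"
    using g gF by simp_all
  moreover have "\<forall>f \<in> Mor C. fmor G (fmor F f) = f" using GF[OF S.Mor_Hom] by blast
  moreover have "\<forall>f \<in> Mor D. fmor F (fmor G f) = f" using G_mor[OF T.Mor_Hom] by blast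
  ultimately show ?thesis
    unfolding isomorphism_of_categories_def using cat_functor_axioms by blast
qed

section \<open>Calculus of tracks\<close>

lemma tracksD: "\<alpha> \<in> tracks T f g \<Longrightarrow> \<alpha> \<in> Trk T \<and> TSrc T \<alpha> = f \<and> TTgt T \<alpha> = g"
  unfolding tracks_def by blast

lemma hom_groupoid_simps [simp]:
  "Obj (hom_groupoid T X Y) = Hom T X Y"
  "Mor (hom_groupoid T X Y) = {\<alpha> \<in> Trk T. TSrc T \<alpha> \<in> Hom T X Y}"
  "Src (hom_groupoid T X Y) = TSrc T"
  "Tgt (hom_groupoid T X Y) = TTgt T"
  "Idt (hom_groupoid T X Y) = TId T"
  "Cmp (hom_groupoid T X Y) = VCmp T"
  by (simp_all add: hom_groupoid_def)

lemma Hom_hom_groupoid: "f \<in> Hom T X Y \<Longrightarrow> Hom (hom_groupoid T X Y) f g = tracks T f g"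
  unfolding Hom_def[of "hom_groupoid T X Y"] tracks_def by auto

context track_category
begin

abbreviation cmp (infixr "\<cdot>" 75) where "g \<cdot> f \<equiv> Cmp T g f"
abbreviation vcmp (infixr "\<bullet>" 65) where "\<beta> \<bullet> \<alpha> \<equiv> VCmp T \<beta> \<alpha>"
abbreviation hcmp (infixr "\<star>" 70) where "\<beta> \<star> \<alpha> \<equiv> HCmp T \<beta> \<alpha>"
abbreviation lwhisker (infixr "\<rhd>" 70) where "g \<rhd> \<alpha> \<equiv> HCmp T (TId T g) \<alpha>"
abbreviation rwhisker (infixl "\<lhd>" 72) where "\<beta> \<lhd> f \<equiv> HCmp T \<beta> (TId T f)"

lemma groupoid_of: "f \<in> Mor T \<Longrightarrow> groupoid (hom_groupoid T (Src T f) (Tgt T f))"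
  using hom_groupoid Src_in Tgt_in by blast

lemma category_of: "f \<in> Mor T \<Longrightarrow> category (hom_groupoid T (Src T f) (Tgt T f))"
  using groupoid_of groupoid.axioms(1) by blast

lemma TTgt_in: "\<alpha> \<in> Trk T \<Longrightarrow> TTgt T \<alpha> \<in> Mor T"
  and Src_TTgt: "\<alpha> \<in> Trk T \<Longrightarrow> Src T (TTgt T \<alpha>) = Src T (TSrc T \<alpha>)"
  and Tgt_TTgt: "\<alpha> \<in> Trk T \<Longrightarrow> Tgt T (TTgt T \<alpha>) = Tgt T (TSrc T \<alpha>)"
  using category.Tgt_in[OF category_of[OF TSrc_in], of \<alpha> \<alpha>] Mor_Hom[OF TSrc_in, of \<alpha>]
  by (auto simp: Hom_def)

lemma TId_Trk: "f \<in> Mor T \<Longrightarrow> TId T f \<in> Trk T"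
  and TSrc_TId: "f \<in> Mor T \<Longrightarrow> TSrc T (TId T f) = f"
  and TTgt_TId: "f \<in> Mor T \<Longrightarrow> TTgt T (TId T f) = f"
  using category.Idt_in[OF category_of, of f f] Mor_Hom[of f]
  by (auto simp: Hom_def)

lemma VCmp_Trk: "\<beta> \<in> Trk T \<Longrightarrow> \<alpha> \<in> Trk T \<Longrightarrow> TSrc T \<beta> = TTgt T \<alpha> \<Longrightarrow> \<beta> \<bullet> \<alpha> \<in> Trk T"
  and TSrc_VCmp: "\<beta> \<in> Trk T \<Longrightarrow> \<alpha> \<in> Trk T \<Longrightarrow> TSrc T \<beta> = TTgt T \<alpha> \<Longrightarrow> TSrc T (\<beta> \<bullet> \<alpha>) = TSrc T \<alpha>"
  and TTgt_VCmp: "\<beta> \<in> Trk T \<Longrightarrow> \<alpha> \<in> Trk T \<Longrightarrow> TSrc T \<beta> = TTgt T \<alpha> \<Longrightarrow> TTgt T (\<beta> \<bullet> \<alpha>) = TTgt T \<beta>"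
  using category.Cmp_in[OF category_of[OF TSrc_in[of \<alpha>]], of \<beta> "TSrc T \<beta>" "TTgt T \<beta>" \<alpha> "TSrc T \<alpha>"]
    Mor_Hom[OF TSrc_in, of \<alpha>] TTgt_in[of \<alpha>] Src_TTgt[of \<alpha>] Tgt_TTgt[of \<alpha>]
  by (auto simp: Hom_def)

lemma VCmp_TId_left: "\<alpha> \<in> Trk T \<Longrightarrow> TTgt T \<alpha> = f \<Longrightarrow> TId T f \<bullet> \<alpha> = \<alpha>"
  and VCmp_TId_right: "\<alpha> \<in> Trk T \<Longrightarrow> TSrc T \<alpha> = f \<Longrightarrow> \<alpha> \<bullet> TId T f = \<alpha>"
  using category.Idt_left[OF category_of[OF TSrc_in[of \<alpha>]], of \<alpha> "TSrc T \<alpha>" "TTgt T \<alpha>"]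
    category.Idt_right[OF category_of[OF TSrc_in[of \<alpha>]], of \<alpha> "TSrc T \<alpha>" "TTgt T \<alpha>"]
    Mor_Hom[OF TSrc_in, of \<alpha>]
  by (auto simp: Hom_def)

lemma VCmp_VCmp: "\<gamma> \<in> Trk T \<Longrightarrow> \<beta> \<in> Trk T \<Longrightarrow> \<alpha> \<in> Trk T \<Longrightarrow> TSrc T \<gamma> = TTgt T \<beta> \<Longrightarrow> TSrc T \<beta> = TTgt T \<alpha> \<Longrightarrow>
    (\<gamma> \<bullet> \<beta>) \<bullet> \<alpha> = \<gamma> \<bullet> \<beta> \<bullet> \<alpha>"
  using category.Cmp_assoc[OF category_of[OF TSrc_in[of \<alpha>]], of \<gamma> "TTgt T \<beta>" "TTgt T \<gamma>" \<beta> "TTgt T \<alpha>" \<alpha> "TSrc T \<alpha>"]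
    Mor_Hom[OF TSrc_in, of \<alpha>] TTgt_in[of \<alpha>] Src_TTgt[of \<alpha>] Tgt_TTgt[of \<alpha>] TTgt_in[of \<beta>] Src_TTgt[of \<beta>] Tgt_TTgt[of \<beta>]
  by (auto simp: Hom_def)

definition TInv where
  "TInv \<alpha> = (SOME \<beta>. \<beta> \<in> tracks T (TTgt T \<alpha>) (TSrc T \<alpha>) \<and> \<beta> \<bullet> \<alpha> = TId T (TSrc T \<alpha>) \<and> \<alpha> \<bullet> \<beta> = TId T (TTgt T \<alpha>))"

lemma TInv: assumes "\<alpha> \<in> Trk T"
  shows TInv_Trk: "TInv \<alpha> \<in> Trk T" and TSrc_TInv: "TSrc T (TInv \<alpha>) = TTgt T \<alpha>"
    and TTgt_TInv: "TTgt T (TInv \<alpha>) = TSrc T \<alpha>"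
    and TInv_left: "TInv \<alpha> \<bullet> \<alpha> = TId T (TSrc T \<alpha>)" and TInv_right: "\<alpha> \<bullet> TInv \<alpha> = TId T (TTgt T \<alpha>)"
proof -
  have "isomorphism (hom_groupoid T (Src T (TSrc T \<alpha>)) (Tgt T (TSrc T \<alpha>))) \<alpha>"
    using groupoid.all_isomorphism[OF groupoid_of[OF TSrc_in[OF assms]], of \<alpha>] assms
      Mor_Hom[OF TSrc_in, of \<alpha>] by simp
  then have "\<exists>\<beta>. \<beta> \<in> tracks T (TTgt T \<alpha>) (TSrc T \<alpha>) \<and> \<beta> \<bullet> \<alpha> = TId T (TSrc T \<alpha>) \<and> \<alpha> \<bullet> \<beta> = TId T (TTgt T \<alpha>)"
    unfolding isomorphism_def Hom_def tracks_def by auto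
  from someI_ex[OF this, folded TInv_def]
  show "TInv \<alpha> \<in> Trk T" "TSrc T (TInv \<alpha>) = TTgt T \<alpha>" "TTgt T (TInv \<alpha>) = TSrc T \<alpha>"
    "TInv \<alpha> \<bullet> \<alpha> = TId T (TSrc T \<alpha>)" "\<alpha> \<bullet> TInv \<alpha> = TId T (TTgt T \<alpha>)"
    unfolding tracks_def by auto
qed

lemma HCmp:
  assumes "\<beta> \<in> Trk T" "\<alpha> \<in> Trk T" "Src T (TSrc T \<beta>) = Tgt T (TSrc T \<alpha>)"
  shows HCmp_Trk: "\<beta> \<star> \<alpha> \<in> Trk T" and TSrc_HCmp: "TSrc T (\<beta> \<star> \<alpha>) = TSrc T \<beta> \<cdot> TSrc T \<alpha>"
    and TTgt_HCmp: "TTgt T (\<beta> \<star> \<alpha>) = TTgt T \<beta> \<cdot> TTgt T \<alpha>"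
proof -
  let ?X = "Src T (TSrc T \<alpha>)" and ?Y = "Tgt T (TSrc T \<alpha>)" and ?Z = "Tgt T (TSrc T \<beta>)"
  interpret c: cat_functor "pair_category (hom_groupoid T ?Y ?Z) (hom_groupoid T ?X ?Y)" "hom_groupoid T ?X ?Z"
    "comp_functor T"
    by (rule comp_functor) (simp_all add: assms TSrc_in Src_in Tgt_in)
  have "(\<beta>, \<alpha>) \<in> Hom (pair_category (hom_groupoid T ?Y ?Z) (hom_groupoid T ?X ?Y))
      (TSrc T \<beta>, TSrc T \<alpha>) (TTgt T \<beta>, TTgt T \<alpha>)"
    using assms Mor_Hom[OF TSrc_in, of \<alpha>] Mor_Hom[OF TSrc_in, of \<beta>]
    by (simp add: Hom_def pair_category_def)
  from c.fmor_in[OF this]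
  show "\<beta> \<star> \<alpha> \<in> Trk T" "TSrc T (\<beta> \<star> \<alpha>) = TSrc T \<beta> \<cdot> TSrc T \<alpha>" "TTgt T (\<beta> \<star> \<alpha>) = TTgt T \<beta> \<cdot> TTgt T \<alpha>"
    by (simp_all add: Hom_def comp_functor_def)
qed

lemma lw_TId:
  assumes "g \<in> Mor T" "f \<in> Mor T" "Src T g = Tgt T f"
  shows "g \<rhd> TId T f = TId T (g \<cdot> f)"
proof -
  interpret c: cat_functor "pair_category (hom_groupoid T (Tgt T f) (Tgt T g)) (hom_groupoid T (Src T f) (Tgt T f))"
    "hom_groupoid T (Src T f) (Tgt T g)" "comp_functor T"
    by (rule comp_functor) (simp_all add: assms Src_in Tgt_in)
  show ?thesis using c.fmor_Idt[of "(g, f)"] assms by (simp add: pair_category_def comp_functor_def Hom_def)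
qed

lemma interchange:
  assumes "\<beta> \<in> Trk T" "\<alpha> \<in> Trk T" "\<beta>' \<in> Trk T" "\<alpha>' \<in> Trk T" "Src T (TSrc T \<beta>) = Tgt T (TSrc T \<alpha>)"
    "TSrc T \<beta>' = TTgt T \<beta>" "TSrc T \<alpha>' = TTgt T \<alpha>"
  shows "(\<beta>' \<star> \<alpha>') \<bullet> (\<beta> \<star> \<alpha>) = (\<beta>' \<bullet> \<beta>) \<star> (\<alpha>' \<bullet> \<alpha>)"
proof -
  let ?X = "Src T (TSrc T \<alpha>)" and ?Y = "Tgt T (TSrc T \<alpha>)" and ?Z = "Tgt T (TSrc T \<beta>)"
  interpret c: cat_functor "pair_category (hom_groupoid T ?Y ?Z) (hom_groupoid T ?X ?Y)" "hom_groupoid T ?X ?Z"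
    "comp_functor T"
    by (rule comp_functor) (simp_all add: assms TSrc_in Src_in Tgt_in)
  have "(\<beta>, \<alpha>) \<in> Mor (pair_category (hom_groupoid T ?Y ?Z) (hom_groupoid T ?X ?Y))"
    "(\<beta>', \<alpha>') \<in> Mor (pair_category (hom_groupoid T ?Y ?Z) (hom_groupoid T ?X ?Y))"
    using assms Mor_Hom[OF TSrc_in, of \<alpha>] Mor_Hom[OF TSrc_in, of \<beta>]
    by (simp_all add: Hom_def pair_category_def Src_TTgt Tgt_TTgt TTgt_in)
  from c.fmor_Cmp'[OF this(2,1)] show ?thesis using assms
    by (simp add: comp_functor_def pair_category_def)
qed

lemma lw_Idt: "\<alpha> \<in> Trk T \<Longrightarrow> Tgt T (TSrc T \<alpha>) = Y \<Longrightarrow> Idt T Y \<rhd> \<alpha> = \<alpha>"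
  and rw_Idt: "\<alpha> \<in> Trk T \<Longrightarrow> Src T (TSrc T \<alpha>) = X \<Longrightarrow> \<alpha> \<lhd> Idt T X = \<alpha>"
  using HCmp_Idt_left[of \<alpha> "Src T (TSrc T \<alpha>)"] HCmp_Idt_right[of \<alpha> _ "Tgt T (TSrc T \<alpha>)"] TSrc_in[of \<alpha>]
  by (auto simp: Hom_def)

lemma HCmp_HCmp:
  assumes "\<gamma> \<in> Trk T" "\<beta> \<in> Trk T" "\<alpha> \<in> Trk T" "Src T (TSrc T \<gamma>) = Tgt T (TSrc T \<beta>)"
    "Src T (TSrc T \<beta>) = Tgt T (TSrc T \<alpha>)"
  shows "(\<gamma> \<star> \<beta>) \<star> \<alpha> = \<gamma> \<star> \<beta> \<star> \<alpha>"
  using HCmp_assoc[of \<gamma> "Tgt T (TSrc T \<beta>)" "Tgt T (TSrc T \<gamma>)" \<beta> "Tgt T (TSrc T \<alpha>)" \<alpha> "Src T (TSrc T \<alpha>)"] assms TSrc_in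
  by (simp add: Hom_def)

lemmas typing = Cmp_Mor Src_Cmp Tgt_Cmp Idt_Mor Src_Idt Tgt_Idt Src_in Tgt_in
  TSrc_in TTgt_in Src_TTgt Tgt_TTgt TId_Trk TSrc_TId TTgt_TId VCmp_Trk TSrc_VCmp TTgt_VCmp
  TInv_Trk TSrc_TInv TTgt_TInv HCmp_Trk TSrc_HCmp TTgt_HCmp

lemmas unit_simps = Cmp_Idt_left Cmp_Idt_right VCmp_TId_left VCmp_TId_right TInv_left TInv_right
  lw_Idt rw_Idt lw_TId

lemma lw_VCmp:
  assumes "\<beta> \<in> Trk T" "\<alpha> \<in> Trk T" "TSrc T \<beta> = TTgt T \<alpha>" "f \<in> Mor T" "Src T f = Tgt T (TSrc T \<alpha>)"
  shows "f \<rhd> (\<beta> \<bullet> \<alpha>) = (f \<rhd> \<beta>) \<bullet> (f \<rhd> \<alpha>)"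
  using assms interchange[of "TId T f" \<alpha> "TId T f" \<beta>] by (simp add: typing unit_simps)

lemma rw_VCmp:
  assumes "\<beta> \<in> Trk T" "\<alpha> \<in> Trk T" "TSrc T \<beta> = TTgt T \<alpha>" "f \<in> Mor T" "Tgt T f = Src T (TSrc T \<alpha>)"
  shows "(\<beta> \<bullet> \<alpha>) \<lhd> f = (\<beta> \<lhd> f) \<bullet> (\<alpha> \<lhd> f)"
  using assms interchange[of \<alpha> "TId T f" \<beta> "TId T f"] by (simp add: typing unit_simps)

text \<open>The horizontal composite is a composite of whiskerings in two ways; the equality of the two is the
  exchange law, through which naturality enters all later computations.\<close>

lemma HCmp_lr:
  assumes "\<beta> \<in> Trk T" "\<alpha> \<in> Trk T" "Src T (TSrc T \<beta>) = Tgt T (TSrc T \<alpha>)"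
  shows "\<beta> \<star> \<alpha> = (\<beta> \<lhd> TTgt T \<alpha>) \<bullet> (TSrc T \<beta> \<rhd> \<alpha>)"
  using assms interchange[of "TId T (TSrc T \<beta>)" \<alpha> \<beta> "TId T (TTgt T \<alpha>)"] by (simp add: typing unit_simps)

lemma HCmp_rl:
  assumes "\<beta> \<in> Trk T" "\<alpha> \<in> Trk T" "Src T (TSrc T \<beta>) = Tgt T (TSrc T \<alpha>)"
  shows "\<beta> \<star> \<alpha> = (TTgt T \<beta> \<rhd> \<alpha>) \<bullet> (\<beta> \<lhd> TSrc T \<alpha>)"
  using assms interchange[of \<beta> "TId T (TSrc T \<alpha>)" "TId T (TTgt T \<beta>)" \<alpha>] by (simp add: typing unit_simps)

lemma lw_lw:
  assumes "\<alpha> \<in> Trk T" "f \<in> Mor T" "g \<in> Mor T" "Src T f = Tgt T (TSrc T \<alpha>)" "Src T g = Tgt T f"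
  shows "g \<rhd> f \<rhd> \<alpha> = g \<cdot> f \<rhd> \<alpha>"
  using assms HCmp_HCmp[of "TId T g" "TId T f" \<alpha>] by (simp add: typing unit_simps)

lemma rw_rw:
  assumes "\<alpha> \<in> Trk T" "f \<in> Mor T" "g \<in> Mor T" "Src T (TSrc T \<alpha>) = Tgt T g" "Src T g = Tgt T f"
  shows "\<alpha> \<lhd> g \<lhd> f = \<alpha> \<lhd> (g \<cdot> f)"
  using assms HCmp_HCmp[of \<alpha> "TId T g" "TId T f"] by (simp add: typing unit_simps)

lemma lw_rw:
  assumes "\<alpha> \<in> Trk T" "f \<in> Mor T" "g \<in> Mor T" "Src T g = Tgt T (TSrc T \<alpha>)" "Src T (TSrc T \<alpha>) = Tgt T f"
  shows "(g \<rhd> \<alpha>) \<lhd> f = g \<rhd> (\<alpha> \<lhd> f)"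
  using assms HCmp_HCmp[of "TId T g" \<alpha> "TId T f"] by (simp add: typing unit_simps)

lemma VCmp_cancel_left:
  assumes "\<gamma> \<in> Trk T" "\<alpha> \<in> Trk T" "\<beta> \<in> Trk T" "TSrc T \<gamma> = TTgt T \<alpha>" "TTgt T \<beta> = TTgt T \<alpha>"
    "\<gamma> \<bullet> \<alpha> = \<gamma> \<bullet> \<beta>"
  shows "\<alpha> = \<beta>"
proof -
  have "TInv \<gamma> \<bullet> \<gamma> \<bullet> \<alpha> = \<alpha>" "TInv \<gamma> \<bullet> \<gamma> \<bullet> \<beta> = \<beta>"
    using assms(1-5) by (simp_all add: VCmp_VCmp[symmetric] typing unit_simps)
  then show ?thesis unfolding assms(6) by (rule trans[OF sym])
qed

lemma VCmp_cancel_right: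
  assumes "\<gamma> \<in> Trk T" "\<alpha> \<in> Trk T" "\<beta> \<in> Trk T" "TSrc T \<alpha> = TTgt T \<gamma>" "TSrc T \<beta> = TTgt T \<gamma>"
    "\<alpha> \<bullet> \<gamma> = \<beta> \<bullet> \<gamma>"
  shows "\<alpha> = \<beta>"
proof -
  have "(\<alpha> \<bullet> \<gamma>) \<bullet> TInv \<gamma> = \<alpha>" "(\<beta> \<bullet> \<gamma>) \<bullet> TInv \<gamma> = \<beta>"
    using assms(1-5) by (simp_all add: VCmp_VCmp typing unit_simps)
  then show ?thesis unfolding assms(6) by (rule trans[OF sym])
qed

lemma TInv_cancel_left:
  "\<alpha> \<in> Trk T \<Longrightarrow> \<beta> \<in> Trk T \<Longrightarrow> TTgt T \<beta> = TSrc T \<alpha> \<Longrightarrow> TInv \<alpha> \<bullet> \<alpha> \<bullet> \<beta> = \<beta>"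
  "\<alpha> \<in> Trk T \<Longrightarrow> \<beta> \<in> Trk T \<Longrightarrow> TTgt T \<beta> = TTgt T \<alpha> \<Longrightarrow> \<alpha> \<bullet> TInv \<alpha> \<bullet> \<beta> = \<beta>"
  by (simp_all add: VCmp_VCmp[symmetric] typing unit_simps)

lemma lw_TInv:
  assumes "\<alpha> \<in> Trk T" "f \<in> Mor T" "Src T f = Tgt T (TSrc T \<alpha>)"
  shows "f \<rhd> TInv \<alpha> = TInv (f \<rhd> \<alpha>)"
  by (rule VCmp_cancel_left[of "f \<rhd> \<alpha>"])
    (use assms in \<open>simp_all add: typing lw_VCmp[symmetric] unit_simps\<close>)

definition homotopic where "homotopic f g \<longleftrightarrow> f \<in> Mor T \<and> g \<in> Mor T \<and> tracks T f g \<noteq> {}"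

lemma homotopicI: "\<alpha> \<in> Trk T \<Longrightarrow> TSrc T \<alpha> = f \<Longrightarrow> TTgt T \<alpha> = g \<Longrightarrow> homotopic f g"
  unfolding homotopic_def tracks_def using TSrc_in TTgt_in by blast

lemma homotopicE:
  assumes "homotopic f g" obtains \<alpha> where "\<alpha> \<in> Trk T" "TSrc T \<alpha> = f" "TTgt T \<alpha> = g"
  using assms unfolding homotopic_def tracks_def by blast

lemma homotopic_refl: "f \<in> Mor T \<Longrightarrow> homotopic f f"
  by (rule homotopicI[of "TId T f"]) (simp_all add: typing)

lemma homotopic_sym: "homotopic f g \<Longrightarrow> homotopic g f"
  by (elim homotopicE, rule_tac \<alpha> = "TInv \<alpha>" in homotopicI) (simp_all add: typing)

lemma homotopic_trans [trans]:
  assumes "homotopic f g" "homotopic g h" shows "homotopic f h"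
proof -
  obtain \<alpha> \<beta> where "\<alpha> \<in> Trk T" "TSrc T \<alpha> = f" "TTgt T \<alpha> = g" "\<beta> \<in> Trk T" "TSrc T \<beta> = g" "TTgt T \<beta> = h"
    using assms homotopicE by metis
  then show ?thesis by (intro homotopicI[of "\<beta> \<bullet> \<alpha>"]) (simp_all add: typing)
qed

lemma homotopic_ends: "homotopic f g \<Longrightarrow> Src T f = Src T g \<and> Tgt T f = Tgt T g"
  using Src_TTgt Tgt_TTgt by (elim homotopicE) fastforce

lemma homotopic_Cmp:
  assumes "homotopic g g'" "homotopic f f'" "Src T g = Tgt T f"
  shows "homotopic (g \<cdot> f) (g' \<cdot> f')"
proof -
  obtain \<alpha> \<beta> where "\<alpha> \<in> Trk T" "TSrc T \<alpha> = f" "TTgt T \<alpha> = f'" "\<beta> \<in> Trk T" "TSrc T \<beta> = g" "TTgt T \<beta> = g'"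
    using assms homotopicE by metis
  then show ?thesis using assms(3) by (intro homotopicI[of "\<beta> \<star> \<alpha>"]) (simp_all add: typing)
qed

end

text \<open>The axioms of a track category in terms of single cells, instead of categories of cells and functors
  between them. The track categories below are verified in this form.\<close>

lemma track_categoryI:
  assumes "category T"
    and TTgt: "\<And>\<alpha>. \<alpha> \<in> Trk T \<Longrightarrow> TSrc T \<alpha> \<in> Mor T \<and> TTgt T \<alpha> \<in> Hom T (Src T (TSrc T \<alpha>)) (Tgt T (TSrc T \<alpha>))"
    and TId: "\<And>f. f \<in> Mor T \<Longrightarrow> TId T f \<in> tracks T f f"
    and VCmp: "\<And>\<beta> \<alpha> f g h. \<beta> \<in> tracks T g h \<Longrightarrow> \<alpha> \<in> tracks T f g \<Longrightarrow> VCmp T \<beta> \<alpha> \<in> tracks T f h"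
    and VCmp_TId: "\<And>\<alpha> f g. \<alpha> \<in> tracks T f g \<Longrightarrow> VCmp T \<alpha> (TId T f) = \<alpha> \<and> VCmp T (TId T g) \<alpha> = \<alpha>"
    and VCmp_assoc: "\<And>\<gamma> \<beta> \<alpha> f g h k. \<gamma> \<in> tracks T h k \<Longrightarrow> \<beta> \<in> tracks T g h \<Longrightarrow> \<alpha> \<in> tracks T f g \<Longrightarrow>
      VCmp T \<gamma> (VCmp T \<beta> \<alpha>) = VCmp T (VCmp T \<gamma> \<beta>) \<alpha>"
    and inverse: "\<And>\<alpha> f g. \<alpha> \<in> tracks T f g \<Longrightarrow>
      \<exists>\<beta> \<in> tracks T g f. VCmp T \<beta> \<alpha> = TId T f \<and> VCmp T \<alpha> \<beta> = TId T g"
    and HCmp: "\<And>\<beta> \<alpha> f f' g g'. \<beta> \<in> tracks T g g' \<Longrightarrow> \<alpha> \<in> tracks T f f' \<Longrightarrow> Src T g = Tgt T f \<Longrightarrow>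
      HCmp T \<beta> \<alpha> \<in> tracks T (Cmp T g f) (Cmp T g' f')"
    and HCmp_TId: "\<And>g f. g \<in> Mor T \<Longrightarrow> f \<in> Mor T \<Longrightarrow> Src T g = Tgt T f \<Longrightarrow>
      HCmp T (TId T g) (TId T f) = TId T (Cmp T g f)"
    and HCmp_VCmp: "\<And>\<beta> \<beta>' \<alpha> \<alpha>' f f' f'' g g' g''. \<beta> \<in> tracks T g g' \<Longrightarrow> \<beta>' \<in> tracks T g' g'' \<Longrightarrow>
      \<alpha> \<in> tracks T f f' \<Longrightarrow> \<alpha>' \<in> tracks T f' f'' \<Longrightarrow> Src T g = Tgt T f \<Longrightarrow>
      HCmp T (VCmp T \<beta>' \<beta>) (VCmp T \<alpha>' \<alpha>) = VCmp T (HCmp T \<beta>' \<alpha>') (HCmp T \<beta> \<alpha>)"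
    and HCmp_Idt: "\<And>\<alpha> f g. \<alpha> \<in> tracks T f g \<Longrightarrow> HCmp T (TId T (Idt T (Tgt T f))) \<alpha> = \<alpha> \<and>
      HCmp T \<alpha> (TId T (Idt T (Src T f))) = \<alpha>"
    and HCmp_assoc: "\<And>\<gamma> \<beta> \<alpha> f f' g g' h h'. \<gamma> \<in> tracks T h h' \<Longrightarrow> \<beta> \<in> tracks T g g' \<Longrightarrow> \<alpha> \<in> tracks T f f' \<Longrightarrow>
      Src T h = Tgt T g \<Longrightarrow> Src T g = Tgt T f \<Longrightarrow>
      HCmp T \<gamma> (HCmp T \<beta> \<alpha>) = HCmp T (HCmp T \<gamma> \<beta>) \<alpha>"
  shows "track_category T"
proof -
  interpret category T by (fact assms(1))
  have tr: "\<alpha> \<in> Trk T \<Longrightarrow> \<alpha> \<in> tracks T (TSrc T \<alpha>) (TTgt T \<alpha>)" for \<alpha>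
    unfolding tracks_def by simp
  have H: "f \<in> Hom T X Y \<Longrightarrow> Hom (hom_groupoid T X Y) f g = tracks T f g" for f g X Y
    by (rule Hom_hom_groupoid)
  have H': "\<alpha> \<in> Hom (hom_groupoid T X Y) f g \<Longrightarrow> \<alpha> \<in> tracks T f g \<and> f \<in> Hom T X Y \<and> g \<in> Hom T X Y" for \<alpha> f g X Y
    using TTgt[of \<alpha>] by (auto simp: Hom_def tracks_def)
  have cat: "category (hom_groupoid T X Y)" for X Y
  proof
    show "Src (hom_groupoid T X Y) \<alpha> \<in> Obj (hom_groupoid T X Y)"
      "Tgt (hom_groupoid T X Y) \<alpha> \<in> Obj (hom_groupoid T X Y)" if "\<alpha> \<in> Mor (hom_groupoid T X Y)" for \<alpha>
      using that TTgt by (auto simp: Hom_def)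
    show "Idt (hom_groupoid T X Y) f \<in> Hom (hom_groupoid T X Y) f f" if "f \<in> Obj (hom_groupoid T X Y)" for f
      using that H[of f X Y f] TId[of f] HomD[of f T X Y] by simp
    show "Cmp (hom_groupoid T X Y) \<beta> \<alpha> \<in> Hom (hom_groupoid T X Y) f h"
      if "\<beta> \<in> Hom (hom_groupoid T X Y) g h" "\<alpha> \<in> Hom (hom_groupoid T X Y) f g" for \<beta> \<alpha> f g h
      using H'[OF that(1)] H'[OF that(2)] VCmp[of \<beta> g h \<alpha> f] H[of f X Y h] by simp
    show "Cmp (hom_groupoid T X Y) (Idt (hom_groupoid T X Y) g) \<alpha> = \<alpha>"
      "Cmp (hom_groupoid T X Y) \<alpha> (Idt (hom_groupoid T X Y) f) = \<alpha>"
      if "\<alpha> \<in> Hom (hom_groupoid T X Y) f g" for \<alpha> f g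
      using H'[OF that] VCmp_TId[of \<alpha> f g] by simp_all
    show "Cmp (hom_groupoid T X Y) \<gamma> (Cmp (hom_groupoid T X Y) \<beta> \<alpha>)
        = Cmp (hom_groupoid T X Y) (Cmp (hom_groupoid T X Y) \<gamma> \<beta>) \<alpha>"
      if "\<gamma> \<in> Hom (hom_groupoid T X Y) h k" "\<beta> \<in> Hom (hom_groupoid T X Y) g h"
        "\<alpha> \<in> Hom (hom_groupoid T X Y) f g" for \<gamma> \<beta> \<alpha> f g h k
      using H'[OF that(1)] H'[OF that(2)] H'[OF that(3)] VCmp_assoc[of \<gamma> h k \<beta> g \<alpha> f] by simp
  qed
  have grpd: "groupoid (hom_groupoid T X Y)" for X Y
  proof (rule groupoid.intro[OF cat], rule groupoid_axioms.intro)
    fix \<alpha> assume \<alpha>: "\<alpha> \<in> Mor (hom_groupoid T X Y)"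
    obtain \<beta> where "\<beta> \<in> tracks T (TTgt T \<alpha>) (TSrc T \<alpha>)"
      "VCmp T \<beta> \<alpha> = TId T (TSrc T \<alpha>) \<and> VCmp T \<alpha> \<beta> = TId T (TTgt T \<alpha>)"
      using inverse[OF tr, of \<alpha>] \<alpha> by auto
    then show "isomorphism (hom_groupoid T X Y) \<alpha>"
      unfolding isomorphism_def using \<alpha> TTgt H[of "TTgt T \<alpha>"] by (auto simp: Hom_def[of T])
  qed
  have pair: "category (pair_category (hom_groupoid T Y Z) (hom_groupoid T X Y))" for X Y Z
  proof -
    interpret c1: category "hom_groupoid T Y Z" by (rule cat)
    interpret c2: category "hom_groupoid T X Y" by (rule cat)
    let ?P = "pair_category (hom_groupoid T Y Z) (hom_groupoid T X Y)"
    have P: "p \<in> Hom ?P a b \<longleftrightarrow> fst p \<in> Hom (hom_groupoid T Y Z) (fst a) (fst b) \<and>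
        snd p \<in> Hom (hom_groupoid T X Y) (snd a) (snd b)" for p a b
      unfolding pair_category_def Hom_def
      by (cases p; cases a; cases b) auto
    show ?thesis
    proof
      show "Src ?P p \<in> Obj ?P" "Tgt ?P p \<in> Obj ?P" if "p \<in> Mor ?P" for p
        using that TTgt by (auto simp: pair_category_def Hom_def)
      show "Idt ?P a \<in> Hom ?P a a" if "a \<in> Obj ?P" for a
        unfolding P using that c1.Idt_in[of "fst a"] c2.Idt_in[of "snd a"] by (auto simp: pair_category_def)
      show "Cmp ?P q p \<in> Hom ?P a c" if "q \<in> Hom ?P b c" "p \<in> Hom ?P a b" for p q a b c
        using that c1.Cmp_in[of "fst q" "fst b" "fst c" "fst p" "fst a"]
          c2.Cmp_in[of "snd q" "snd b" "snd c" "snd p" "snd a"]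
        unfolding P by (auto simp: pair_category_def split: prod.splits)
      show "Cmp ?P (Idt ?P b) p = p" if "p \<in> Hom ?P a b" for p a b
        using that c1.Idt_left[of "fst p" "fst a" "fst b"] c2.Idt_left[of "snd p" "snd a" "snd b"]
        unfolding P by (cases b) (auto simp: pair_category_def split: prod.splits)
      show "Cmp ?P p (Idt ?P a) = p" if "p \<in> Hom ?P a b" for p a b
        using that c1.Idt_right[of "fst p" "fst a" "fst b"] c2.Idt_right[of "snd p" "snd a" "snd b"]
        unfolding P by (cases a) (auto simp: pair_category_def split: prod.splits)
      show "Cmp ?P r (Cmp ?P q p) = Cmp ?P (Cmp ?P r q) p"
        if "r \<in> Hom ?P c d" "q \<in> Hom ?P b c" "p \<in> Hom ?P a b" for p q r a b c d
        using that c1.Cmp_assoc[of "fst r" "fst c" "fst d" "fst q" "fst b" "fst p" "fst a"]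
          c2.Cmp_assoc[of "snd r" "snd c" "snd d" "snd q" "snd b" "snd p" "snd a"]
        unfolding P by (auto simp: pair_category_def split: prod.splits)
    qed
  qed
  show ?thesis
  proof (rule track_category.intro[OF assms(1)], rule track_category_axioms.intro)
    show "\<alpha> \<in> Trk T \<Longrightarrow> TSrc T \<alpha> \<in> Mor T" for \<alpha> using TTgt by blast
    show "groupoid (hom_groupoid T X Y)" for X Y by (rule grpd)
    show "cat_functor (pair_category (hom_groupoid T Y Z) (hom_groupoid T X Y)) (hom_groupoid T X Z)
        (comp_functor T)" for X Y Z
    proof (rule cat_functor.intro[OF pair cat], rule cat_functor_axioms.intro)
      let ?P = "pair_category (hom_groupoid T Y Z) (hom_groupoid T X Y)"
      have P: "p \<in> Hom ?P a b \<Longrightarrow> fst p \<in> tracks T (fst a) (fst b) \<and> snd p \<in> tracks T (snd a) (snd b) \<and>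
          fst a \<in> Hom T Y Z \<and> snd a \<in> Hom T X Y" for p a b
        unfolding Hom_def[of ?P] tracks_def by (cases p; cases a; cases b) (auto simp: pair_category_def)
      show "fob (comp_functor T) a \<in> Obj (hom_groupoid T X Z)" if "a \<in> Obj ?P" for a
        using that Cmp_in by (auto simp: pair_category_def comp_functor_def)
      show "fmor (comp_functor T) p \<in> Hom (hom_groupoid T X Z) (fob (comp_functor T) a) (fob (comp_functor T) b)"
        if "p \<in> Hom ?P a b" for p a b
        using P[OF that] H[OF Cmp_in, of "fst a" Y Z "snd a" X] HCmp[of "fst p" "fst a" "fst b" "snd p" "snd a" "snd b"]
        by (auto simp: comp_functor_def Hom_def[of T] split: prod.splits)
      show "fmor (comp_functor T) (Idt ?P a) = Idt (hom_groupoid T X Z) (fob (comp_functor T) a)"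
        if "a \<in> Obj ?P" for a
        using that HCmp_TId by (auto simp: pair_category_def comp_functor_def Hom_def)
      show "fmor (comp_functor T) (Cmp ?P q p) = Cmp (hom_groupoid T X Z) (fmor (comp_functor T) q) (fmor (comp_functor T) p)"
        if "q \<in> Hom ?P b c" "p \<in> Hom ?P a b" for p q a b c
        using P[OF that(1)] P[OF that(2)] HCmp_VCmp[of "fst p" "fst a" "fst b" "fst q" "fst c" "snd p" "snd a" "snd b" "snd q" "snd c"]
        by (auto simp: pair_category_def comp_functor_def Hom_def split: prod.splits)
    qed
    show "HCmp T (TId T (Idt T Y)) \<alpha> = \<alpha>" "HCmp T \<alpha> (TId T (Idt T X)) = \<alpha>"
      if "\<alpha> \<in> Mor (hom_groupoid T X Y)" for \<alpha> X Y
      using that HCmp_Idt[OF tr, of \<alpha>] by (auto simp: Hom_def)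
    show "HCmp T \<gamma> (HCmp T \<beta> \<alpha>) = HCmp T (HCmp T \<gamma> \<beta>) \<alpha>"
      if "\<gamma> \<in> Mor (hom_groupoid T Y Z)" "\<beta> \<in> Mor (hom_groupoid T X Y)" "\<alpha> \<in> Mor (hom_groupoid T W X)"
      for \<gamma> \<beta> \<alpha> W X Y Z
      using that HCmp_assoc[OF tr tr tr, of \<gamma> \<beta> \<alpha>] by (auto simp: Hom_def)
  qed
qed

section \<open>The homotopy category\<close>

context track_category
begin

definition hclass where "hclass f = {g. homotopic f g}"

lemma homotopy_eq: "homotopy T = {(f, g). homotopic f g}"
  unfolding homotopy_def homotopic_def by simp

lemma hclass_Image: "homotopy T `` {f} = hclass f"
  unfolding homotopy_eq hclass_def by auto

lemma hclass_eq_iff: "f \<in> Mor T \<Longrightarrow> g \<in> Mor T \<Longrightarrow> hclass f = hclass g \<longleftrightarrow> homotopic f g"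
  unfolding hclass_def set_eq_iff mem_Collect_eq
  by (rule iffI) (use homotopic_refl homotopic_sym homotopic_trans in blast)+

lemma homotopy_category_simps [simp]:
  "Obj (homotopy_category T) = Obj T"
  "Mor (homotopy_category T) = hclass ` Mor T"
  "Idt (homotopy_category T) X = hclass (Idt T X)"
  unfolding homotopy_category_def quotient_def by (auto simp: hclass_Image)

lemma Src_hclass [simp]: "f \<in> Mor T \<Longrightarrow> Src (homotopy_category T) (hclass f) = Src T f"
  and Tgt_hclass [simp]: "f \<in> Mor T \<Longrightarrow> Tgt (homotopy_category T) (hclass f) = Tgt T f"
proof -
  assume f: "f \<in> Mor T"
  then have "f \<in> hclass f" using homotopic_refl unfolding hclass_def by blast
  moreover have "Src T g = Src T f \<and> Tgt T g = Tgt T f" if "g \<in> hclass f" for g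
    using homotopic_ends[of f g] that unfolding hclass_def by simp
  ultimately have "the_elem (Src T ` hclass f) = Src T f" "the_elem (Tgt T ` hclass f) = Tgt T f"
    by (metis empty_iff the_elem_image_unique)+
  then show "Src (homotopy_category T) (hclass f) = Src T f"
    "Tgt (homotopy_category T) (hclass f) = Tgt T f"
    unfolding homotopy_category_def by simp_all
qed

lemma Cmp_hclass [simp]:
  assumes "g \<in> Mor T" "f \<in> Mor T" "Src T g = Tgt T f"
  shows "Cmp (homotopy_category T) (hclass g) (hclass f) = hclass (g \<cdot> f)"
proof -
  have "homotopy T `` {g' \<cdot> f' | g' f'. g' \<in> hclass g \<and> f' \<in> hclass f} = hclass (g \<cdot> f)"
    unfolding homotopy_eq hclass_def Image_def Bex_def mem_Collect_eq case_prod_conv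
  proof (intro equalityI subsetI CollectI; elim CollectE exE conjE)
    fix h k g' f' assume "homotopic g g'" "homotopic f f'" "k = g' \<cdot> f'" "homotopic k h"
    then show "homotopic (g \<cdot> f) h" using homotopic_trans[OF homotopic_Cmp[OF _ _ assms(3)]] by blast
  next
    fix h assume "homotopic (g \<cdot> f) h"
    then show "\<exists>k. (\<exists>g' f'. k = g' \<cdot> f' \<and> homotopic g g' \<and> homotopic f f') \<and> homotopic k h"
      using homotopic_refl assms(1,2) by blast
  qed
  then show ?thesis unfolding homotopy_category_def by simp
qed

lemma Hom_homotopy_category: "Hom (homotopy_category T) X Y = hclass ` Hom T X Y"
  unfolding Hom_def by auto

lemma category_homotopy_category: "category (homotopy_category T)"
proof
  show "Src (homotopy_category T) c \<in> Obj (homotopy_category T)"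
    "Tgt (homotopy_category T) c \<in> Obj (homotopy_category T)" if "c \<in> Mor (homotopy_category T)" for c
    using that Src_in Tgt_in by auto
  show "Idt (homotopy_category T) X \<in> Hom (homotopy_category T) X X" if "X \<in> Obj (homotopy_category T)" for X
    using that Idt_in by (auto simp: Hom_homotopy_category)
  show "Cmp (homotopy_category T) d c \<in> Hom (homotopy_category T) X Z"
    if "d \<in> Hom (homotopy_category T) Y Z" "c \<in> Hom (homotopy_category T) X Y" for d c X Y Z
    using that unfolding Hom_homotopy_category by (auto simp: Hom_def typing)
  show "Cmp (homotopy_category T) (Idt (homotopy_category T) Y) c = c"
    "Cmp (homotopy_category T) c (Idt (homotopy_category T) X) = c"
    if "c \<in> Hom (homotopy_category T) X Y" for c X Y
    using that unfolding Hom_homotopy_category by (auto simp: Hom_def typing unit_simps)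
  show "Cmp (homotopy_category T) e (Cmp (homotopy_category T) d c)
      = Cmp (homotopy_category T) (Cmp (homotopy_category T) e d) c"
    if "e \<in> Hom (homotopy_category T) Y Z" "d \<in> Hom (homotopy_category T) X Y"
      "c \<in> Hom (homotopy_category T) W X" for e d c W X Y Z
    using that unfolding Hom_homotopy_category by (auto simp: Hom_def typing Cmp_Cmp)
qed

lemma homotopy_equivalent_iff:
  assumes "X \<in> Obj T" "Y \<in> Obj T"
  shows "homotopy_equivalent T X Y \<longleftrightarrow>
    (\<exists>u \<in> Hom T X Y. \<exists>v \<in> Hom T Y X. homotopic (v \<cdot> u) (Idt T X) \<and> homotopic (u \<cdot> v) (Idt T Y))"
proof -
  have eq: "Cmp (homotopy_category T) (hclass v) (hclass u) = hclass (Idt T X) \<longleftrightarrow> homotopic (v \<cdot> u) (Idt T X)"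
    if "u \<in> Hom T X Y" "v \<in> Hom T Y X" "X \<in> Obj T" for u v X Y
    using HomD[OF that(1)] HomD[OF that(2)] that(3) by (simp add: hclass_eq_iff typing)
  have "isomorphism (homotopy_category T) (hclass u) \<longleftrightarrow>
      (\<exists>v \<in> Hom T Y X. homotopic (v \<cdot> u) (Idt T X) \<and> homotopic (u \<cdot> v) (Idt T Y))"
    if u: "u \<in> Hom T X Y" for u
  proof -
    have "hclass u \<in> hclass ` Mor T" using HomD[OF u] by blast
    then show ?thesis unfolding isomorphism_def using HomD[OF u] eq[OF u _ assms(1)] eq[OF _ u assms(2)]
      by (simp add: Hom_homotopy_category)
  qed
  then show ?thesis
    unfolding homotopy_equivalent_def isomorphic_def Hom_homotopy_category by blast
qed

end

section \<open>Lax products\<close>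

lemma bij_betw_Ex1: "bij_betw f A B \<longleftrightarrow> (\<forall>x \<in> A. f x \<in> B) \<and> (\<forall>y \<in> B. \<exists>!x. x \<in> A \<and> f x = y)"
proof
  assume "bij_betw f A B"
  then have inj: "\<And>x y. x \<in> A \<Longrightarrow> y \<in> A \<Longrightarrow> f x = f y \<Longrightarrow> x = y" and im: "f ` A = B"
    unfolding bij_betw_def inj_on_def by auto
  then show "(\<forall>x \<in> A. f x \<in> B) \<and> (\<forall>y \<in> B. \<exists>!x. x \<in> A \<and> f x = y)" by blast
next
  assume r: "(\<forall>x \<in> A. f x \<in> B) \<and> (\<forall>y \<in> B. \<exists>!x. x \<in> A \<and> f x = y)"
  then have "x = y" if "x \<in> A" "y \<in> A" "f x = f y" for x y using that by metis
  then show "bij_betw f A B" using r unfolding bij_betw_def inj_on_def by blast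
qed

lemma listset_nth: "xs \<in> listset As \<longleftrightarrow> length xs = length As \<and> (\<forall>k < length As. xs ! k \<in> As ! k)"
proof (induction As arbitrary: xs)
  case (Cons A As)
  then show ?case by (cases xs) (auto simp: set_Cons_def nth_Cons split: nat.splits)
qed simp

lemma list_category_simps:
  "xs \<in> Obj (list_category Cs) \<longleftrightarrow> length xs = length Cs \<and> (\<forall>k < length Cs. xs ! k \<in> Obj (Cs ! k))"
  "fs \<in> Mor (list_category Cs) \<longleftrightarrow> length fs = length Cs \<and> (\<forall>k < length Cs. fs ! k \<in> Mor (Cs ! k))"
  unfolding list_category_def by (simp_all add: listset_nth)

lemma Hom_list_category:
  "fs \<in> Hom (list_category Cs) xs ys \<longleftrightarrow> length fs = length Cs \<and> length xs = length Cs \<and> length ys = length Cs \<and>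
    (\<forall>k < length Cs. fs ! k \<in> Hom (Cs ! k) (xs ! k) (ys ! k))"
  unfolding Hom_def list_category_def by (auto simp: listset_nth list_eq_iff_nth_eq)

lemma nth_list_category:
  "length gs = length Cs \<Longrightarrow> length fs = length Cs \<Longrightarrow> k < length Cs \<Longrightarrow>
    Cmp (list_category Cs) gs fs ! k = Cmp (Cs ! k) (gs ! k) (fs ! k)"
  "length xs = length Cs \<Longrightarrow> k < length Cs \<Longrightarrow> Idt (list_category Cs) xs ! k = Idt (Cs ! k) (xs ! k)"
  "length gs = length Cs \<Longrightarrow> length fs = length Cs \<Longrightarrow> length (Cmp (list_category Cs) gs fs) = length Cs"
  "length xs = length Cs \<Longrightarrow> length (Idt (list_category Cs) xs) = length Cs"
  unfolding list_category_def by simp_all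

lemma category_list_category:
  assumes "\<And>k. k < length Cs \<Longrightarrow> category (Cs ! k)"
  shows "category (list_category Cs)"
proof
  let ?L = "list_category Cs"
  have sel: "Src ?L fs = map2 Src Cs fs" "Tgt ?L fs = map2 Tgt Cs fs" for fs unfolding list_category_def by simp_all
  show "Src ?L fs \<in> Obj ?L" "Tgt ?L fs \<in> Obj ?L" if "fs \<in> Mor ?L" for fs
    using that category.Src_in[OF assms] category.Tgt_in[OF assms] unfolding sel list_category_simps by auto
  show "Idt ?L xs \<in> Hom ?L xs xs" if "xs \<in> Obj ?L" for xs
    using that category.Idt_in[OF assms] unfolding Hom_list_category list_category_simps
    by (auto simp: nth_list_category)
  show "Cmp ?L gs fs \<in> Hom ?L xs zs" if "gs \<in> Hom ?L ys zs" "fs \<in> Hom ?L xs ys" for gs fs xs ys zs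
    using that category.Cmp_in[OF assms] unfolding Hom_list_category by (auto simp: nth_list_category)
  show "Cmp ?L (Idt ?L ys) fs = fs" "Cmp ?L fs (Idt ?L xs) = fs" if "fs \<in> Hom ?L xs ys" for fs xs ys
    using that category.Idt_left[OF assms] category.Idt_right[OF assms] unfolding Hom_list_category
    by (auto simp: nth_list_category intro!: nth_equalityI)
  show "Cmp ?L hs (Cmp ?L gs fs) = Cmp ?L (Cmp ?L hs gs) fs"
    if "hs \<in> Hom ?L ys zs" "gs \<in> Hom ?L xs ys" "fs \<in> Hom ?L ws xs" for hs gs fs ws xs ys zs
    using that unfolding Hom_list_category
    by (auto simp: nth_list_category intro!: nth_equalityI category.Cmp_assoc[OF assms])
qed

text \<open>The two halves of the universal property, at a test object \<open>Y\<close>: the functor induced by the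
  projections is essentially surjective, respectively fully faithful. The second half is a
  property of each pair of parallel 1-arrows, which is named for transport along homotopies.\<close>

definition cones_lift :: "('o, 'a, 't) track_category \<Rightarrow> 'o list \<Rightarrow> 'o \<Rightarrow> 'a list \<Rightarrow> 'o \<Rightarrow> bool" where
  "cones_lift T Xs P ps Y \<longleftrightarrow> (\<forall>fs. length fs = length Xs \<and> (\<forall>k < length Xs. fs ! k \<in> Hom T Y (Xs ! k)) \<longrightarrow>
    (\<exists>h \<in> Hom T Y P. \<forall>k < length Xs. track_category.homotopic T (Cmp T (ps ! k) h) (fs ! k)))"

definition lifts_uniquely :: "('o, 'a, 't) track_category \<Rightarrow> 'a list \<Rightarrow> 'a \<Rightarrow> 'a \<Rightarrow> bool" where
  "lifts_uniquely T ps f g \<longleftrightarrow>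
    (\<forall>\<alpha>s. (\<forall>k < length ps. \<alpha>s k \<in> tracks T (Cmp T (ps ! k) f) (Cmp T (ps ! k) g)) \<longrightarrow>
      (\<exists>!\<alpha>. \<alpha> \<in> tracks T f g \<and> (\<forall>k < length ps. HCmp T (TId T (ps ! k)) \<alpha> = \<alpha>s k)))"

definition tracks_lift :: "('o, 'a, 't) track_category \<Rightarrow> 'o \<Rightarrow> 'a list \<Rightarrow> 'o \<Rightarrow> bool" where
  "tracks_lift T P ps Y \<longleftrightarrow> (\<forall>f \<in> Hom T Y P. \<forall>g \<in> Hom T Y P. lifts_uniquely T ps f g)"

lemma cone_iff: "cone T Xs P ps \<longleftrightarrow> P \<in> Obj T \<and> length ps = length Xs \<and> (\<forall>k < length Xs. ps ! k \<in> Hom T P (Xs ! k))"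
  unfolding cone_def list_all2_conv_all_nth by auto

context track_category
begin

lemma category_hom_groupoid: "X \<in> Obj T \<Longrightarrow> Y \<in> Obj T \<Longrightarrow> category (hom_groupoid T X Y)"
  using hom_groupoid groupoid.axioms(1) by blast

lemma Hom_hom_groupoid_iff:
  "\<alpha> \<in> Hom (hom_groupoid T X Y) f g \<longleftrightarrow> \<alpha> \<in> tracks T f g \<and> f \<in> Hom T X Y"
  "\<alpha> \<in> Hom (hom_groupoid T X Y) f g \<longleftrightarrow> \<alpha> \<in> tracks T f g \<and> g \<in> Hom T X Y"
  by (auto simp: Hom_def tracks_def typing)

lemma cat_functor_induced:
  assumes c: "cone T Xs P ps" and Y: "Y \<in> Obj T"
  shows "cat_functor (hom_groupoid T Y P) (list_category (map (hom_groupoid T Y) Xs)) (induced_func T ps)"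
proof (rule cat_functor.intro)
  let ?L = "list_category (map (hom_groupoid T Y) Xs)"
  have P: "P \<in> Obj T" and len: "length ps = length Xs" and ps: "k < length Xs \<Longrightarrow> ps ! k \<in> Hom T P (Xs ! k)" for k
    using c unfolding cone_iff by auto
  have Xs: "k < length Xs \<Longrightarrow> Xs ! k \<in> Obj T" for k using Hom_objects[OF ps] by blast
  show "category (hom_groupoid T Y P)" using category_hom_groupoid[OF Y P] .
  show "category ?L" using category_list_category category_hom_groupoid[OF Y] Xs
    by (metis (no_types, lifting) length_map nth_map)
  show "cat_functor_axioms (hom_groupoid T Y P) ?L (induced_func T ps)"
  proof
    show "fob (induced_func T ps) f \<in> Obj ?L" if "f \<in> Obj (hom_groupoid T Y P)" for f
      using that Cmp_in[OF ps] len by (auto simp: induced_func_def list_category_simps)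
    show "fmor (induced_func T ps) \<alpha> \<in> Hom ?L (fob (induced_func T ps) f) (fob (induced_func T ps) g)"
      if "\<alpha> \<in> Hom (hom_groupoid T Y P) f g" for \<alpha> f g
    proof -
      have "\<alpha> \<in> tracks T f g" "f \<in> Hom T Y P" using that Hom_hom_groupoid_iff by blast+
      then have "(ps ! k) \<rhd> \<alpha> \<in> tracks T (ps ! k \<cdot> f) (ps ! k \<cdot> g) \<and> ps ! k \<cdot> f \<in> Hom T Y (Xs ! k)"
        if "k < length Xs" for k
        using ps[OF that] by (auto simp: tracks_def Hom_def typing)
      then show ?thesis using len
        unfolding Hom_list_category by (simp add: induced_func_def Hom_hom_groupoid_iff(1))
    qed
    show "fmor (induced_func T ps) (Idt (hom_groupoid T Y P) f) = Idt ?L (fob (induced_func T ps) f)"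
      if "f \<in> Obj (hom_groupoid T Y P)" for f
      using that len HomD[OF ps]
      by (intro nth_equalityI) (auto simp: induced_func_def nth_list_category HomD unit_simps)
    show "fmor (induced_func T ps) (Cmp (hom_groupoid T Y P) \<beta> \<alpha>)
        = Cmp ?L (fmor (induced_func T ps) \<beta>) (fmor (induced_func T ps) \<alpha>)"
      if "\<beta> \<in> Hom (hom_groupoid T Y P) g h" "\<alpha> \<in> Hom (hom_groupoid T Y P) f g" for \<beta> \<alpha> f g h
    proof -
      have "\<beta> \<in> tracks T g h" "\<alpha> \<in> tracks T f g" "f \<in> Hom T Y P" using that Hom_hom_groupoid_iff by blast+
      then have "(ps ! k) \<rhd> (\<beta> \<bullet> \<alpha>) = (ps ! k \<rhd> \<beta>) \<bullet> (ps ! k \<rhd> \<alpha>)" if "k < length Xs" for k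
        using ps[OF that] by (intro lw_VCmp) (auto simp: tracks_def Hom_def)
      then show ?thesis using len
        by (intro nth_equalityI) (auto simp: induced_func_def nth_list_category)
    qed
  qed
qed

lemma fully_faithful_induced_iff:
  assumes c: "cone T Xs P ps" and Y: "Y \<in> Obj T"
  shows "fully_faithful (hom_groupoid T Y P) (list_category (map (hom_groupoid T Y) Xs)) (induced_func T ps)
    \<longleftrightarrow> tracks_lift T P ps Y"
proof -
  let ?L = "list_category (map (hom_groupoid T Y) Xs)" and ?F = "induced_func T ps"
  interpret F: cat_functor "hom_groupoid T Y P" ?L ?F using cat_functor_induced[OF c Y] .
  have len: "length ps = length Xs" and ps: "k < length Xs \<Longrightarrow> ps ! k \<in> Hom T P (Xs ! k)" for k
    using c unfolding cone_iff by auto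
  have tuples: "\<alpha>s \<in> Hom ?L (fob ?F f) (fob ?F g) \<longleftrightarrow> length \<alpha>s = length ps \<and>
      (\<forall>k < length ps. \<alpha>s ! k \<in> tracks T (ps ! k \<cdot> f) (ps ! k \<cdot> g))" if "f \<in> Hom T Y P" for \<alpha>s f g
    using Cmp_in[OF ps that] len
    unfolding Hom_list_category by (auto simp: induced_func_def Hom_hom_groupoid_iff(1))
  have F_eq: "fmor ?F \<alpha> = \<alpha>s \<longleftrightarrow> length \<alpha>s = length ps \<and> (\<forall>k < length ps. ps ! k \<rhd> \<alpha> = \<alpha>s ! k)" for \<alpha> \<alpha>s
    by (auto simp: induced_func_def list_eq_iff_nth_eq)
  have "bij_betw (fmor ?F) (tracks T f g) (Hom ?L (fob ?F f) (fob ?F g)) \<longleftrightarrow>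
      (\<forall>\<alpha>s. (\<forall>k < length ps. \<alpha>s k \<in> tracks T (Cmp T (ps ! k) f) (Cmp T (ps ! k) g)) \<longrightarrow>
        (\<exists>!\<alpha>. \<alpha> \<in> tracks T f g \<and> (\<forall>k < length ps. HCmp T (TId T (ps ! k)) \<alpha> = \<alpha>s k)))" (is "?l \<longleftrightarrow> ?r")
    if f: "f \<in> Hom T Y P" and g: "g \<in> Hom T Y P" for f g
  proof
    assume l: ?l
    show ?r
    proof (intro allI impI)
      fix \<alpha>s assume "\<forall>k < length ps. \<alpha>s k \<in> tracks T (ps ! k \<cdot> f) (ps ! k \<cdot> g)"
      then have "map \<alpha>s [0..<length ps] \<in> Hom ?L (fob ?F f) (fob ?F g)" unfolding tuples[OF f] by simp
      then have "\<exists>!\<alpha>. \<alpha> \<in> tracks T f g \<and> fmor ?F \<alpha> = map \<alpha>s [0..<length ps]"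
        using l unfolding bij_betw_Ex1 by blast
      then show "\<exists>!\<alpha>. \<alpha> \<in> tracks T f g \<and> (\<forall>k < length ps. HCmp T (TId T (ps ! k)) \<alpha> = \<alpha>s k)"
        unfolding F_eq by simp
    qed
  next
    assume r: ?r
    have "\<exists>!\<alpha>. \<alpha> \<in> tracks T f g \<and> fmor ?F \<alpha> = \<alpha>s" if "\<alpha>s \<in> Hom ?L (fob ?F f) (fob ?F g)" for \<alpha>s
      using r[rule_format, of "\<lambda>k. \<alpha>s ! k"] that unfolding tuples[OF f] F_eq by simp
    moreover have "fmor ?F \<alpha> \<in> Hom ?L (fob ?F f) (fob ?F g)" if "\<alpha> \<in> tracks T f g" for \<alpha>
      using F.fmor_in[of \<alpha> f g] that unfolding Hom_hom_groupoid[OF f] by blast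
    ultimately show ?l unfolding bij_betw_Ex1 by blast
  qed
  then show ?thesis
    unfolding fully_faithful_def tracks_lift_def lifts_uniquely_def using Hom_hom_groupoid[of _ T Y P] by simp
qed

text \<open>An isomorphism in a product of groupoids is a list of tracks, so essential surjectivity is about
  homotopies between entries.\<close>

theorem lax_product_iff:
  "lax_product T Xs P ps \<longleftrightarrow> cone T Xs P ps \<and> (\<forall>Y \<in> Obj T. cones_lift T Xs P ps Y \<and> tracks_lift T P ps Y)"
proof -
  have "equivalence_of_categories (hom_groupoid T Y P)
      (list_category (map (hom_groupoid T Y) Xs)) (induced_func T ps) \<longleftrightarrow>
      cones_lift T Xs P ps Y \<and> tracks_lift T P ps Y" if c: "cone T Xs P ps" and Y: "Y \<in> Obj T" for Y
  proof -
    let ?L = "list_category (map (hom_groupoid T Y) Xs)" and ?F = "induced_func T ps"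
    interpret F: cat_functor "hom_groupoid T Y P" ?L ?F using cat_functor_induced[OF c Y] .
    have len: "length ps = length Xs" and ps: "k < length Xs \<Longrightarrow> ps ! k \<in> Hom T P (Xs ! k)" for k
      using c unfolding cone_iff by auto
    have iso: "isomorphic ?L (fob ?F h) fs \<longleftrightarrow> (\<forall>k < length Xs. homotopic (ps ! k \<cdot> h) (fs ! k))"
      if h: "h \<in> Hom T Y P" and fs: "length fs = length Xs" "\<forall>k < length Xs. fs ! k \<in> Hom T Y (Xs ! k)" for h fs
    proof
      assume "isomorphic ?L (fob ?F h) fs"
      then obtain \<alpha>s where "\<alpha>s \<in> Hom ?L (fob ?F h) fs" unfolding isomorphic_def by blast
      then show "\<forall>k < length Xs. homotopic (ps ! k \<cdot> h) (fs ! k)"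
        using len unfolding Hom_list_category
        by (auto simp: induced_func_def Hom_hom_groupoid_iff(2) tracks_def intro: homotopicI)
    next
      assume "\<forall>k < length Xs. homotopic (ps ! k \<cdot> h) (fs ! k)"
      then have "\<forall>k. \<exists>\<alpha>. k < length Xs \<longrightarrow> \<alpha> \<in> tracks T (ps ! k \<cdot> h) (fs ! k)"
        unfolding homotopic_def by blast
      then have "\<exists>\<alpha>. \<forall>k < length Xs. \<alpha> k \<in> tracks T (ps ! k \<cdot> h) (fs ! k)"
        by (drule_tac choice) blast
      then obtain \<alpha> where \<alpha>: "\<And>k. k < length Xs \<Longrightarrow> \<alpha> k \<in> tracks T (ps ! k \<cdot> h) (fs ! k)" by blast
      let ?a = "map \<alpha> [0..<length Xs]" and ?b = "map (\<lambda>k. TInv (\<alpha> k)) [0..<length Xs]"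
      have a: "?a \<in> Hom ?L (fob ?F h) fs"
        using len fs \<alpha> unfolding Hom_list_category by (simp add: induced_func_def Hom_hom_groupoid_iff(2))
      have b: "?b \<in> Hom ?L fs (fob ?F h)"
        using len fs tracksD[OF \<alpha>] unfolding Hom_list_category
        by (simp add: induced_func_def Hom_hom_groupoid_iff(1) tracks_def typing)
      have "Cmp ?L ?b ?a = Idt ?L (fob ?F h)" "Cmp ?L ?a ?b = Idt ?L fs"
        using len fs tracksD[OF \<alpha>]
        by (auto intro!: nth_equalityI simp: nth_list_category induced_func_def unit_simps)
      then show "isomorphic ?L (fob ?F h) fs"
        using a isomorphismI[OF a b] unfolding isomorphic_def by blast
    qed
    have "(\<forall>fs \<in> Obj ?L. \<exists>h \<in> Hom T Y P. isomorphic ?L (fob ?F h) fs) \<longleftrightarrow> cones_lift T Xs P ps Y"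
      unfolding cones_lift_def Ball_def[of "Obj ?L"] list_category_simps
      by (intro iff_allI imp_cong bex_cong refl iso) auto
    then show ?thesis
      using F.equivalence_of_categoriesI equivalence_of_categoriesD[of "hom_groupoid T Y P" ?L ?F]
        fully_faithful_induced_iff[OF c Y] by (simp, blast)
  qed
  then show ?thesis unfolding lax_product_def by blast
qed

text \<open>A fully faithful functor that is bijective on objects is an isomorphism of categories.\<close>

lemma strong_productI:
  assumes c: "cone T Xs P ps" and ff: "\<And>Y. Y \<in> Obj T \<Longrightarrow> tracks_lift T P ps Y"
    and unique: "\<And>Y fs. Y \<in> Obj T \<Longrightarrow> length fs = length Xs \<Longrightarrow> \<forall>k < length Xs. fs ! k \<in> Hom T Y (Xs ! k) \<Longrightarrow>
      \<exists>!h. h \<in> Hom T Y P \<and> (\<forall>k < length Xs. ps ! k \<cdot> h = fs ! k)"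
  shows "strong_product T Xs P ps" and "lax_product T Xs P ps"
proof -
  have len: "length ps = length Xs" and ps: "k < length Xs \<Longrightarrow> ps ! k \<in> Hom T P (Xs ! k)" for k
    using c unfolding cone_iff by auto
  show "strong_product T Xs P ps"
    unfolding strong_product_def
  proof (intro conjI ballI c)
    fix Y assume Y: "Y \<in> Obj T"
    let ?L = "list_category (map (hom_groupoid T Y) Xs)" and ?F = "induced_func T ps"
    interpret F: cat_functor "hom_groupoid T Y P" ?L ?F using cat_functor_induced[OF c Y] .
    have F_eq: "fob ?F h = fs \<longleftrightarrow> length fs = length Xs \<and> (\<forall>k < length Xs. ps ! k \<cdot> h = fs ! k)" for h fs
      using len by (auto simp: induced_func_def list_eq_iff_nth_eq)
    have L: "fs \<in> Obj ?L \<longleftrightarrow> length fs = length Xs \<and> (\<forall>k < length Xs. fs ! k \<in> Hom T Y (Xs ! k))" for fs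
      unfolding list_category_simps by auto
    have "\<exists>!h. h \<in> Hom T Y P \<and> fob ?F h = fs" if "fs \<in> Obj ?L" for fs
      using unique[OF Y, of fs] that unfolding F_eq L by auto
    moreover have "fob ?F h \<in> Obj ?L" if "h \<in> Hom T Y P" for h
      using F.fob_in[of h] that by simp
    ultimately have "bij_betw (fob ?F) (Hom T Y P) (Obj ?L)"
      unfolding bij_betw_Ex1 by blast
    then show "isomorphism_of_categories (hom_groupoid T Y P) ?L ?F"
      using F.isomorphism_of_categoriesI fully_faithful_induced_iff[OF c Y] ff[OF Y] by simp
  qed
  have "cones_lift T Xs P ps Y" if Y: "Y \<in> Obj T" for Y
    unfolding cones_lift_def
  proof (intro allI impI; elim conjE)
    fix fs assume fs: "length fs = length Xs" "\<forall>k < length Xs. fs ! k \<in> Hom T Y (Xs ! k)"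
    then obtain h where h: "h \<in> Hom T Y P" "\<forall>k < length Xs. ps ! k \<cdot> h = fs ! k"
      using unique[OF Y] by blast
    then have "\<forall>k < length Xs. homotopic (ps ! k \<cdot> h) (fs ! k)"
      using fs(2) homotopic_refl by (simp add: Hom_def)
    then show "\<exists>h \<in> Hom T Y P. \<forall>k < length Xs. homotopic (ps ! k \<cdot> h) (fs ! k)" using h(1) by blast
  qed
  then show "lax_product T Xs P ps" using lax_product_iff c ff by blast
qed

end

context track_category
begin

text \<open>Conjugation by tracks \<open>f \<Rightarrow> f'\<close> and \<open>g \<Rightarrow> g'\<close> turns the lifting problem for \<open>f'\<close>, \<open>g'\<close> into the one for \<open>f\<close>, \<open>g\<close>.\<close>

lemma lifts_uniquely_homotopic:
  assumes ps: "\<And>k. k < length ps \<Longrightarrow> ps ! k \<in> Mor T \<and> Src T (ps ! k) = Tgt T f"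
    and f: "homotopic f f'" and g: "homotopic g g'" and par: "Tgt T g = Tgt T f"
    and lift: "lifts_uniquely T ps f g"
  shows "lifts_uniquely T ps f' g'"
  unfolding lifts_uniquely_def
proof (intro allI impI)
  fix \<alpha>s assume "\<forall>k < length ps. \<alpha>s k \<in> tracks T (ps ! k \<cdot> f') (ps ! k \<cdot> g')"
  then have \<alpha>s: "\<And>k. k < length ps \<Longrightarrow> \<alpha>s k \<in> Trk T \<and> TSrc T (\<alpha>s k) = ps ! k \<cdot> f' \<and> TTgt T (\<alpha>s k) = ps ! k \<cdot> g'"
    unfolding tracks_def by auto
  obtain \<phi> where \<phi>: "\<phi> \<in> Trk T" "TSrc T \<phi> = f" "TTgt T \<phi> = f'" using homotopicE[OF f] .
  obtain \<psi> where \<psi>: "\<psi> \<in> Trk T" "TSrc T \<psi> = g" "TTgt T \<psi> = g'" using homotopicE[OF g] .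
  have ends: "Tgt T f' = Tgt T f" "Tgt T g' = Tgt T f" using homotopic_ends f g par by metis+
  let ?\<beta>s = "\<lambda>k. TInv (ps ! k \<rhd> \<psi>) \<bullet> \<alpha>s k \<bullet> (ps ! k \<rhd> \<phi>)"
  have "\<forall>k < length ps. ?\<beta>s k \<in> tracks T (ps ! k \<cdot> f) (ps ! k \<cdot> g)"
    using ps \<alpha>s \<phi> \<psi> par by (simp add: tracks_def typing)
  then have ex1: "\<exists>!\<beta>. \<beta> \<in> tracks T f g \<and> (\<forall>k < length ps. ps ! k \<rhd> \<beta> = ?\<beta>s k)"
    by (rule lift[unfolded lifts_uniquely_def, THEN spec, THEN mp])
  then obtain \<beta> where \<beta>0: "\<beta> \<in> tracks T f g \<and> (\<forall>k < length ps. ps ! k \<rhd> \<beta> = ?\<beta>s k)"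
    by blast
  then have \<beta>: "\<beta> \<in> Trk T" "TSrc T \<beta> = f" "TTgt T \<beta> = g" "\<And>k. k < length ps \<Longrightarrow> ps ! k \<rhd> \<beta> = ?\<beta>s k"
    unfolding tracks_def by auto
  show "\<exists>!\<alpha>. \<alpha> \<in> tracks T f' g' \<and> (\<forall>k < length ps. ps ! k \<rhd> \<alpha> = \<alpha>s k)"
  proof (rule ex1I[of _ "\<psi> \<bullet> \<beta> \<bullet> TInv \<phi>"])
    have "ps ! k \<rhd> (\<psi> \<bullet> \<beta> \<bullet> TInv \<phi>) = \<alpha>s k" if "k < length ps" for k
    proof -
      have "ps ! k \<rhd> (\<psi> \<bullet> \<beta> \<bullet> TInv \<phi>) = (ps ! k \<rhd> \<psi>) \<bullet> ?\<beta>s k \<bullet> TInv (ps ! k \<rhd> \<phi>)"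
        using \<beta> \<phi> \<psi> ps[OF that] that par ends by (simp add: lw_VCmp typing lw_TInv)
      also have "\<dots> = \<alpha>s k"
        using \<phi> \<psi> ps[OF that] \<alpha>s[OF that] par ends by (simp add: VCmp_VCmp TInv_cancel_left typing unit_simps)
      finally show ?thesis .
    qed
    then show "\<psi> \<bullet> \<beta> \<bullet> TInv \<phi> \<in> tracks T f' g' \<and> (\<forall>k < length ps. ps ! k \<rhd> (\<psi> \<bullet> \<beta> \<bullet> TInv \<phi>) = \<alpha>s k)"
      using \<beta> \<phi> \<psi> by (simp add: tracks_def typing)
  next
    fix \<alpha> assume "\<alpha> \<in> tracks T f' g' \<and> (\<forall>k < length ps. ps ! k \<rhd> \<alpha> = \<alpha>s k)"
    then have \<alpha>: "\<alpha> \<in> Trk T" "TSrc T \<alpha> = f'" "TTgt T \<alpha> = g'" "\<And>k. k < length ps \<Longrightarrow> ps ! k \<rhd> \<alpha> = \<alpha>s k"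
      unfolding tracks_def by auto
    have "ps ! k \<rhd> (TInv \<psi> \<bullet> \<alpha> \<bullet> \<phi>) = ?\<beta>s k" if "k < length ps" for k
      using \<alpha> \<phi> \<psi> ps[OF that] that par ends by (simp add: lw_VCmp typing lw_TInv)
    then have "TInv \<psi> \<bullet> \<alpha> \<bullet> \<phi> \<in> tracks T f g \<and> (\<forall>k < length ps. ps ! k \<rhd> (TInv \<psi> \<bullet> \<alpha> \<bullet> \<phi>) = ?\<beta>s k)"
      using \<alpha> \<phi> \<psi> by (simp add: tracks_def typing)
    then have "\<beta> = TInv \<psi> \<bullet> \<alpha> \<bullet> \<phi>"
      using ex1 \<beta>0 by blast
    then show "\<alpha> = \<psi> \<bullet> \<beta> \<bullet> TInv \<phi>"
      using \<alpha> \<phi> \<psi> by (simp add: VCmp_VCmp TInv_cancel_left typing unit_simps)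
  qed
qed

text \<open>The universal property passes to a homotopy retract \<open>Y\<close> of a test object \<open>Z\<close>: precompose the data with
  \<open>v\<close>, solve the problem at \<open>Z\<close>, and precompose the solution with \<open>u\<close>. This is how a lax product over the
  image of a weak equivalence is seen to be one over all objects.\<close>

lemma
  assumes c: "cone T Xs P ps"
    and u: "u \<in> Hom T Y Z" and v: "v \<in> Hom T Z Y" and vu: "homotopic (v \<cdot> u) (Idt T Y)"
  shows cones_lift_retract: "cones_lift T Xs P ps Z \<Longrightarrow> cones_lift T Xs P ps Y"
    and tracks_lift_retract: "tracks_lift T P ps Z \<Longrightarrow> tracks_lift T P ps Y"
proof -
  have len: "length ps = length Xs" and ps: "k < length Xs \<Longrightarrow> ps ! k \<in> Hom T P (Xs ! k)" for k
    using c unfolding cone_iff by auto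
  have uvD: "u \<in> Mor T" "Src T u = Y" "Tgt T u = Z" "v \<in> Mor T" "Src T v = Z" "Tgt T v = Y"
    using HomD[OF u] HomD[OF v] by auto
  {
    assume Z: "cones_lift T Xs P ps Z"
    show "cones_lift T Xs P ps Y"
      unfolding cones_lift_def
    proof (intro allI impI; elim conjE)
      fix fs assume fs: "length fs = length Xs" "\<forall>k < length Xs. fs ! k \<in> Hom T Y (Xs ! k)"
      have "\<forall>k < length Xs. map (\<lambda>f. f \<cdot> v) fs ! k \<in> Hom T Z (Xs ! k)"
        using fs Cmp_in[OF _ v] by simp
      then obtain h where h: "h \<in> Hom T Z P" "\<forall>k < length Xs. homotopic (ps ! k \<cdot> h) (fs ! k \<cdot> v)"
        using Z[unfolded cones_lift_def, THEN spec, of "map (\<lambda>f. f \<cdot> v) fs"] fs(1) by auto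
      have "homotopic (ps ! k \<cdot> h \<cdot> u) (fs ! k)" if k: "k < length Xs" for k
      proof -
        note typed = HomD[OF ps[OF k]] HomD[OF h(1)] HomD[OF fs(2)[rule_format, OF k]] uvD
        have "homotopic ((ps ! k \<cdot> h) \<cdot> u) ((fs ! k \<cdot> v) \<cdot> u)"
          by (rule homotopic_Cmp) (use h(2) k typed in \<open>auto simp: typing intro: homotopic_refl\<close>)
        also have "homotopic ((fs ! k \<cdot> v) \<cdot> u) (fs ! k)"
          using homotopic_Cmp[OF homotopic_refl vu, of "fs ! k"] typed by (simp add: Cmp_Cmp typing unit_simps)
        finally show ?thesis using typed by (simp add: Cmp_Cmp)
      qed
      then show "\<exists>h \<in> Hom T Y P. \<forall>k < length Xs. homotopic (ps ! k \<cdot> h) (fs ! k)"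
        using Cmp_in[OF h(1) u] by blast
    qed
  }
  assume Z: "tracks_lift T P ps Z"
  obtain \<theta> where \<theta>: "\<theta> \<in> Trk T" "TSrc T \<theta> = v \<cdot> u" "TTgt T \<theta> = Idt T Y" using homotopicE[OF vu] .
  have Y: "Y \<in> Obj T" using Hom_objects[OF u] by blast
  show "tracks_lift T P ps Y"
    unfolding tracks_lift_def
  proof (intro ballI)
    fix f g assume f: "f \<in> Hom T Y P" and g: "g \<in> Hom T Y P"
    note typed = HomD[OF f] HomD[OF g] uvD \<theta> Y
    have lift: "lifts_uniquely T ps (f \<cdot> v) (g \<cdot> v)"
      using Z Cmp_in[OF f v] Cmp_in[OF g v] unfolding tracks_lift_def by blast
    \<comment> \<open>Whiskering a track with \<open>v u\<close> is conjugation by \<open>\<theta>\<close>.\<close>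
    have nat: "(b \<rhd> \<theta>) \<bullet> (\<gamma> \<lhd> (v \<cdot> u)) = \<gamma> \<bullet> (a \<rhd> \<theta>)"
      if "\<gamma> \<in> Trk T" "TSrc T \<gamma> = a" "TTgt T \<gamma> = b" "Src T a = Y" for \<gamma> a b
      using HCmp_rl[of \<gamma> \<theta>] HCmp_lr[of \<gamma> \<theta>] that typed by (simp add: typing unit_simps)
    show "lifts_uniquely T ps f g"
      unfolding lifts_uniquely_def
    proof (intro allI impI)
      fix \<alpha>s assume "\<forall>k < length ps. \<alpha>s k \<in> tracks T (ps ! k \<cdot> f) (ps ! k \<cdot> g)"
      then have \<alpha>s: "\<And>k. k < length ps \<Longrightarrow> \<alpha>s k \<in> Trk T \<and> TSrc T (\<alpha>s k) = ps ! k \<cdot> f \<and> TTgt T (\<alpha>s k) = ps ! k \<cdot> g"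
        unfolding tracks_def by auto
      have psD: "ps ! k \<in> Mor T \<and> Src T (ps ! k) = P" if "k < length ps" for k
        using ps that len by (simp add: Hom_def)
      have "\<forall>k < length ps. \<alpha>s k \<lhd> v \<in> tracks T (ps ! k \<cdot> f \<cdot> v) (ps ! k \<cdot> g \<cdot> v)"
        using \<alpha>s psD typed by (simp add: tracks_def typing Cmp_Cmp)
      then have ex1: "\<exists>!\<gamma>. \<gamma> \<in> tracks T (f \<cdot> v) (g \<cdot> v) \<and> (\<forall>k < length ps. ps ! k \<rhd> \<gamma> = \<alpha>s k \<lhd> v)"
        by (rule lift[unfolded lifts_uniquely_def, THEN spec, THEN mp])
      then obtain \<gamma> where \<gamma>0: "\<gamma> \<in> tracks T (f \<cdot> v) (g \<cdot> v) \<and> (\<forall>k < length ps. ps ! k \<rhd> \<gamma> = \<alpha>s k \<lhd> v)"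
        by blast
      then have \<gamma>: "\<gamma> \<in> Trk T" "TSrc T \<gamma> = f \<cdot> v" "TTgt T \<gamma> = g \<cdot> v"
          "\<And>k. k < length ps \<Longrightarrow> ps ! k \<rhd> \<gamma> = \<alpha>s k \<lhd> v"
        unfolding tracks_def by auto
      let ?\<delta> = "(g \<rhd> \<theta>) \<bullet> (\<gamma> \<lhd> u) \<bullet> TInv (f \<rhd> \<theta>)"
      have \<gamma>u: "\<gamma> \<lhd> u \<in> Trk T" "TSrc T (\<gamma> \<lhd> u) = f \<cdot> v \<cdot> u" "TTgt T (\<gamma> \<lhd> u) = g \<cdot> v \<cdot> u"
        using \<gamma>(1-3) typed by (simp_all add: typing Cmp_Cmp)
      have g\<theta>: "g \<rhd> \<theta> \<in> Trk T" "TSrc T (g \<rhd> \<theta>) = g \<cdot> v \<cdot> u" "TTgt T (g \<rhd> \<theta>) = g"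
        and f\<theta>: "f \<rhd> \<theta> \<in> Trk T" "TSrc T (f \<rhd> \<theta>) = f \<cdot> v \<cdot> u" "TTgt T (f \<rhd> \<theta>) = f"
        using typed by (simp_all add: typing unit_simps)
      show "\<exists>!\<alpha>. \<alpha> \<in> tracks T f g \<and> (\<forall>k < length ps. ps ! k \<rhd> \<alpha> = \<alpha>s k)"
      proof (rule ex1I[of _ ?\<delta>])
        have "ps ! k \<rhd> ?\<delta> = \<alpha>s k" if k: "k < length ps" for k
        proof -
          note pk = psD[OF k]
          have "ps ! k \<rhd> ?\<delta> = (ps ! k \<rhd> g \<rhd> \<theta>) \<bullet> (ps ! k \<rhd> (\<gamma> \<lhd> u)) \<bullet> TInv (ps ! k \<rhd> f \<rhd> \<theta>)"
            using pk typed \<gamma>u f\<theta> g\<theta> by (simp add: lw_VCmp lw_TInv[symmetric] typing)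
          also have "ps ! k \<rhd> (\<gamma> \<lhd> u) = \<alpha>s k \<lhd> (v \<cdot> u)"
            using pk typed \<gamma>(1-3) \<gamma>(4)[OF k] \<alpha>s[OF k] by (simp add: lw_rw[symmetric] rw_rw typing)
          also have "(ps ! k \<rhd> g \<rhd> \<theta>) \<bullet> (\<alpha>s k \<lhd> (v \<cdot> u)) \<bullet> TInv (ps ! k \<rhd> f \<rhd> \<theta>)
              = ((ps ! k \<cdot> g \<rhd> \<theta>) \<bullet> (\<alpha>s k \<lhd> (v \<cdot> u))) \<bullet> TInv (ps ! k \<cdot> f \<rhd> \<theta>)"
            using pk typed \<alpha>s[OF k] by (simp add: lw_lw typing VCmp_VCmp Cmp_Cmp)
          also have "\<dots> = \<alpha>s k"
            using nat[of "\<alpha>s k" "ps ! k \<cdot> f" "ps ! k \<cdot> g"] pk typed \<alpha>s[OF k]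
            by (simp add: typing VCmp_VCmp Cmp_Cmp unit_simps)
          finally show ?thesis .
        qed
        moreover have "?\<delta> \<in> tracks T f g" using \<gamma>u f\<theta> g\<theta> by (simp add: tracks_def typing)
        ultimately show "?\<delta> \<in> tracks T f g \<and> (\<forall>k < length ps. ps ! k \<rhd> ?\<delta> = \<alpha>s k)" by blast
      next
        fix \<alpha> assume "\<alpha> \<in> tracks T f g \<and> (\<forall>k < length ps. ps ! k \<rhd> \<alpha> = \<alpha>s k)"
        then have \<alpha>: "\<alpha> \<in> Trk T" "TSrc T \<alpha> = f" "TTgt T \<alpha> = g" "\<And>k. k < length ps \<Longrightarrow> ps ! k \<rhd> \<alpha> = \<alpha>s k"
          unfolding tracks_def by auto
        have "ps ! k \<rhd> (\<alpha> \<lhd> v) = \<alpha>s k \<lhd> v" if k: "k < length ps" for k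
          using psD[OF k] typed \<alpha>(1-3) \<alpha>(4)[OF k] by (simp add: lw_rw[symmetric] typing)
        moreover have "\<alpha> \<lhd> v \<in> tracks T (f \<cdot> v) (g \<cdot> v)"
          using \<alpha>(1-3) typed by (simp add: tracks_def typing)
        ultimately have "\<gamma> = \<alpha> \<lhd> v" using ex1 \<gamma>0 by blast
        then have "?\<delta> = (g \<rhd> \<theta>) \<bullet> (\<alpha> \<lhd> (v \<cdot> u)) \<bullet> TInv (f \<rhd> \<theta>)"
          using \<alpha>(1-3) typed by (simp add: rw_rw)
        also have "\<dots> = ((g \<rhd> \<theta>) \<bullet> (\<alpha> \<lhd> (v \<cdot> u))) \<bullet> TInv (f \<rhd> \<theta>)"
          using \<alpha>(1-3) typed by (simp add: VCmp_VCmp typing Cmp_Cmp)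
        also have "\<dots> = \<alpha>"
          using nat[of \<alpha> f g] \<alpha>(1-3) typed f\<theta> by (simp add: VCmp_VCmp typing unit_simps)
        finally show "\<alpha> = ?\<delta>" by simp
      qed
    qed
  qed
qed

end

section \<open>Weak equivalences\<close>

context track_functor
begin

interpretation U: cat_functor S T "\<lparr>fob = on_ob F, fmor = on_arr F\<rparr>"
  by (rule underlying_functor)

lemma on_ob_in: "X \<in> Obj S \<Longrightarrow> on_ob F X \<in> Obj T"
  and on_arr_Mor: "f \<in> Mor S \<Longrightarrow> on_arr F f \<in> Mor T"
  and Src_on_arr: "f \<in> Mor S \<Longrightarrow> Src T (on_arr F f) = on_ob F (Src S f)"
  and Tgt_on_arr: "f \<in> Mor S \<Longrightarrow> Tgt T (on_arr F f) = on_ob F (Tgt S f)"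
  and on_arr_Cmp: "g \<in> Mor S \<Longrightarrow> f \<in> Mor S \<Longrightarrow> Src S g = Tgt S f \<Longrightarrow>
    on_arr F (Cmp S g f) = Cmp T (on_arr F g) (on_arr F f)"
  and on_arr_Idt: "X \<in> Obj S \<Longrightarrow> on_arr F (Idt S X) = Idt T (on_ob F X)"
  using U.fun_simps by simp_all

lemma hom_functor_of: "f \<in> Mor S \<Longrightarrow>
    cat_functor (hom_groupoid S (Src S f) (Tgt S f)) (hom_groupoid T (on_ob F (Src S f)) (on_ob F (Tgt S f))) (hom_func F)"
  using hom_functor S.Src_in S.Tgt_in by blast

lemma on_trk_Trk: "\<alpha> \<in> Trk S \<Longrightarrow> on_trk F \<alpha> \<in> Trk T"
  and TSrc_on_trk: "\<alpha> \<in> Trk S \<Longrightarrow> TSrc T (on_trk F \<alpha>) = on_arr F (TSrc S \<alpha>)"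
  and TTgt_on_trk: "\<alpha> \<in> Trk S \<Longrightarrow> TTgt T (on_trk F \<alpha>) = on_arr F (TTgt S \<alpha>)"
  using cat_functor.fmor_Mor[OF hom_functor_of[OF S.TSrc_in], of \<alpha> \<alpha>]
    cat_functor.Src_fmor[OF hom_functor_of[OF S.TSrc_in], of \<alpha> \<alpha>]
    cat_functor.Tgt_fmor[OF hom_functor_of[OF S.TSrc_in], of \<alpha> \<alpha>]
    S.TSrc_in[of \<alpha>]
  by (auto simp: hom_func_def Hom_def)

lemma on_trk_VCmp:
  assumes "\<beta> \<in> Trk S" "\<alpha> \<in> Trk S" "TSrc S \<beta> = TTgt S \<alpha>"
  shows "on_trk F (VCmp S \<beta> \<alpha>) = VCmp T (on_trk F \<beta>) (on_trk F \<alpha>)"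
  using cat_functor.fmor_Cmp'[OF hom_functor_of[OF S.TSrc_in], of \<alpha> \<beta> \<alpha>] S.TSrc_in[of \<alpha>] assms
  by (simp add: hom_func_def Hom_def S.typing)

lemma on_trk_TId: "f \<in> Mor S \<Longrightarrow> on_trk F (TId S f) = TId T (on_arr F f)"
  using cat_functor.fmor_Idt[OF hom_functor_of, of f f] by (simp add: hom_func_def Hom_def)

lemma on_trk_HCmp':
  "\<beta> \<in> Trk S \<Longrightarrow> \<alpha> \<in> Trk S \<Longrightarrow> Src S (TSrc S \<beta>) = Tgt S (TSrc S \<alpha>) \<Longrightarrow>
    on_trk F (HCmp S \<beta> \<alpha>) = HCmp T (on_trk F \<beta>) (on_trk F \<alpha>)"
  using on_trk_HCmp[of \<beta> "Tgt S (TSrc S \<alpha>)" "Tgt S (TSrc S \<beta>)" \<alpha> "Src S (TSrc S \<alpha>)"] S.TSrc_in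
  by (simp add: Hom_def)

lemmas map_simps = on_ob_in on_arr_Mor Src_on_arr Tgt_on_arr on_arr_Cmp on_arr_Idt on_trk_Trk TSrc_on_trk
  TTgt_on_trk on_trk_VCmp on_trk_TId on_trk_HCmp'

lemma on_arr_homotopic: "S.homotopic f g \<Longrightarrow> T.homotopic (on_arr F f) (on_arr F g)"
  by (elim S.homotopicE, rule_tac \<alpha> = "on_trk F \<alpha>" in T.homotopicI) (auto simp: map_simps)

lemma on_arr_Hom: "f \<in> Hom S X Y \<Longrightarrow> on_arr F f \<in> Hom T (on_ob F X) (on_ob F Y)"
  by (simp add: Hom_def map_simps)

lemma on_trk_tracks: "\<alpha> \<in> tracks S f g \<Longrightarrow> on_trk F \<alpha> \<in> tracks T (on_arr F f) (on_arr F g)"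
  by (auto simp: tracks_def map_simps)

lemma cone_image: "cone S Xs P ps \<Longrightarrow> cone T (map (on_ob F) Xs) (on_ob F P) (map (on_arr F) ps)"
  unfolding cone_iff using on_arr_Hom by (simp add: map_simps)

end

lemma hom_cat_functorI:
  assumes "track_category S" "track_category T" "X \<in> Obj S" "Y \<in> Obj S"
    and ob: "\<And>X. X \<in> Obj S \<Longrightarrow> on_ob F X \<in> Obj T"
    and arr: "\<And>f X Y. f \<in> Hom S X Y \<Longrightarrow> on_arr F f \<in> Hom T (on_ob F X) (on_ob F Y)"
    and trk: "\<And>\<alpha> f g. \<alpha> \<in> tracks S f g \<Longrightarrow> on_trk F \<alpha> \<in> tracks T (on_arr F f) (on_arr F g)"
    and TId: "\<And>f. f \<in> Mor S \<Longrightarrow> on_trk F (TId S f) = TId T (on_arr F f)"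
    and VCmp: "\<And>\<beta> \<alpha> f g h. \<beta> \<in> tracks S g h \<Longrightarrow> \<alpha> \<in> tracks S f g \<Longrightarrow>
      on_trk F (VCmp S \<beta> \<alpha>) = VCmp T (on_trk F \<beta>) (on_trk F \<alpha>)"
  shows "cat_functor (hom_groupoid S X Y) (hom_groupoid T (on_ob F X) (on_ob F Y)) (hom_func F)"
proof -
  interpret S: track_category S by (fact assms(1))
  interpret T: track_category T by (fact assms(2))
  show ?thesis
  proof (rule cat_functor.intro)
    show "category (hom_groupoid S X Y)" "category (hom_groupoid T (on_ob F X) (on_ob F Y))"
      using S.category_hom_groupoid T.category_hom_groupoid assms(3,4) ob by auto
    show "cat_functor_axioms (hom_groupoid S X Y) (hom_groupoid T (on_ob F X) (on_ob F Y)) (hom_func F)"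
    proof
      show "fmor (hom_func F) \<alpha> \<in> Hom (hom_groupoid T (on_ob F X) (on_ob F Y)) (fob (hom_func F) f) (fob (hom_func F) g)"
        if "\<alpha> \<in> Hom (hom_groupoid S X Y) f g" for \<alpha> f g
        using that arr trk by (simp add: hom_func_def S.Hom_hom_groupoid_iff(1) T.Hom_hom_groupoid_iff(1))
      show "fmor (hom_func F) (Cmp (hom_groupoid S X Y) \<beta> \<alpha>) = Cmp (hom_groupoid T (on_ob F X) (on_ob F Y))
          (fmor (hom_func F) \<beta>) (fmor (hom_func F) \<alpha>)"
        if "\<beta> \<in> Hom (hom_groupoid S X Y) g h" "\<alpha> \<in> Hom (hom_groupoid S X Y) f g" for \<beta> \<alpha> f g h
        using that VCmp[of \<beta> g h \<alpha> f] by (simp add: hom_func_def S.Hom_hom_groupoid_iff(1))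
    qed (use arr TId in \<open>auto simp: hom_func_def dest: HomD\<close>)
  qed
qed

lemma track_functorI:
  assumes "track_category S" "track_category T"
    and ob: "\<And>X. X \<in> Obj S \<Longrightarrow> on_ob F X \<in> Obj T"
    and arr: "\<And>f X Y. f \<in> Hom S X Y \<Longrightarrow> on_arr F f \<in> Hom T (on_ob F X) (on_ob F Y)"
    and Idt: "\<And>X. X \<in> Obj S \<Longrightarrow> on_arr F (Idt S X) = Idt T (on_ob F X)"
    and Cmp: "\<And>g f. g \<in> Mor S \<Longrightarrow> f \<in> Mor S \<Longrightarrow> Src S g = Tgt S f \<Longrightarrow>
      on_arr F (Cmp S g f) = Cmp T (on_arr F g) (on_arr F f)"
    and trk: "\<And>\<alpha> f g. \<alpha> \<in> tracks S f g \<Longrightarrow> on_trk F \<alpha> \<in> tracks T (on_arr F f) (on_arr F g)"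
    and TId: "\<And>f. f \<in> Mor S \<Longrightarrow> on_trk F (TId S f) = TId T (on_arr F f)"
    and VCmp: "\<And>\<beta> \<alpha> f g h. \<beta> \<in> tracks S g h \<Longrightarrow> \<alpha> \<in> tracks S f g \<Longrightarrow>
      on_trk F (VCmp S \<beta> \<alpha>) = VCmp T (on_trk F \<beta>) (on_trk F \<alpha>)"
    and HCmp: "\<And>\<beta> \<alpha> f f' g g'. \<beta> \<in> tracks S g g' \<Longrightarrow> \<alpha> \<in> tracks S f f' \<Longrightarrow> Src S g = Tgt S f \<Longrightarrow>
      on_trk F (HCmp S \<beta> \<alpha>) = HCmp T (on_trk F \<beta>) (on_trk F \<alpha>)"
  shows "track_functor S T F"
proof -
  interpret S: track_category S by (fact assms(1))
  interpret T: track_category T by (fact assms(2))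
  show ?thesis
  proof (rule track_functor.intro[OF assms(1,2)], rule track_functor_axioms.intro)
    show "cat_functor S T \<lparr>fob = on_ob F, fmor = on_arr F\<rparr>"
      by unfold_locales (use ob arr Idt Cmp in \<open>auto simp: Hom_def\<close>)
    show "cat_functor (hom_groupoid S X Y) (hom_groupoid T (on_ob F X) (on_ob F Y)) (hom_func F)"
      if "X \<in> Obj S" "Y \<in> Obj S" for X Y
      by (rule hom_cat_functorI[OF assms(1,2) that ob arr trk TId VCmp])
    show "on_trk F (HCmp S \<beta> \<alpha>) = HCmp T (on_trk F \<beta>) (on_trk F \<alpha>)"
      if "\<beta> \<in> Mor (hom_groupoid S Y Z)" "\<alpha> \<in> Mor (hom_groupoid S X Y)" for \<beta> \<alpha> X Y Z
      using that by (intro HCmp[of _ "TSrc S \<beta>" "TTgt S \<beta>" _ "TSrc S \<alpha>" "TTgt S \<alpha>"]) (auto simp: tracks_def Hom_def)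
  qed
qed

definition bijective_on_tracks :: "('o, 'a, 't) track_category \<Rightarrow> ('p, 'b, 's) track_category \<Rightarrow>
    ('o, 'a, 't, 'p, 'b, 's, 'z) track_map_scheme \<Rightarrow> bool" where
  "bijective_on_tracks S T F \<longleftrightarrow> (\<forall>f \<in> Mor S. \<forall>g \<in> Mor S. Src S f = Src S g \<longrightarrow> Tgt S f = Tgt S g \<longrightarrow>
    bij_betw (on_trk F) (tracks S f g) (tracks T (on_arr F f) (on_arr F g)))"

definition full_up_to_homotopy :: "('o, 'a, 't) track_category \<Rightarrow> ('p, 'b, 's) track_category \<Rightarrow>
    ('o, 'a, 't, 'p, 'b, 's, 'z) track_map_scheme \<Rightarrow> bool" where
  "full_up_to_homotopy S T F \<longleftrightarrow> (\<forall>X \<in> Obj S. \<forall>Y \<in> Obj S. \<forall>g \<in> Hom T (on_ob F X) (on_ob F Y).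
    \<exists>f \<in> Hom S X Y. track_category.homotopic T (on_arr F f) g)"

lemma bijective_on_tracksD:
  assumes "bijective_on_tracks S T F" "f \<in> Hom S X Y" "g \<in> Hom S X Y"
  shows "bij_betw (on_trk F) (tracks S f g) (tracks T (on_arr F f) (on_arr F g))"
  using assms unfolding bijective_on_tracks_def Hom_def by auto

lemma (in track_category) isomorphic_hom_groupoid:
  assumes f: "f \<in> Hom T X Y"
  shows "isomorphic (hom_groupoid T X Y) f g \<longleftrightarrow> homotopic f g"
proof
  assume "isomorphic (hom_groupoid T X Y) f g"
  then show "homotopic f g"
    unfolding isomorphic_def Hom_hom_groupoid[OF f] by (auto simp: tracks_def intro: homotopicI)
next
  assume "homotopic f g"
  then obtain \<alpha> where "\<alpha> \<in> tracks T f g" unfolding homotopic_def by auto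
  then have "\<alpha> \<in> Hom (hom_groupoid T X Y) f g" unfolding Hom_hom_groupoid[OF f] .
  moreover have "isomorphism (hom_groupoid T X Y) \<alpha>"
    using groupoid.all_isomorphism[OF hom_groupoid, of X Y \<alpha>] Hom_objects[OF f]
      HomD[of \<alpha> "hom_groupoid T X Y" f g] calculation f by simp
  ultimately show "isomorphic (hom_groupoid T X Y) f g" unfolding isomorphic_def by blast
qed

text \<open>Isomorphic objects of a Hom-groupoid are homotopic 1-arrows, so a functor between Hom-groupoids is an
  equivalence if it is bijective on tracks and full up to homotopy.\<close>

theorem weak_equivalence_iff:
  "weak_equivalence S T F \<longleftrightarrow> track_functor S T F \<and> bijective_on_tracks S T F \<and> full_up_to_homotopy S T F \<and>
    (\<forall>Y \<in> Obj T. \<exists>X \<in> Obj S. homotopy_equivalent T Y (on_ob F X))"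
proof -
  have "(\<forall>X \<in> Obj S. \<forall>Y \<in> Obj S. equivalence_of_categories (hom_groupoid S X Y)
      (hom_groupoid T (on_ob F X) (on_ob F Y)) (hom_func F)) \<longleftrightarrow>
    bijective_on_tracks S T F \<and> full_up_to_homotopy S T F" if F: "track_functor S T F"
  proof -
    interpret track_functor S T F by (fact F)
    have eq: "equivalence_of_categories (hom_groupoid S X Y) (hom_groupoid T (on_ob F X) (on_ob F Y)) (hom_func F) \<longleftrightarrow>
        (\<forall>f \<in> Hom S X Y. \<forall>g \<in> Hom S X Y. bij_betw (on_trk F) (tracks S f g) (tracks T (on_arr F f) (on_arr F g))) \<and>
        (\<forall>g \<in> Hom T (on_ob F X) (on_ob F Y). \<exists>f \<in> Hom S X Y. T.homotopic (on_arr F f) g)"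
      if X: "X \<in> Obj S" and Y: "Y \<in> Obj S" for X Y
    proof -
      interpret H: cat_functor "hom_groupoid S X Y" "hom_groupoid T (on_ob F X) (on_ob F Y)" "hom_func F"
        by (rule hom_functor[OF X Y])
      have 1: "fully_faithful (hom_groupoid S X Y) (hom_groupoid T (on_ob F X) (on_ob F Y)) (hom_func F) \<longleftrightarrow>
        (\<forall>f \<in> Hom S X Y. \<forall>g \<in> Hom S X Y. bij_betw (on_trk F) (tracks S f g) (tracks T (on_arr F f) (on_arr F g)))"
        unfolding fully_faithful_def using Hom_hom_groupoid[of _ S X Y] Hom_hom_groupoid[OF on_arr_Hom]
        by (simp add: hom_func_def)
      have 2: "(\<forall>g \<in> Obj (hom_groupoid T (on_ob F X) (on_ob F Y)). \<exists>f \<in> Obj (hom_groupoid S X Y).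
          isomorphic (hom_groupoid T (on_ob F X) (on_ob F Y)) (fob (hom_func F) f) g) \<longleftrightarrow>
        (\<forall>g \<in> Hom T (on_ob F X) (on_ob F Y). \<exists>f \<in> Hom S X Y. T.homotopic (on_arr F f) g)"
        using T.isomorphic_hom_groupoid[OF on_arr_Hom] by (simp add: hom_func_def)
      show ?thesis using H.equivalence_of_categoriesI
          equivalence_of_categoriesD[of "hom_groupoid S X Y" "hom_groupoid T (on_ob F X) (on_ob F Y)" "hom_func F"] 1 2
        by blast
    qed
    have "bijective_on_tracks S T F \<longleftrightarrow> (\<forall>X \<in> Obj S. \<forall>Y \<in> Obj S. \<forall>f \<in> Hom S X Y. \<forall>g \<in> Hom S X Y.
        bij_betw (on_trk F) (tracks S f g) (tracks T (on_arr F f) (on_arr F g)))" (is "_ \<longleftrightarrow> ?r")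
    proof
      show "bijective_on_tracks S T F \<Longrightarrow> ?r" by (intro ballI) (rule bijective_on_tracksD)
      assume r: ?r
      show "bijective_on_tracks S T F"
        unfolding bijective_on_tracks_def
      proof (intro ballI impI)
        fix f g assume "f \<in> Mor S" "g \<in> Mor S" "Src S f = Src S g" "Tgt S f = Tgt S g"
        then show "bij_betw (on_trk F) (tracks S f g) (tracks T (on_arr F f) (on_arr F g))"
          using r S.Mor_Hom[of f] S.Mor_Hom[of g] S.Src_in S.Tgt_in by auto
      qed
    qed
    then show ?thesis unfolding full_up_to_homotopy_def using eq by (simp, blast)
  qed
  then show ?thesis unfolding weak_equivalence_def by blast
qed

text \<open>The local half of a weak equivalence, through which lifting problems in \<open>S\<close> and \<open>T\<close> are compared.\<close>

locale weak_equiv = track_functor +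
  assumes bij: "bijective_on_tracks S T F" and full: "full_up_to_homotopy S T F"
begin

lemma bij_tracks: "f \<in> Hom S X Y \<Longrightarrow> g \<in> Hom S X Y \<Longrightarrow>
    bij_betw (on_trk F) (tracks S f g) (tracks T (on_arr F f) (on_arr F g))"
  using bijective_on_tracksD[OF bij] .

lemma homotopic_reflect:
  assumes "f \<in> Hom S X Y" "g \<in> Hom S X Y" "T.homotopic (on_arr F f) (on_arr F g)"
  shows "S.homotopic f g"
  using assms bij_tracks[OF assms(1,2)] HomD[OF assms(1)] HomD[OF assms(2)]
  unfolding S.homotopic_def T.homotopic_def bij_betw_def by auto

lemma full_arrow:
  assumes "X \<in> Obj S" "Y \<in> Obj S" "g \<in> Hom T (on_ob F X) (on_ob F Y)"
  obtains f where "f \<in> Hom S X Y" "T.homotopic (on_arr F f) g"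
  using full assms unfolding full_up_to_homotopy_def by blast

lemma cones_lift_image_iff:
  assumes c: "cone S Xs P ps" and Y: "Y \<in> Obj S"
  shows "cones_lift S Xs P ps Y \<longleftrightarrow>
    cones_lift T (map (on_ob F) Xs) (on_ob F P) (map (on_arr F) ps) (on_ob F Y)"
proof
  have P: "P \<in> Obj S" and len: "length ps = length Xs" and ps: "k < length Xs \<Longrightarrow> ps ! k \<in> Hom S P (Xs ! k)" for k
    using c unfolding cone_iff by auto
  have Xs: "k < length Xs \<Longrightarrow> Xs ! k \<in> Obj S" for k using S.Hom_objects[OF ps] by blast
  {
    assume l: "cones_lift S Xs P ps Y"
    show "cones_lift T (map (on_ob F) Xs) (on_ob F P) (map (on_arr F) ps) (on_ob F Y)"
      unfolding cones_lift_def
    proof (intro allI impI; elim conjE)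
      fix fs assume fs: "length fs = length (map (on_ob F) Xs)"
        "\<forall>k < length (map (on_ob F) Xs). fs ! k \<in> Hom T (on_ob F Y) (map (on_ob F) Xs ! k)"
      then have "\<forall>k. \<exists>f. k < length Xs \<longrightarrow> f \<in> Hom S Y (Xs ! k) \<and> T.homotopic (on_arr F f) (fs ! k)"
        using full_arrow[OF Y Xs] by (metis length_map nth_map)
      then obtain f where f: "\<And>k. k < length Xs \<Longrightarrow> f k \<in> Hom S Y (Xs ! k) \<and> T.homotopic (on_arr F (f k)) (fs ! k)"
        by metis
      then obtain h where h: "h \<in> Hom S Y P" "\<forall>k < length Xs. S.homotopic (Cmp S (ps ! k) h) (f k)"
        using l[unfolded cones_lift_def, THEN spec, of "map f [0..<length Xs]"] by auto
      have "T.homotopic (Cmp T (on_arr F (ps ! k)) (on_arr F h)) (fs ! k)" if k: "k < length Xs" for k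
        using on_arr_homotopic[of "Cmp S (ps ! k) h" "f k"] h(2) k f[OF k] HomD[OF ps[OF k]] HomD[OF h(1)]
          T.homotopic_trans by (simp add: on_arr_Cmp)
      then show "\<exists>h \<in> Hom T (on_ob F Y) (on_ob F P). \<forall>k < length (map (on_ob F) Xs).
          T.homotopic (Cmp T (map (on_arr F) ps ! k) h) (fs ! k)"
        using on_arr_Hom[OF h(1)] len by auto
    qed
  }
  assume l: "cones_lift T (map (on_ob F) Xs) (on_ob F P) (map (on_arr F) ps) (on_ob F Y)"
  show "cones_lift S Xs P ps Y"
    unfolding cones_lift_def
  proof (intro allI impI; elim conjE)
    fix fs assume fs: "length fs = length Xs" "\<forall>k < length Xs. fs ! k \<in> Hom S Y (Xs ! k)"
    then obtain h where h: "h \<in> Hom T (on_ob F Y) (on_ob F P)"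
      "\<forall>k < length Xs. T.homotopic (Cmp T (on_arr F (ps ! k)) h) (on_arr F (fs ! k))"
      using l[unfolded cones_lift_def, THEN spec, of "map (on_arr F) fs"] len on_arr_Hom by auto
    obtain h' where h': "h' \<in> Hom S Y P" "T.homotopic (on_arr F h') h"
      using full_arrow[OF Y P h(1)] .
    have "S.homotopic (Cmp S (ps ! k) h') (fs ! k)" if k: "k < length Xs" for k
    proof -
      note typed = HomD[OF ps[OF k]] HomD[OF h(1)] HomD[OF h'(1)]
      have "T.homotopic (Cmp T (on_arr F (ps ! k)) (on_arr F h')) (Cmp T (on_arr F (ps ! k)) h)"
        using typed h'(2) by (intro T.homotopic_Cmp T.homotopic_refl) (auto simp: map_simps)
      also have "T.homotopic (Cmp T (on_arr F (ps ! k)) h) (on_arr F (fs ! k))" using h(2) k by blast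
      finally show ?thesis using typed
        by (intro homotopic_reflect[OF S.Cmp_in[OF ps[OF k] h'(1)] fs(2)[rule_format, OF k]]) (simp add: map_simps)
    qed
    then show "\<exists>h \<in> Hom S Y P. \<forall>k < length Xs. S.homotopic (Cmp S (ps ! k) h) (fs ! k)" using h'(1) by blast
  qed
qed

text \<open>Both sides are the same lifting problem, read through the bijections on tracks.\<close>

lemma lifts_uniquely_image_iff:
  assumes c: "cone S Xs P ps" and f: "f \<in> Hom S Y P" and g: "g \<in> Hom S Y P"
  shows "lifts_uniquely S ps f g \<longleftrightarrow> lifts_uniquely T (map (on_arr F) ps) (on_arr F f) (on_arr F g)"
proof -
  have len: "length ps = length Xs" and ps: "k < length Xs \<Longrightarrow> ps ! k \<in> Hom S P (Xs ! k)" for k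
    using c unfolding cone_iff by auto
  have fgD: "f \<in> Mor S" "g \<in> Mor S" "Tgt S f = P" "Tgt S g = P" using HomD[OF f] HomD[OF g] by auto
  have bp: "bij_betw (on_trk F) (tracks S (Cmp S (ps ! k) f) (Cmp S (ps ! k) g))
      (tracks T (Cmp T (on_arr F (ps ! k)) (on_arr F f)) (Cmp T (on_arr F (ps ! k)) (on_arr F g)))"
    if k: "k < length ps" for k
    using bij_tracks[OF S.Cmp_in[OF ps[of k] f] S.Cmp_in[OF ps[of k] g]] k len HomD[OF ps, of k] fgD
    by (simp add: map_simps)
  have whisker: "on_trk F (HCmp S (TId S (ps ! k)) \<alpha>) = HCmp T (TId T (on_arr F (ps ! k))) (on_trk F \<alpha>)"
    "HCmp S (TId S (ps ! k)) \<alpha> \<in> tracks S (Cmp S (ps ! k) f) (Cmp S (ps ! k) g)"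
    if "\<alpha> \<in> tracks S f g" "k < length ps" for \<alpha> k
    using tracksD[OF that(1)] HomD[OF ps, of k] that(2) len fgD by (simp_all add: map_simps S.typing tracks_def)
  note bfg = bij_tracks[OF f g]
  show ?thesis
  proof
    assume l: "lifts_uniquely S ps f g"
    show "lifts_uniquely T (map (on_arr F) ps) (on_arr F f) (on_arr F g)"
      unfolding lifts_uniquely_def
    proof (intro allI impI)
      fix \<alpha>s assume "\<forall>k < length (map (on_arr F) ps). \<alpha>s k \<in>
        tracks T (Cmp T (map (on_arr F) ps ! k) (on_arr F f)) (Cmp T (map (on_arr F) ps ! k) (on_arr F g))"
      then have "\<forall>k. \<exists>\<beta>. k < length ps \<longrightarrow> \<beta> \<in> tracks S (Cmp S (ps ! k) f) (Cmp S (ps ! k) g) \<and> on_trk F \<beta> = \<alpha>s k"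
        using bp unfolding bij_betw_Ex1 by (metis length_map nth_map)
      then obtain \<beta>s where \<beta>s: "\<And>k. k < length ps \<Longrightarrow> \<beta>s k \<in> tracks S (Cmp S (ps ! k) f) (Cmp S (ps ! k) g)"
        "\<And>k. k < length ps \<Longrightarrow> on_trk F (\<beta>s k) = \<alpha>s k" by metis
      have ex1: "\<exists>!\<beta>. \<beta> \<in> tracks S f g \<and> (\<forall>k < length ps. HCmp S (TId S (ps ! k)) \<beta> = \<beta>s k)"
        using l[unfolded lifts_uniquely_def, THEN spec, THEN mp] \<beta>s(1) by blast
      then obtain \<beta> where \<beta>: "\<beta> \<in> tracks S f g" "\<forall>k < length ps. HCmp S (TId S (ps ! k)) \<beta> = \<beta>s k" by blast
      show "\<exists>!\<alpha>. \<alpha> \<in> tracks T (on_arr F f) (on_arr F g) \<and>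
        (\<forall>k < length (map (on_arr F) ps). HCmp T (TId T (map (on_arr F) ps ! k)) \<alpha> = \<alpha>s k)"
      proof (rule ex1I[of _ "on_trk F \<beta>"])
        show "on_trk F \<beta> \<in> tracks T (on_arr F f) (on_arr F g) \<and>
          (\<forall>k < length (map (on_arr F) ps). HCmp T (TId T (map (on_arr F) ps ! k)) (on_trk F \<beta>) = \<alpha>s k)"
          using on_trk_tracks[OF \<beta>(1)] \<beta>(2) \<beta>s(2) whisker(1)[OF \<beta>(1), symmetric] by simp
        fix \<alpha> assume \<alpha>: "\<alpha> \<in> tracks T (on_arr F f) (on_arr F g) \<and>
          (\<forall>k < length (map (on_arr F) ps). HCmp T (TId T (map (on_arr F) ps ! k)) \<alpha> = \<alpha>s k)"
        then obtain \<gamma> where \<gamma>: "\<gamma> \<in> tracks S f g" "on_trk F \<gamma> = \<alpha>" using bfg unfolding bij_betw_Ex1 by blast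
        have "HCmp S (TId S (ps ! k)) \<gamma> = \<beta>s k" if k: "k < length ps" for k
        proof -
          have "on_trk F (HCmp S (TId S (ps ! k)) \<gamma>) = on_trk F (\<beta>s k)"
            using whisker(1)[OF \<gamma>(1) k] \<alpha> \<gamma>(2) \<beta>s(2)[OF k] k by simp
          then show ?thesis
            using inj_onD[OF bij_betw_imp_inj_on[OF bp[OF k]]] whisker(2)[OF \<gamma>(1) k] \<beta>s(1)[OF k] by blast
        qed
        then have "\<gamma> = \<beta>" using ex1 \<beta> \<gamma>(1) by blast
        then show "\<alpha> = on_trk F \<beta>" using \<gamma>(2) by simp
      qed
    qed
  next
    assume l: "lifts_uniquely T (map (on_arr F) ps) (on_arr F f) (on_arr F g)"
    show "lifts_uniquely S ps f g"
      unfolding lifts_uniquely_def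
    proof (intro allI impI)
      fix \<alpha>s assume \<alpha>s: "\<forall>k < length ps. \<alpha>s k \<in> tracks S (Cmp S (ps ! k) f) (Cmp S (ps ! k) g)"
      then have "\<forall>k < length (map (on_arr F) ps). on_trk F (\<alpha>s k) \<in>
        tracks T (Cmp T (map (on_arr F) ps ! k) (on_arr F f)) (Cmp T (map (on_arr F) ps ! k) (on_arr F g))"
        using bp unfolding bij_betw_Ex1 by simp
      from l[unfolded lifts_uniquely_def, THEN spec, THEN mp, OF this]
      have ex1: "\<exists>!\<beta>. \<beta> \<in> tracks T (on_arr F f) (on_arr F g) \<and>
          (\<forall>k < length ps. HCmp T (TId T (on_arr F (ps ! k))) \<beta> = on_trk F (\<alpha>s k))" by simp
      have iff: "(HCmp T (TId T (on_arr F (ps ! k))) (on_trk F \<alpha>) = on_trk F (\<alpha>s k)) \<longleftrightarrow> HCmp S (TId S (ps ! k)) \<alpha> = \<alpha>s k"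
        if "\<alpha> \<in> tracks S f g" "k < length ps" for \<alpha> k
        unfolding whisker(1)[OF that, symmetric]
        by (rule inj_on_eq_iff[OF bij_betw_imp_inj_on[OF bp[OF that(2)]]])
          (use whisker(2)[OF that] \<alpha>s that(2) in blast)+
      obtain \<beta> where \<beta>: "\<beta> \<in> tracks T (on_arr F f) (on_arr F g)"
        "\<forall>k < length ps. HCmp T (TId T (on_arr F (ps ! k))) \<beta> = on_trk F (\<alpha>s k)" using ex1 by blast
      obtain \<alpha> where \<alpha>: "\<alpha> \<in> tracks S f g" "on_trk F \<alpha> = \<beta>" using bfg \<beta>(1) unfolding bij_betw_Ex1 by blast
      show "\<exists>!\<alpha>. \<alpha> \<in> tracks S f g \<and> (\<forall>k < length ps. HCmp S (TId S (ps ! k)) \<alpha> = \<alpha>s k)"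
      proof (rule ex1I[of _ \<alpha>])
        show "\<alpha> \<in> tracks S f g \<and> (\<forall>k < length ps. HCmp S (TId S (ps ! k)) \<alpha> = \<alpha>s k)"
          using \<alpha> \<beta>(2) iff[OF \<alpha>(1)] by simp
        fix \<gamma> assume \<gamma>: "\<gamma> \<in> tracks S f g \<and> (\<forall>k < length ps. HCmp S (TId S (ps ! k)) \<gamma> = \<alpha>s k)"
        then have "on_trk F \<gamma> = \<beta>" using ex1 \<beta> on_trk_tracks[of \<gamma> f g] iff[of \<gamma>] by blast
        then show "\<gamma> = \<alpha>" using \<alpha> \<gamma> inj_onD[OF bij_betw_imp_inj_on[OF bfg]] by blast
      qed
    qed
  qed
qed

text \<open>The 1-arrows of \<open>T\<close> between images need not be images, but they are homotopic to images.\<close>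

lemma tracks_lift_image_iff:
  assumes c: "cone S Xs P ps" and Y: "Y \<in> Obj S"
  shows "tracks_lift S P ps Y \<longleftrightarrow> tracks_lift T (on_ob F P) (map (on_arr F) ps) (on_ob F Y)"
proof
  have P: "P \<in> Obj S" and len: "length ps = length Xs" and ps: "k < length Xs \<Longrightarrow> ps ! k \<in> Hom S P (Xs ! k)" for k
    using c unfolding cone_iff by auto
  {
    assume l: "tracks_lift S P ps Y"
    show "tracks_lift T (on_ob F P) (map (on_arr F) ps) (on_ob F Y)"
      unfolding tracks_lift_def
    proof (intro ballI)
      fix f g assume f: "f \<in> Hom T (on_ob F Y) (on_ob F P)" and g: "g \<in> Hom T (on_ob F Y) (on_ob F P)"
      obtain f' where f': "f' \<in> Hom S Y P" "T.homotopic (on_arr F f') f" using full_arrow[OF Y P f] .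
      obtain g' where g': "g' \<in> Hom S Y P" "T.homotopic (on_arr F g') g" using full_arrow[OF Y P g] .
      have "lifts_uniquely T (map (on_arr F) ps) (on_arr F f') (on_arr F g')"
        using l f'(1) g'(1) lifts_uniquely_image_iff[OF c] unfolding tracks_lift_def by blast
      then show "lifts_uniquely T (map (on_arr F) ps) f g"
        using f' g' HomD[OF ps] len HomD[OF f'(1)] HomD[OF g'(1)]
        by (intro T.lifts_uniquely_homotopic[OF _ f'(2) g'(2)]) (auto simp: map_simps)
    qed
  }
  show "tracks_lift T (on_ob F P) (map (on_arr F) ps) (on_ob F Y) \<Longrightarrow> tracks_lift S P ps Y"
    using lifts_uniquely_image_iff[OF c] on_arr_Hom unfolding tracks_lift_def by blast
qed

end

lemma weak_equivalenceD:
  assumes "weak_equivalence S T F" shows "weak_equiv S T F"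
  using assms unfolding weak_equivalence_iff weak_equiv_def weak_equiv_axioms_def by blast

lemma weak_equivalence_reflects_lax_products:
  assumes F: "weak_equiv S T F" and c: "cone S Xs P ps"
    and lax: "lax_product T (map (on_ob F) Xs) (on_ob F P) (map (on_arr F) ps)"
  shows "lax_product S Xs P ps"
proof -
  interpret weak_equiv S T F by (fact F)
  show ?thesis
    using lax on_ob_in cones_lift_image_iff[OF c] tracks_lift_image_iff[OF c] c
    unfolding S.lax_product_iff T.lax_product_iff by blast
qed

text \<open>At test objects in the image of \<open>F\<close> the universal property is that of \<open>S\<close>; every other test object is a
  homotopy retract of one of these.\<close>

lemma weak_equivalence_preserves_lax_products:
  assumes F: "weak_equivalence S T F" and lax: "lax_product S Xs P ps"
  shows "lax_product T (map (on_ob F) Xs) (on_ob F P) (map (on_arr F) ps)"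
proof -
  interpret weak_equiv S T F by (rule weak_equivalenceD[OF F])
  have c: "cone S Xs P ps" using lax unfolding S.lax_product_iff by blast
  note cF = cone_image[OF c]
  show ?thesis
    unfolding T.lax_product_iff
  proof (intro conjI ballI cF)
    fix Y assume Y: "Y \<in> Obj T"
    obtain X where X: "X \<in> Obj S" "homotopy_equivalent T Y (on_ob F X)"
      using F Y unfolding weak_equivalence_iff by blast
    then obtain u v where u: "u \<in> Hom T Y (on_ob F X)" and v: "v \<in> Hom T (on_ob F X) Y"
      and vu: "T.homotopic (Cmp T v u) (Idt T Y)"
      using T.homotopy_equivalent_iff[OF Y on_ob_in[OF X(1)]] by blast
    have "cones_lift S Xs P ps X" "tracks_lift S P ps X" using lax X(1) unfolding S.lax_product_iff by blast+
    then have "cones_lift T (map (on_ob F) Xs) (on_ob F P) (map (on_arr F) ps) (on_ob F X)"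
      "tracks_lift T (on_ob F P) (map (on_arr F) ps) (on_ob F X)"
      using cones_lift_image_iff[OF c X(1)] tracks_lift_image_iff[OF c X(1)] by blast+
    then show "cones_lift T (map (on_ob F) Xs) (on_ob F P) (map (on_arr F) ps) Y"
      "tracks_lift T (on_ob F P) (map (on_arr F) ps) Y"
      using T.cones_lift_retract[OF cF u v vu] T.tracks_lift_retract[OF cF u v vu] by blast+
  qed
qed

lemma equivalence_of_track_theoriesI:
  assumes "track_theory S" "track_theory T" "weak_equivalence S T F"
  shows "equivalence_of_track_theories S T F"
  using assms weak_equivalence_preserves_lax_products[OF assms(3)] weak_equivalence_iff[of S T F]
  unfolding equivalence_of_track_theories_def track_theory_morphism_def by blast

lemma weak_equivalence_comp:
  assumes F: "weak_equivalence S T F" and G: "weak_equivalence T U G"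
  shows "weak_equivalence S U \<lparr>on_ob = on_ob G \<circ> on_ob F, on_arr = on_arr G \<circ> on_arr F, on_trk = on_trk G \<circ> on_trk F\<rparr>"
    (is "weak_equivalence S U ?H")
proof -
  interpret F: weak_equiv S T F by (rule weak_equivalenceD[OF F])
  interpret G: weak_equiv T U G by (rule weak_equivalenceD[OF G])
  have "track_functor S U ?H"
    by (rule track_functorI[OF F.S.track_category_axioms G.T.track_category_axioms])
      (auto simp: F.map_simps G.map_simps F.S.TSrc_in tracks_def intro: F.on_arr_Hom G.on_arr_Hom)
  moreover have "bijective_on_tracks S U ?H"
    unfolding bijective_on_tracks_def
  proof (intro ballI impI)
    fix f g assume fg: "f \<in> Mor S" "g \<in> Mor S" "Src S f = Src S g" "Tgt S f = Tgt S g"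
    have f: "f \<in> Hom S (Src S f) (Tgt S f)" and g: "g \<in> Hom S (Src S f) (Tgt S f)"
      using fg by (simp_all add: Hom_def)
    show "bij_betw (on_trk ?H) (tracks S f g) (tracks U (on_arr ?H f) (on_arr ?H g))"
      using bij_betw_trans[OF F.bij_tracks[OF f g] G.bij_tracks[OF F.on_arr_Hom[OF f] F.on_arr_Hom[OF g]]] by simp
  qed
  moreover have "full_up_to_homotopy S U ?H"
    unfolding full_up_to_homotopy_def
  proof (intro ballI)
    fix X Y g assume X: "X \<in> Obj S" and Y: "Y \<in> Obj S" and g: "g \<in> Hom U (on_ob ?H X) (on_ob ?H Y)"
    obtain f where f: "f \<in> Hom T (on_ob F X) (on_ob F Y)" "G.T.homotopic (on_arr G f) g"
      using G.full_arrow[OF F.on_ob_in[OF X] F.on_ob_in[OF Y]] g by auto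
    obtain e where e: "e \<in> Hom S X Y" "F.T.homotopic (on_arr F e) f" using F.full_arrow[OF X Y f(1)] .
    show "\<exists>f \<in> Hom S X Y. G.T.homotopic (on_arr ?H f) g"
      using e(1) G.T.homotopic_trans[OF G.on_arr_homotopic[OF e(2)] f(2)] by auto
  qed
  moreover have "\<exists>X \<in> Obj S. homotopy_equivalent U Z (on_ob ?H X)" if Z: "Z \<in> Obj U" for Z
  proof -
    obtain Y where Y: "Y \<in> Obj T" "homotopy_equivalent U Z (on_ob G Y)"
      using G Z unfolding weak_equivalence_iff by blast
    obtain X where X: "X \<in> Obj S" "homotopy_equivalent T Y (on_ob F X)"
      using F Y(1) unfolding weak_equivalence_iff by blast
    note FX = F.on_ob_in[OF X(1)]
    obtain u v where uv: "u \<in> Hom U Z (on_ob G Y)" "v \<in> Hom U (on_ob G Y) Z"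
      "G.T.homotopic (Cmp U v u) (Idt U Z)" "G.T.homotopic (Cmp U u v) (Idt U (on_ob G Y))"
      using Y G.T.homotopy_equivalent_iff[OF Z G.on_ob_in[OF Y(1)]] by blast
    obtain u' v' where uv': "u' \<in> Hom T Y (on_ob F X)" "v' \<in> Hom T (on_ob F X) Y"
      "F.T.homotopic (Cmp T v' u') (Idt T Y)" "F.T.homotopic (Cmp T u' v') (Idt T (on_ob F X))"
      using X F.T.homotopy_equivalent_iff[OF Y(1) FX] by blast
    note typed = HomD[OF uv(1)] HomD[OF uv(2)] HomD[OF uv'(1)] HomD[OF uv'(2)] Y(1) FX Z
    have "G.T.homotopic (on_arr G (Cmp T v' u')) (on_arr G (Idt T Y))"
      "G.T.homotopic (on_arr G (Cmp T u' v')) (on_arr G (Idt T (on_ob F X)))"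
      using G.on_arr_homotopic uv'(3,4) by blast+
    then have G': "G.T.homotopic (Cmp U (on_arr G v') (on_arr G u')) (Idt U (on_ob G Y))"
      "G.T.homotopic (Cmp U (on_arr G u') (on_arr G v')) (Idt U (on_ob G (on_ob F X)))"
      using typed by (simp_all add: G.map_simps)
    have retract: "G.T.homotopic (Cmp U (Cmp U b' b) (Cmp U a a')) (Idt U A)"
      if "a' \<in> Hom U A B" "a \<in> Hom U B C" "b \<in> Hom U C B" "b' \<in> Hom U B A"
        "G.T.homotopic (Cmp U b' a') (Idt U A)" "G.T.homotopic (Cmp U b a) (Idt U B)" for a a' b b' A B C
    proof -
      note t = HomD[OF that(1)] HomD[OF that(2)] HomD[OF that(3)] HomD[OF that(4)]
      have "G.T.homotopic (Cmp U b' (Cmp U (Cmp U b a) a')) (Cmp U b' (Cmp U (Idt U B) a'))"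
        using t that(6) by (auto simp: G.T.typing intro!: G.T.homotopic_Cmp G.T.homotopic_refl)
      also have "Cmp U b' (Cmp U (Idt U B) a') = Cmp U b' a'" using t by (simp add: G.T.unit_simps)
      also have "G.T.homotopic \<dots> (Idt U A)" by (fact that(5))
      finally show ?thesis using t by (simp add: G.T.cat_simps)
    qed
    have "Cmp U (on_arr G u') u \<in> Hom U Z (on_ob ?H X)" "Cmp U v (on_arr G v') \<in> Hom U (on_ob ?H X) Z"
      using typed by (simp_all add: Hom_def G.map_simps G.T.typing)
    moreover have "G.T.homotopic (Cmp U (Cmp U v (on_arr G v')) (Cmp U (on_arr G u') u)) (Idt U Z)"
      by (rule retract[OF uv(1) G.on_arr_Hom[OF uv'(1)] G.on_arr_Hom[OF uv'(2)] uv(2) uv(3) G'(1)])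
    moreover have "G.T.homotopic (Cmp U (Cmp U (on_arr G u') u) (Cmp U v (on_arr G v'))) (Idt U (on_ob ?H X))"
      using retract[OF G.on_arr_Hom[OF uv'(2)] uv(2) uv(1) G.on_arr_Hom[OF uv'(1)] G'(2) uv(4)] by simp
    ultimately have "homotopy_equivalent U Z (on_ob ?H X)"
      using G.T.homotopy_equivalent_iff[OF Z] G.on_ob_in[OF FX] by auto
    then show ?thesis using X(1) by blast
  qed
  ultimately show ?thesis unfolding weak_equivalence_iff by blast
qed

section \<open>Abelian track categories\<close>

lemma abelian_iff:
  assumes "track_category T"
  shows "abelian T \<longleftrightarrow> (\<forall>f \<in> Mor T. \<forall>\<alpha> \<in> tracks T f f. \<forall>\<beta> \<in> tracks T f f. VCmp T \<alpha> \<beta> = VCmp T \<beta> \<alpha>)"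
proof -
  interpret track_category T by (fact assms)
  have "comm_group (Aut T f) \<longleftrightarrow> (\<forall>\<alpha> \<in> tracks T f f. \<forall>\<beta> \<in> tracks T f f. \<alpha> \<bullet> \<beta> = \<beta> \<bullet> \<alpha>)" if f: "f \<in> Mor T" for f
  proof
    assume "comm_group (Aut T f)"
    then interpret comm_group "Aut T f" .
    show "\<forall>\<alpha> \<in> tracks T f f. \<forall>\<beta> \<in> tracks T f f. \<alpha> \<bullet> \<beta> = \<beta> \<bullet> \<alpha>" using m_comm by (simp add: Aut_def)
  next
    assume comm: "\<forall>\<alpha> \<in> tracks T f f. \<forall>\<beta> \<in> tracks T f f. \<alpha> \<bullet> \<beta> = \<beta> \<bullet> \<alpha>"
    show "comm_group (Aut T f)"
    proof (rule comm_groupI)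
      show "\<exists>\<beta> \<in> carrier (Aut T f). \<beta> \<otimes>\<^bsub>Aut T f\<^esub> \<alpha> = \<one>\<^bsub>Aut T f\<^esub>" if "\<alpha> \<in> carrier (Aut T f)" for \<alpha>
        using that by (intro bexI[of _ "TInv \<alpha>"]) (auto simp: Aut_def tracks_def typing unit_simps)
    qed (use comm f in \<open>auto simp: Aut_def tracks_def typing unit_simps VCmp_VCmp\<close>)
  qed
  then show ?thesis unfolding abelian_def by blast
qed

lemma abelian_reflected:
  assumes "track_category S" "track_category T" "abelian T" "bijective_on_tracks S T F"
    and arr: "\<And>f. f \<in> Mor S \<Longrightarrow> on_arr F f \<in> Mor T"
    and VCmp: "\<And>\<beta> \<alpha> f. \<beta> \<in> tracks S f f \<Longrightarrow> \<alpha> \<in> tracks S f f \<Longrightarrow> on_trk F (VCmp S \<beta> \<alpha>) = VCmp T (on_trk F \<beta>) (on_trk F \<alpha>)"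
  shows "abelian S"
  unfolding abelian_iff[OF assms(1)]
proof (intro ballI)
  interpret S: track_category S by (fact assms(1))
  fix f \<alpha> \<beta> assume f: "f \<in> Mor S" and \<alpha>: "\<alpha> \<in> tracks S f f" and \<beta>: "\<beta> \<in> tracks S f f"
  have b: "bij_betw (on_trk F) (tracks S f f) (tracks T (on_arr F f) (on_arr F f))"
    using assms(4) f unfolding bijective_on_tracks_def by blast
  then have "on_trk F \<alpha> \<in> tracks T (on_arr F f) (on_arr F f)" "on_trk F \<beta> \<in> tracks T (on_arr F f) (on_arr F f)"
    using \<alpha> \<beta> bij_betwE by blast+
  then have "on_trk F (VCmp S \<alpha> \<beta>) = on_trk F (VCmp S \<beta> \<alpha>)"
    using assms(3) arr[OF f] VCmp[OF \<alpha> \<beta>] VCmp[OF \<beta> \<alpha>] unfolding abelian_iff[OF assms(2)] by simp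
  moreover have "VCmp S \<alpha> \<beta> \<in> tracks S f f" "VCmp S \<beta> \<alpha> \<in> tracks S f f"
    using \<alpha> \<beta> by (auto simp: tracks_def S.typing)
  ultimately show "VCmp S \<alpha> \<beta> = VCmp S \<beta> \<alpha>"
    using inj_onD[OF bij_betw_imp_inj_on[OF b]] by blast
qed

section \<open>Renaming\<close>

context
  fixes T :: "('o, 'a, 't) track_category" and i :: "'o \<Rightarrow> 'p" and j :: "'a \<Rightarrow> 'b" and k :: "'t \<Rightarrow> 's"
  assumes T: "track_category T" and inj: "inj i" "inj j" "inj k"
begin

interpretation track_category T by (fact T)

lemma rename_simps:
  "Obj (rename i j k T) = i ` Obj T" "Mor (rename i j k T) = j ` Mor T" "Trk (rename i j k T) = k ` Trk T"
  "Src (rename i j k T) (j f) = i (Src T f)" "Tgt (rename i j k T) (j f) = i (Tgt T f)"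
  "Idt (rename i j k T) (i X) = j (Idt T X)" "Cmp (rename i j k T) (j g) (j f) = j (Cmp T g f)"
  "TSrc (rename i j k T) (k \<alpha>) = j (TSrc T \<alpha>)" "TTgt (rename i j k T) (k \<alpha>) = j (TTgt T \<alpha>)"
  "TId (rename i j k T) (j f) = k (TId T f)" "VCmp (rename i j k T) (k \<beta>) (k \<alpha>) = k (VCmp T \<beta> \<alpha>)"
  "HCmp (rename i j k T) (k \<beta>) (k \<alpha>) = k (HCmp T \<beta> \<alpha>)"
  unfolding rename_def using inj by simp_all

lemma Hom_rename: "f \<in> Hom (rename i j k T) X Y \<longleftrightarrow>
    (\<exists>f'. f = j f' \<and> f' \<in> Mor T \<and> X = i (Src T f') \<and> Y = i (Tgt T f'))"
  unfolding Hom_def by (auto simp: rename_simps)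

lemma tracks_rename: "\<alpha> \<in> tracks (rename i j k T) f g \<longleftrightarrow>
    (\<exists>\<alpha>'. \<alpha> = k \<alpha>' \<and> \<alpha>' \<in> Trk T \<and> f = j (TSrc T \<alpha>') \<and> g = j (TTgt T \<alpha>'))"
  unfolding tracks_def by (auto simp: rename_simps)

lemmas inj_simps = inj[THEN inj_eq]

lemma track_category_rename: "track_category (rename i j k T)"
proof (rule track_categoryI)
  show "category (rename i j k T)"
    by unfold_locales
      (auto simp: Hom_rename rename_simps inj_simps cat_simps)
  fix \<alpha> f g assume "\<alpha> \<in> tracks (rename i j k T) f g"
  then obtain \<alpha>' where \<alpha>': "\<alpha> = k \<alpha>'" "\<alpha>' \<in> Trk T" "f = j (TSrc T \<alpha>')" "g = j (TTgt T \<alpha>')"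
    unfolding tracks_rename by blast
  show "\<exists>\<beta> \<in> tracks (rename i j k T) g f. VCmp (rename i j k T) \<beta> \<alpha> = TId (rename i j k T) f \<and>
      VCmp (rename i j k T) \<alpha> \<beta> = TId (rename i j k T) g"
    using \<alpha>' by (intro bexI[of _ "k (TInv \<alpha>')"]) (auto simp: tracks_rename rename_simps typing unit_simps)
next
  fix \<beta> \<beta>' \<alpha> \<alpha>' f f' f'' g g' g''
  assume "\<beta> \<in> tracks (rename i j k T) g g'" "\<beta>' \<in> tracks (rename i j k T) g' g''"
    "\<alpha> \<in> tracks (rename i j k T) f f'" "\<alpha>' \<in> tracks (rename i j k T) f' f''"
    "Src (rename i j k T) g = Tgt (rename i j k T) f"
  then show "HCmp (rename i j k T) (VCmp (rename i j k T) \<beta>' \<beta>) (VCmp (rename i j k T) \<alpha>' \<alpha>)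
      = VCmp (rename i j k T) (HCmp (rename i j k T) \<beta>' \<alpha>') (HCmp (rename i j k T) \<beta> \<alpha>)"
    by (auto simp: tracks_rename rename_simps inj_simps interchange)
qed (auto simp: tracks_rename Hom_rename rename_simps inj_simps typing unit_simps VCmp_VCmp HCmp_HCmp)

theorem weak_equivalence_rename:
  "weak_equivalence T (rename i j k T) \<lparr>on_ob = i, on_arr = j, on_trk = k\<rparr>"
  unfolding weak_equivalence_iff
proof (intro conjI ballI)
  show "track_functor T (rename i j k T) \<lparr>on_ob = i, on_arr = j, on_trk = k\<rparr>"
    by (rule track_functorI[OF T track_category_rename])
      (auto simp: tracks_rename Hom_rename rename_simps Hom_def tracks_def)
  have "tracks (rename i j k T) (j f) (j g) = k ` tracks T f g" for f g
    unfolding set_eq_iff tracks_rename by (auto simp: tracks_def inj_simps)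
  then show "bijective_on_tracks T (rename i j k T) \<lparr>on_ob = i, on_arr = j, on_trk = k\<rparr>"
    unfolding bijective_on_tracks_def bij_betw_def using inj(3) by (auto intro: inj_on_subset)
  interpret R: track_category "rename i j k T" by (rule track_category_rename)
  show "full_up_to_homotopy T (rename i j k T) \<lparr>on_ob = i, on_arr = j, on_trk = k\<rparr>"
    unfolding full_up_to_homotopy_def using R.homotopic_refl
    by (fastforce simp: Hom_rename inj_simps Hom_def rename_simps)
  show "\<exists>X \<in> Obj T. homotopy_equivalent (rename i j k T) Y (on_ob \<lparr>on_ob = i, on_arr = j, on_trk = k\<rparr> X)"
    if Y: "Y \<in> Obj (rename i j k T)" for Y
  proof -
    obtain X where X: "X \<in> Obj T" "Y = i X" using Y by (auto simp: rename_simps)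
    have "homotopy_equivalent (rename i j k T) Y Y"
      unfolding R.homotopy_equivalent_iff[OF Y Y]
      using R.Idt_in[OF Y] R.homotopic_refl Y by (intro bexI[of _ "Idt (rename i j k T) Y"] conjI) (auto simp: R.unit_simps R.typing)
    then show ?thesis using X by auto
  qed
qed

theorem track_theory_rename:
  assumes "track_theory T"
  shows "track_theory (rename i j k T)"
  unfolding track_theory_def
proof (intro conjI allI impI track_category_rename)
  fix Ys assume Ys: "set Ys \<subseteq> Obj (rename i j k T)"
  then have "\<forall>Y \<in> set Ys. \<exists>X. X \<in> Obj T \<and> i X = Y" by (auto simp: rename_simps)
  then obtain c where c: "\<And>Y. Y \<in> set Ys \<Longrightarrow> c Y \<in> Obj T \<and> i (c Y) = Y" by metis
  have "set (map c Ys) \<subseteq> Obj T" "map i (map c Ys) = Ys" using c by (auto intro: map_idI)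
  then obtain P ps where "lax_product T (map c Ys) P ps" using assms unfolding track_theory_def by blast
  from weak_equivalence_preserves_lax_products[OF weak_equivalence_rename this]
  show "\<exists>P ps. lax_product (rename i j k T) Ys P ps" using \<open>map i (map c Ys) = Ys\<close> by auto
qed

end

section \<open>Lax equivalences\<close>

text \<open>Functoriality of \<open>F\<^sub>\<simeq>\<close> is the existence of the unit and comparison tracks. A functor that is full on
  tracks reflects homotopies, so \<open>F\<^sub>\<simeq>\<close> is faithful.\<close>

theorem lax_equivalenceI:
  assumes F: "lax_functor S T F" and bij: "bijective_on_tracks S T F" and full: "full_up_to_homotopy S T F"
    and eso: "\<And>Y. Y \<in> Obj T \<Longrightarrow> \<exists>X \<in> Obj S. on_ob F X = Y"
  shows "lax_equivalence S T F"
proof -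
  interpret lax_functor S T F by (fact F)
  interpret HS: category "homotopy_category S" by (rule S.category_homotopy_category)
  interpret HT: category "homotopy_category T" by (rule T.category_homotopy_category)
  have arr: "on_arr F f \<in> Hom T (on_ob F X) (on_ob F Y)" if "f \<in> Hom S X Y" for f X Y
    using cat_functor.fob_in[OF hom_functor, of X Y f] that S.Hom_objects[OF that] by (simp add: hom_func_def)
  have trk: "on_trk F \<alpha> \<in> tracks T (on_arr F f) (on_arr F g)" if "\<alpha> \<in> tracks S f g" for \<alpha> f g
  proof -
    have f: "f \<in> Hom S (Src S f) (Tgt S f)" using tracksD[OF that] S.TSrc_in S.Mor_Hom by blast
    show ?thesis using cat_functor.fmor_in[OF hom_functor, of "Src S f" "Tgt S f" \<alpha> f g] S.Hom_objects[OF f] that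
      unfolding Hom_hom_groupoid[OF f] by (simp add: hom_func_def Hom_hom_groupoid[OF arr[OF f]])
  qed
  have homot: "T.homotopic (on_arr F f) (on_arr F g)" if fg: "S.homotopic f g" for f g
  proof -
    obtain \<alpha> where "\<alpha> \<in> tracks S f g" using fg unfolding S.homotopic_def by blast
    from tracksD[OF trk[OF this]] show ?thesis using T.homotopicI by blast
  qed
  have cls: "fmor (homotopy_func T F) (S.hclass f) = T.hclass (on_arr F f)" if f: "f \<in> Mor S" for f
  proof -
    have "homotopy T `` (on_arr F ` S.hclass f) = T.hclass (on_arr F f)"
    proof (intro equalityI subsetI)
      fix g assume "g \<in> homotopy T `` (on_arr F ` S.hclass f)"
      then obtain f' where "S.homotopic f f'" "T.homotopic (on_arr F f') g"
        unfolding T.homotopy_eq S.hclass_def by blast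
      then show "g \<in> T.hclass (on_arr F f)" using homot T.homotopic_trans unfolding T.hclass_def by blast
    next
      fix g assume "g \<in> T.hclass (on_arr F f)"
      then show "g \<in> homotopy T `` (on_arr F ` S.hclass f)"
        using S.homotopic_refl[OF f] unfolding T.homotopy_eq S.hclass_def T.hclass_def by blast
    qed
    then show ?thesis by (simp add: homotopy_func_def)
  qed
  have fob: "fob (homotopy_func T F) = on_ob F" by (simp add: homotopy_func_def)
  interpret H: cat_functor "homotopy_category S" "homotopy_category T" "homotopy_func T F"
  proof
    show "fob (homotopy_func T F) X \<in> Obj (homotopy_category T)" if "X \<in> Obj (homotopy_category S)" for X
      using that on_ob_in by (simp add: fob)
    show "fmor (homotopy_func T F) c \<in> Hom (homotopy_category T) (fob (homotopy_func T F) X) (fob (homotopy_func T F) Y)"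
      if "c \<in> Hom (homotopy_category S) X Y" for c X Y
      using that arr HomD cls unfolding S.Hom_homotopy_category T.Hom_homotopy_category fob by fastforce
    show "fmor (homotopy_func T F) (Idt (homotopy_category S) X) = Idt (homotopy_category T) (fob (homotopy_func T F) X)"
      if "X \<in> Obj (homotopy_category S)" for X
    proof -
      have X: "X \<in> Obj S" using that by simp
      have "T.homotopic (Idt T (on_ob F X)) (on_arr F (Idt S X))"
        using unit_trk_in[OF X] by (auto simp: tracks_def intro: T.homotopicI)
      then have "T.hclass (Idt T (on_ob F X)) = T.hclass (on_arr F (Idt S X))"
        using T.hclass_eq_iff unfolding T.homotopic_def by blast
      then show ?thesis using cls[of "Idt S X"] X by (simp add: fob S.typing)
    qed
    show "fmor (homotopy_func T F) (Cmp (homotopy_category S) d c) =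
        Cmp (homotopy_category T) (fmor (homotopy_func T F) d) (fmor (homotopy_func T F) c)"
      if dc: "d \<in> Hom (homotopy_category S) Y Z" "c \<in> Hom (homotopy_category S) X Y" for d c X Y Z
    proof -
      obtain g f where g: "g \<in> Hom S Y Z" "d = S.hclass g" and f: "f \<in> Hom S X Y" "c = S.hclass f"
        using dc unfolding S.Hom_homotopy_category by blast
      have "T.homotopic (Cmp T (on_arr F g) (on_arr F f)) (on_arr F (Cmp S g f))"
        using comp_trk_in[OF g(1) f(1)] by (auto simp: tracks_def intro: T.homotopicI)
      then have "T.hclass (Cmp T (on_arr F g) (on_arr F f)) = T.hclass (on_arr F (Cmp S g f))"
        using T.hclass_eq_iff unfolding T.homotopic_def by blast
      then show ?thesis
        using HomD[OF g(1)] HomD[OF f(1)] HomD[OF arr[OF g(1)]] HomD[OF arr[OF f(1)]] g(2) f(2)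
        by (simp add: cls S.typing)
    qed
  qed
  have "fully_faithful (homotopy_category S) (homotopy_category T) (homotopy_func T F)"
    unfolding fully_faithful_def bij_betw_Ex1 S.Hom_homotopy_category T.Hom_homotopy_category fob
  proof (intro ballI conjI)
    fix X Y assume XY: "X \<in> Obj (homotopy_category S)" "Y \<in> Obj (homotopy_category S)"
    show "fmor (homotopy_func T F) c \<in> T.hclass ` Hom T (on_ob F X) (on_ob F Y)" if "c \<in> S.hclass ` Hom S X Y" for c
      using that H.fmor_in[of c X Y] unfolding S.Hom_homotopy_category T.Hom_homotopy_category fob by blast
    fix d assume "d \<in> T.hclass ` Hom T (on_ob F X) (on_ob F Y)"
    then obtain g where g: "g \<in> Hom T (on_ob F X) (on_ob F Y)" "d = T.hclass g" by blast
    obtain f where f: "f \<in> Hom S X Y" "T.homotopic (on_arr F f) g"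
      using full[unfolded full_up_to_homotopy_def, rule_format, of X Y g] XY g(1) by auto
    show "\<exists>!c. c \<in> S.hclass ` Hom S X Y \<and> fmor (homotopy_func T F) c = d"
    proof (rule ex1I[of _ "S.hclass f"])
      show "S.hclass f \<in> S.hclass ` Hom S X Y \<and> fmor (homotopy_func T F) (S.hclass f) = d"
        using f HomD[OF f(1)] HomD[OF arr[OF f(1)]] HomD[OF g(1)] T.hclass_eq_iff cls g(2) by auto
      fix c assume "c \<in> S.hclass ` Hom S X Y \<and> fmor (homotopy_func T F) c = d"
      then obtain e where e: "e \<in> Hom S X Y" "c = S.hclass e" "fmor (homotopy_func T F) (S.hclass e) = d" by blast
      then have "T.hclass (on_arr F e) = T.hclass g" using HomD[OF e(1)] cls g(2) by simp
      also have "\<dots> = T.hclass (on_arr F f)"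
        using f(2) T.hclass_eq_iff HomD[OF arr[OF f(1)]] HomD[OF g(1)] by blast
      finally have "T.homotopic (on_arr F e) (on_arr F f)"
        using T.hclass_eq_iff HomD[OF arr[OF f(1)]] HomD[OF arr[OF e(1)]] by blast
      then have "S.homotopic e f"
        using bijective_on_tracksD[OF bij e(1) f(1)] HomD[OF e(1)] HomD[OF f(1)]
        unfolding S.homotopic_def T.homotopic_def bij_betw_def by auto
      then show "c = S.hclass f" using e(2) S.hclass_eq_iff HomD[OF e(1)] HomD[OF f(1)] by blast
    qed
  qed
  moreover have "\<exists>X \<in> Obj (homotopy_category S). isomorphic (homotopy_category T) (fob (homotopy_func T F) X) Y"
    if Y: "Y \<in> Obj (homotopy_category T)" for Y
  proof -
    obtain X where "X \<in> Obj S" "on_ob F X = Y" using eso Y by auto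
    moreover have "isomorphic (homotopy_category T) Y Y"
      unfolding isomorphic_def
      using HT.Idt_in[OF Y] isomorphismI[OF HT.Idt_in[OF Y] HT.Idt_in[OF Y]] HT.Idt_left[OF HT.Idt_in[OF Y]] by blast
    ultimately show ?thesis by (auto simp: fob)
  qed
  ultimately have "equivalence_of_categories (homotopy_category S) (homotopy_category T) (homotopy_func T F)"
    by (rule H.equivalence_of_categoriesI)
  moreover have "on_trk F \<in> iso (Aut S f) (Aut T (on_arr F f))" if f: "f \<in> Mor S" for f
  proof -
    have "on_trk F (VCmp S \<beta> \<alpha>) = VCmp T (on_trk F \<beta>) (on_trk F \<alpha>)"
      if "\<beta> \<in> tracks S f f" "\<alpha> \<in> tracks S f f" for \<beta> \<alpha>
      using cat_functor.fmor_Cmp[OF hom_functor[OF S.Src_in[OF f] S.Tgt_in[OF f]], of \<beta> f f \<alpha> f] that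
      unfolding Hom_hom_groupoid[OF S.Mor_Hom[OF f]] by (simp add: hom_func_def)
    then show ?thesis
      using bijective_on_tracksD[OF bij S.Mor_Hom[OF f] S.Mor_Hom[OF f]] trk
      unfolding iso_def hom_def Aut_def by auto
  qed
  ultimately show ?thesis unfolding lax_equivalence_def using F by blast
qed

section \<open>Tracks pulled back along a pseudofunctor\<close>

text \<open>A track of the pulled back structure is encoded as an expression that lists its source, its target
  and a track of \<open>T\<close>.\<close>

definition part :: "nat \<Rightarrow> ('o, 'a, 't) cell \<Rightarrow> ('o, 'a, 't) cell" where
  "part k c = (case c of Form cs \<Rightarrow> cs ! k | _ \<Rightarrow> c)"

definition val :: "('o, 'a, 't) cell \<Rightarrow> 't" where
  "val c = (case part 2 c of TrkCell \<alpha> \<Rightarrow> \<alpha> | _ \<Rightarrow> undefined)"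

definition track_cell :: "('o, 'a, 't) cell \<Rightarrow> ('o, 'a, 't) cell \<Rightarrow> 't \<Rightarrow> ('o, 'a, 't) cell" where
  "track_cell f g \<alpha> = Form [f, g, TrkCell \<alpha>]"

lemma track_cell_simps [simp]:
  "part 0 (track_cell f g \<alpha>) = f" "part (Suc 0) (track_cell f g \<alpha>) = g" "val (track_cell f g \<alpha>) = \<alpha>"
  "track_cell f g \<alpha> = track_cell f' g' \<alpha>' \<longleftrightarrow> f = f' \<and> g = g' \<and> \<alpha> = \<alpha>'"
  unfolding part_def val_def track_cell_def by simp_all

text \<open>The conditions are those of a lax functor on a category that has identity tracks only. Naturality of
  the comparison tracks is then a triviality; it becomes a property of the tracks that are pulled
  back.\<close>

locale pseudofunctor = C: category C + T: track_category T
  for C :: "(('o, 'a, 't) cell, ('o, 'a, 't) cell) category" and T :: "('o, 'a, 't) track_category" +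
  fixes ob :: "('o, 'a, 't) cell \<Rightarrow> 'o" and arr :: "('o, 'a, 't) cell \<Rightarrow> 'a"
    and unit :: "('o, 'a, 't) cell \<Rightarrow> 't" and comp :: "('o, 'a, 't) cell \<Rightarrow> ('o, 'a, 't) cell \<Rightarrow> 't"
  assumes ob_in: "X \<in> Obj C \<Longrightarrow> ob X \<in> Obj T"
    and arr_in: "f \<in> Hom C X Y \<Longrightarrow> arr f \<in> Hom T (ob X) (ob Y)"
    and unit_in: "X \<in> Obj C \<Longrightarrow> unit X \<in> tracks T (Idt T (ob X)) (arr (Idt C X))"
    and comp_in: "f \<in> Hom C Y Z \<Longrightarrow> g \<in> Hom C X Y \<Longrightarrow>
      comp f g \<in> tracks T (Cmp T (arr f) (arr g)) (arr (Cmp C f g))"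
    and left_unit: "f \<in> Hom C X Y \<Longrightarrow>
      VCmp T (comp (Idt C Y) f) (HCmp T (unit Y) (TId T (arr f))) = TId T (arr f)"
    and right_unit: "f \<in> Hom C X Y \<Longrightarrow>
      VCmp T (comp f (Idt C X)) (HCmp T (TId T (arr f)) (unit X)) = TId T (arr f)"
    and assoc: "f \<in> Hom C Y Z \<Longrightarrow> g \<in> Hom C X Y \<Longrightarrow> h \<in> Hom C W X \<Longrightarrow>
      VCmp T (comp f (Cmp C g h)) (HCmp T (TId T (arr f)) (comp g h)) =
      VCmp T (comp (Cmp C f g) h) (HCmp T (comp f g) (TId T (arr h)))"
begin

lemma arr_simps:
  "f \<in> Mor C \<Longrightarrow> arr f \<in> Mor T" "f \<in> Mor C \<Longrightarrow> Src T (arr f) = ob (Src C f)"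
  "f \<in> Mor C \<Longrightarrow> Tgt T (arr f) = ob (Tgt C f)"
  using arr_in[OF C.Mor_Hom] by (simp_all add: Hom_def)

lemma unit_simps:
  "X \<in> Obj C \<Longrightarrow> unit X \<in> Trk T" "X \<in> Obj C \<Longrightarrow> TSrc T (unit X) = Idt T (ob X)"
  "X \<in> Obj C \<Longrightarrow> TTgt T (unit X) = arr (Idt C X)"
  using unit_in by (simp_all add: tracks_def)

lemma comp_simps:
  assumes "f \<in> Mor C" "g \<in> Mor C" "Src C f = Tgt C g"
  shows "comp f g \<in> Trk T" "TSrc T (comp f g) = arr f \<cdot> arr g" "TTgt T (comp f g) = arr (Cmp C f g)"
  using comp_in[of f "Tgt C g" "Tgt C f" g "Src C g"] assms by (simp_all add: tracks_def Hom_def)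

lemmas pf_simps = ob_in arr_simps unit_simps comp_simps

lemma left_unit': "f \<in> Mor C \<Longrightarrow> Tgt C f = Y \<Longrightarrow>
    (comp (Idt C Y) f) \<bullet> (unit Y \<lhd> arr f) = TId T (arr f)"
  and right_unit': "f \<in> Mor C \<Longrightarrow> Src C f = X \<Longrightarrow>
    (comp f (Idt C X)) \<bullet> (arr f \<rhd> unit X) = TId T (arr f)"
  using left_unit[OF C.Mor_Hom] right_unit[OF C.Mor_Hom] by auto

lemma assoc': "f \<in> Mor C \<Longrightarrow> g \<in> Mor C \<Longrightarrow> h \<in> Mor C \<Longrightarrow> Src C f = Tgt C g \<Longrightarrow> Src C g = Tgt C h \<Longrightarrow>
      (comp f (Cmp C g h)) \<bullet> (arr f \<rhd> comp g h) =
      comp (Cmp C f g) h \<bullet> (comp f g \<lhd> arr h)"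
  using assoc[of f "Tgt C g" "Tgt C f" g "Tgt C h" h "Src C h"] by (simp add: Hom_def)

text \<open>The horizontal composite in \<open>T\<close> has the wrong source and target, so it is conjugated with comparison
  tracks.\<close>

definition hcomp :: "('o, 'a, 't) cell \<Rightarrow> ('o, 'a, 't) cell \<Rightarrow> 't" where
  "hcomp \<beta> \<alpha> = comp (part 1 \<beta>) (part 1 \<alpha>) \<bullet> (val \<beta> \<star> val \<alpha>) \<bullet> T.TInv (comp (part 0 \<beta>) (part 0 \<alpha>))"

definition tracks_along :: "('o, 'a, 't) cell_track_category" where
  "tracks_along =
    \<lparr>Obj = Obj C, Mor = Mor C, Src = Src C, Tgt = Tgt C, Idt = Idt C, Cmp = Cmp C,
     Trk = {track_cell f g \<alpha> | f g \<alpha>. f \<in> Mor C \<and> g \<in> Mor C \<and> Src C f = Src C g \<and> Tgt C f = Tgt C g \<and>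
       \<alpha> \<in> tracks T (arr f) (arr g)},
     TSrc = part 0,
     TTgt = part 1,
     TId = (\<lambda>f. track_cell f f (TId T (arr f))),
     VCmp = (\<lambda>\<beta> \<alpha>. track_cell (part 0 \<alpha>) (part 1 \<beta>) (val \<beta> \<bullet> val \<alpha>)),
     HCmp = (\<lambda>\<beta> \<alpha>. track_cell (Cmp C (part 0 \<beta>) (part 0 \<alpha>)) (Cmp C (part 1 \<beta>) (part 1 \<alpha>)) (hcomp \<beta> \<alpha>))\<rparr>"

lemma tracks_along_sel [simp]:
  "Obj tracks_along = Obj C" "Mor tracks_along = Mor C" "Src tracks_along = Src C" "Tgt tracks_along = Tgt C"
  "Idt tracks_along = Idt C" "Cmp tracks_along = Cmp C"
  "TSrc tracks_along = part 0" "TTgt tracks_along = part 1"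
  "TId tracks_along f = track_cell f f (TId T (arr f))"
  "VCmp tracks_along \<beta> \<alpha> = track_cell (part 0 \<alpha>) (part 1 \<beta>) (val \<beta> \<bullet> val \<alpha>)"
  "HCmp tracks_along \<beta> \<alpha> = track_cell (Cmp C (part 0 \<beta>) (part 0 \<alpha>)) (Cmp C (part 1 \<beta>) (part 1 \<alpha>)) (hcomp \<beta> \<alpha>)"
  "Hom tracks_along X Y = Hom C X Y"
  unfolding tracks_along_def Hom_def by simp_all

lemma tracks_along_iff: "\<alpha> \<in> tracks tracks_along f g \<longleftrightarrow>
    (\<exists>a. \<alpha> = track_cell f g a \<and> f \<in> Mor C \<and> g \<in> Mor C \<and> Src C f = Src C g \<and> Tgt C f = Tgt C g \<and>
      a \<in> Trk T \<and> TSrc T a = arr f \<and> TTgt T a = arr g)"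
  unfolding tracks_def[of tracks_along] tracks_along_def by (auto simp: tracks_def)

text \<open>The horizontal composite is characterised by an equation free of inverses, which is how its
  laws are proved: both sides of each law are composed with the comparison track of the source.\<close>

lemma hcomp_eqI:
  assumes "g \<in> Mor C" "g' \<in> Mor C" "f \<in> Mor C" "f' \<in> Mor C" "Src C g = Tgt C f" "Src C g' = Tgt C f'"
    and "\<beta> \<in> Trk T" "TSrc T \<beta> = arr g" "TTgt T \<beta> = arr g'" "\<alpha> \<in> Trk T" "TSrc T \<alpha> = arr f" "TTgt T \<alpha> = arr f'"
    and "\<gamma> \<in> Trk T" "TSrc T \<gamma> = arr (Cmp C g f)"
    and eq: "\<gamma> \<bullet> comp g f = comp g' f' \<bullet> (\<beta> \<star> \<alpha>)"
  shows "hcomp (track_cell g g' \<beta>) (track_cell f f' \<alpha>) = \<gamma>"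
proof -
  have "comp g' f' \<bullet> (\<beta> \<star> \<alpha>) \<bullet> T.TInv (comp g f)
      = (comp g' f' \<bullet> (\<beta> \<star> \<alpha>)) \<bullet> T.TInv (comp g f)"
    using assms(1-14) by (simp add: T.VCmp_VCmp T.typing pf_simps)
  also have "\<dots> = \<gamma>"
    unfolding eq[symmetric] using assms(1-14) by (simp add: T.VCmp_VCmp T.typing T.unit_simps pf_simps)
  finally show ?thesis unfolding hcomp_def by simp
qed

lemma hcomp:
  assumes "g \<in> Mor C" "g' \<in> Mor C" "f \<in> Mor C" "f' \<in> Mor C" "Src C g = Tgt C f" "Src C g' = Tgt C f'"
    and "\<beta> \<in> Trk T" "TSrc T \<beta> = arr g" "TTgt T \<beta> = arr g'" "\<alpha> \<in> Trk T" "TSrc T \<alpha> = arr f" "TTgt T \<alpha> = arr f'"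
  shows "hcomp (track_cell g g' \<beta>) (track_cell f f' \<alpha>) \<in> Trk T"
    "TSrc T (hcomp (track_cell g g' \<beta>) (track_cell f f' \<alpha>)) = arr (Cmp C g f)"
    "TTgt T (hcomp (track_cell g g' \<beta>) (track_cell f f' \<alpha>)) = arr (Cmp C g' f')"
    "hcomp (track_cell g g' \<beta>) (track_cell f f' \<alpha>) \<bullet> comp g f = comp g' f' \<bullet> (\<beta> \<star> \<alpha>)"
  unfolding hcomp_def using assms
  by (simp_all add: T.VCmp_VCmp T.typing T.unit_simps pf_simps)

theorem track_category_tracks_along: "track_category tracks_along"
proof (rule track_categoryI)
  show "category tracks_along"
    by unfold_locales (simp_all add: C.Src_in C.Tgt_in C.Idt_in C.Cmp_in C.Idt_left C.Idt_right C.Cmp_assoc)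
next
  fix \<alpha> assume "\<alpha> \<in> Trk tracks_along"
  then have "\<alpha> \<in> tracks tracks_along (part 0 \<alpha>) (part 1 \<alpha>)" by (simp add: tracks_def[of tracks_along])
  then show "TSrc tracks_along \<alpha> \<in> Mor tracks_along \<and>
      TTgt tracks_along \<alpha> \<in> Hom tracks_along (Src tracks_along (TSrc tracks_along \<alpha>)) (Tgt tracks_along (TSrc tracks_along \<alpha>))"
    unfolding tracks_along_iff by (auto simp: Hom_def)
next
  fix \<alpha> f g assume "\<alpha> \<in> tracks tracks_along f g"
  then obtain a where a: "\<alpha> = track_cell f g a" "f \<in> Mor C" "g \<in> Mor C" "Src C f = Src C g" "Tgt C f = Tgt C g"
      "a \<in> Trk T" "TSrc T a = arr f" "TTgt T a = arr g"
    unfolding tracks_along_iff by blast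
  show "\<exists>\<beta> \<in> tracks tracks_along g f. VCmp tracks_along \<beta> \<alpha> = TId tracks_along f \<and>
      VCmp tracks_along \<alpha> \<beta> = TId tracks_along g"
    using a by (intro bexI[of _ "track_cell g f (T.TInv a)"]) (auto simp: tracks_along_iff T.typing T.unit_simps)
  have o: "Src C f \<in> Obj C" "Tgt C f \<in> Obj C" using a C.Src_in C.Tgt_in by blast+
  \<comment> \<open>By the unit axioms the whiskered unit track is inverse to the comparison track, so it suffices to
    commute \<open>a\<close> past the unit track.\<close>
  have "hcomp (track_cell (Idt C (Tgt C f)) (Idt C (Tgt C f)) (TId T (arr (Idt C (Tgt C f))))) (track_cell f g a) = a"
  proof (rule hcomp_eqI)
    let ?Y = "Tgt C f" let ?i = "arr (Idt C ?Y)"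
    have "(comp (Idt C ?Y) g \<bullet> (?i \<rhd> a)) \<bullet> (unit ?Y \<lhd> arr f)
        = comp (Idt C ?Y) g \<bullet> (?i \<rhd> a) \<bullet> (unit ?Y \<lhd> arr f)"
      using a o by (simp add: T.VCmp_VCmp T.typing pf_simps C.cat_simps)
    also have "(?i \<rhd> a) \<bullet> (unit ?Y \<lhd> arr f)
        = (unit ?Y \<lhd> arr g) \<bullet> (Idt T (ob ?Y) \<rhd> a)"
      using a o T.HCmp_rl[of "unit ?Y" a] T.HCmp_lr[of "unit ?Y" a] by (simp add: T.typing pf_simps)
    also have "comp (Idt C ?Y) g \<bullet> \<dots> = (comp (Idt C ?Y) g \<bullet> (unit ?Y \<lhd> arr g)) \<bullet> a"
      using a o by (simp add: T.VCmp_VCmp T.typing T.unit_simps pf_simps C.cat_simps)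
    also have "\<dots> = a \<bullet> comp (Idt C ?Y) f \<bullet> (unit ?Y \<lhd> arr f)"
      using a o left_unit'[of f ?Y] left_unit'[of g ?Y] by (simp add: T.unit_simps)
    also have "\<dots> = (a \<bullet> comp (Idt C ?Y) f) \<bullet> (unit ?Y \<lhd> arr f)"
      using a o by (simp add: T.VCmp_VCmp T.typing pf_simps C.cat_simps)
    finally show "a \<bullet> comp (Idt C ?Y) f = comp (Idt C ?Y) g \<bullet> (?i \<rhd> a)"
      by (rule T.VCmp_cancel_right[rotated -1, OF sym])
        (use a o in \<open>simp_all add: T.typing pf_simps C.cat_simps\<close>)
  qed (use a o in \<open>simp_all add: C.cat_simps T.typing pf_simps\<close>)
  moreover have "hcomp (track_cell f g a) (track_cell (Idt C (Src C f)) (Idt C (Src C f)) (TId T (arr (Idt C (Src C f))))) = a"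
  proof (rule hcomp_eqI)
    let ?X = "Src C f" let ?i = "arr (Idt C ?X)"
    have "(comp g (Idt C ?X) \<bullet> (a \<lhd> ?i)) \<bullet> (arr f \<rhd> unit ?X)
        = comp g (Idt C ?X) \<bullet> (a \<lhd> ?i) \<bullet> (arr f \<rhd> unit ?X)"
      using a o by (simp add: T.VCmp_VCmp T.typing pf_simps C.cat_simps)
    also have "(a \<lhd> ?i) \<bullet> (arr f \<rhd> unit ?X)
        = (arr g \<rhd> unit ?X) \<bullet> (a \<lhd> Idt T (ob ?X))"
      using a o T.HCmp_rl[of a "unit ?X"] T.HCmp_lr[of a "unit ?X"] by (simp add: T.typing pf_simps)
    also have "comp g (Idt C ?X) \<bullet> \<dots> = (comp g (Idt C ?X) \<bullet> (arr g \<rhd> unit ?X)) \<bullet> a"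
      using a o by (simp add: T.VCmp_VCmp T.typing T.unit_simps pf_simps C.cat_simps)
    also have "\<dots> = a \<bullet> comp f (Idt C ?X) \<bullet> (arr f \<rhd> unit ?X)"
      using a o right_unit'[of f ?X] right_unit'[of g ?X] by (simp add: T.unit_simps)
    also have "\<dots> = (a \<bullet> comp f (Idt C ?X)) \<bullet> (arr f \<rhd> unit ?X)"
      using a o by (simp add: T.VCmp_VCmp T.typing pf_simps C.cat_simps)
    finally show "a \<bullet> comp f (Idt C ?X) = comp g (Idt C ?X) \<bullet> (a \<lhd> ?i)"
      by (rule T.VCmp_cancel_right[rotated -1, OF sym])
        (use a o in \<open>simp_all add: T.typing pf_simps C.cat_simps\<close>)
  qed (use a o in \<open>simp_all add: C.cat_simps T.typing pf_simps\<close>)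
  ultimately show "HCmp tracks_along (TId tracks_along (Idt tracks_along (Tgt tracks_along f))) \<alpha> = \<alpha> \<and>
      HCmp tracks_along \<alpha> (TId tracks_along (Idt tracks_along (Src tracks_along f))) = \<alpha>"
    using a by (simp add: C.cat_simps)
next
  fix \<beta> \<beta>' \<alpha> \<alpha>' f f' f'' g g' g''
  assume "\<beta> \<in> tracks tracks_along g g'" "\<beta>' \<in> tracks tracks_along g' g''"
    "\<alpha> \<in> tracks tracks_along f f'" "\<alpha>' \<in> tracks tracks_along f' f''"
    and gf: "Src tracks_along g = Tgt tracks_along f"
  then obtain b b' a a' where
      b: "\<beta> = track_cell g g' b" "g \<in> Mor C" "g' \<in> Mor C" "Src C g = Src C g'" "Tgt C g = Tgt C g'"
        "b \<in> Trk T" "TSrc T b = arr g" "TTgt T b = arr g'"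
    and b': "\<beta>' = track_cell g' g'' b'" "g'' \<in> Mor C" "Src C g' = Src C g''" "Tgt C g' = Tgt C g''"
        "b' \<in> Trk T" "TSrc T b' = arr g'" "TTgt T b' = arr g''"
    and a: "\<alpha> = track_cell f f' a" "f \<in> Mor C" "f' \<in> Mor C" "Src C f = Src C f'" "Tgt C f = Tgt C f'"
        "a \<in> Trk T" "TSrc T a = arr f" "TTgt T a = arr f'"
    and a': "\<alpha>' = track_cell f' f'' a'" "f'' \<in> Mor C" "Src C f' = Src C f''" "Tgt C f' = Tgt C f''"
        "a' \<in> Trk T" "TSrc T a' = arr f'" "TTgt T a' = arr f''"
    unfolding tracks_along_iff by blast
  have gf': "Src C g'' = Tgt C f''" using gf b b' a a' by simp
  note typed = b(2-) b'(2-) a(2-) a'(2-) gf'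
  have "hcomp (track_cell g g'' (b' \<bullet> b)) (track_cell f f'' (a' \<bullet> a))
      = hcomp \<beta>' \<alpha>' \<bullet> hcomp \<beta> \<alpha>"
  proof (rule hcomp_eqI)
    let ?H' = "hcomp \<beta>' \<alpha>'" and ?H = "hcomp \<beta> \<alpha>"
    have H: "?H \<in> Trk T" "TSrc T ?H = arr (Cmp C g f)" "TTgt T ?H = arr (Cmp C g' f')"
        "?H \<bullet> comp g f = comp g' f' \<bullet> (b \<star> a)"
      unfolding a(1) b(1) by (rule hcomp; use typed in simp)+
    have H': "?H' \<in> Trk T" "TSrc T ?H' = arr (Cmp C g' f')" "TTgt T ?H' = arr (Cmp C g'' f'')"
        "?H' \<bullet> comp g' f' = comp g'' f'' \<bullet> (b' \<star> a')"
      unfolding a'(1) b'(1) by (rule hcomp; use typed in simp)+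
    show "?H' \<bullet> ?H \<in> Trk T" "TSrc T (?H' \<bullet> ?H) = arr (Cmp C g f)"
      using H H' by (simp_all add: T.typing)
    have "(?H' \<bullet> ?H) \<bullet> comp g f = ?H' \<bullet> ?H \<bullet> comp g f"
      using H(1-3) H'(1-3) typed by (simp add: T.VCmp_VCmp T.typing pf_simps)
    also have "\<dots> = (?H' \<bullet> comp g' f') \<bullet> (b \<star> a)"
      unfolding H(4) using H(1-3) H'(1-3) typed by (simp add: T.VCmp_VCmp T.typing pf_simps)
    also have "\<dots> = comp g'' f'' \<bullet> ((b' \<bullet> b) \<star> (a' \<bullet> a))"
      unfolding H'(4) using typed by (simp add: T.VCmp_VCmp T.typing pf_simps T.interchange)
    finally show "(?H' \<bullet> ?H) \<bullet> comp g f = comp g'' f'' \<bullet> ((b' \<bullet> b) \<star> (a' \<bullet> a))" .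
  qed (use typed in \<open>simp_all add: T.typing\<close>)
  then show "HCmp tracks_along (VCmp tracks_along \<beta>' \<beta>) (VCmp tracks_along \<alpha>' \<alpha>)
      = VCmp tracks_along (HCmp tracks_along \<beta>' \<alpha>') (HCmp tracks_along \<beta> \<alpha>)"
    using a(1) b(1) a'(1) b'(1) by simp
next
  fix \<gamma> \<beta> \<alpha> f f' g g' h h'
  assume "\<gamma> \<in> tracks tracks_along h h'" "\<beta> \<in> tracks tracks_along g g'" "\<alpha> \<in> tracks tracks_along f f'"
    and hg: "Src tracks_along h = Tgt tracks_along g" and gf: "Src tracks_along g = Tgt tracks_along f"
  then obtain c b a where
      c: "\<gamma> = track_cell h h' c" "h \<in> Mor C" "h' \<in> Mor C" "Src C h = Src C h'" "Tgt C h = Tgt C h'"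
        "c \<in> Trk T" "TSrc T c = arr h" "TTgt T c = arr h'"
    and b: "\<beta> = track_cell g g' b" "g \<in> Mor C" "g' \<in> Mor C" "Src C g = Src C g'" "Tgt C g = Tgt C g'"
        "b \<in> Trk T" "TSrc T b = arr g" "TTgt T b = arr g'"
    and a: "\<alpha> = track_cell f f' a" "f \<in> Mor C" "f' \<in> Mor C" "Src C f = Src C f'" "Tgt C f = Tgt C f'"
        "a \<in> Trk T" "TSrc T a = arr f" "TTgt T a = arr f'"
    unfolding tracks_along_iff by blast
  have e: "Src C h' = Tgt C g'" "Src C g' = Tgt C f'" using hg gf c b a by simp_all
  note typed = c(2-) b(2-) a(2-) e
  let ?ba = "hcomp \<beta> \<alpha>" and ?cb = "hcomp \<gamma> \<beta>"
  have ba: "?ba \<in> Trk T" "TSrc T ?ba = arr (Cmp C g f)" "TTgt T ?ba = arr (Cmp C g' f')"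
      "?ba \<bullet> comp g f = comp g' f' \<bullet> (b \<star> a)"
    unfolding a(1) b(1) by (rule hcomp; use typed in simp)+
  have cb: "?cb \<in> Trk T" "TSrc T ?cb = arr (Cmp C h g)" "TTgt T ?cb = arr (Cmp C h' g')"
      "?cb \<bullet> comp h g = comp h' g' \<bullet> (c \<star> b)"
    unfolding c(1) b(1) by (rule hcomp; use typed in simp)+
  let ?r = "hcomp (track_cell (Cmp C h g) (Cmp C h' g') ?cb) (track_cell f f' a)"
  have r: "?r \<in> Trk T" "TSrc T ?r = arr (Cmp C (Cmp C h g) f)" "TTgt T ?r = arr (Cmp C (Cmp C h' g') f')"
      "?r \<bullet> comp (Cmp C h g) f = comp (Cmp C h' g') f' \<bullet> (?cb \<star> a)"
    by (rule hcomp; use cb(1-3) typed in \<open>simp add: C.cat_simps\<close>)+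
  \<comment> \<open>Composed with the comparison tracks of the source, both bracketings become the triple composite in \<open>T\<close>
    followed by the comparison tracks of the target; \<open>assoc\<close> identifies the two ways of comparing.\<close>
  have "hcomp (track_cell h h' c) (track_cell (Cmp C g f) (Cmp C g' f') ?ba) = ?r"
  proof (rule hcomp_eqI)
    have "(?r \<bullet> comp h (Cmp C g f)) \<bullet> (arr h \<rhd> comp g f)
        = ?r \<bullet> comp h (Cmp C g f) \<bullet> (arr h \<rhd> comp g f)"
      using r(1-3) typed by (simp add: T.VCmp_VCmp T.Cmp_Cmp T.typing pf_simps C.cat_simps)
    also have "\<dots> = (?r \<bullet> comp (Cmp C h g) f) \<bullet> (comp h g \<lhd> arr f)"
      using assoc'[of h g f] r(1-3) typed by (simp add: T.VCmp_VCmp T.Cmp_Cmp T.typing pf_simps C.cat_simps)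
    also have "\<dots> = comp (Cmp C h' g') f' \<bullet> (?cb \<star> a) \<bullet> (comp h g \<lhd> arr f)"
      unfolding r(4) using cb(1-3) typed by (simp add: T.VCmp_VCmp T.Cmp_Cmp T.typing pf_simps C.cat_simps)
    also have "(?cb \<star> a) \<bullet> (comp h g \<lhd> arr f)
        = (?cb \<bullet> comp h g) \<star> (a \<bullet> TId T (arr f))"
      using cb(1-3) typed by (simp add: T.interchange T.typing pf_simps)
    also have "\<dots> = (comp h' g' \<bullet> (c \<star> b)) \<star> (TId T (arr f') \<bullet> a)"
      unfolding cb(4) using typed by (simp add: T.unit_simps)
    also have "\<dots> = (comp h' g' \<lhd> arr f') \<bullet> ((c \<star> b) \<star> a)"
      using typed by (simp add: T.interchange T.typing pf_simps)
    also have "comp (Cmp C h' g') f' \<bullet> \<dots>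
        = (comp (Cmp C h' g') f' \<bullet> (comp h' g' \<lhd> arr f')) \<bullet> (c \<star> (b \<star> a))"
      using typed by (simp add: T.VCmp_VCmp T.Cmp_Cmp T.HCmp_HCmp T.typing pf_simps C.cat_simps)
    also have "\<dots> = comp h' (Cmp C g' f') \<bullet> (arr h' \<rhd> comp g' f') \<bullet> (c \<star> (b \<star> a))"
      unfolding assoc'[OF c(3) b(3) a(3) e, symmetric]
      using typed by (simp add: T.VCmp_VCmp T.Cmp_Cmp T.typing pf_simps C.cat_simps)
    also have "(arr h' \<rhd> comp g' f') \<bullet> (c \<star> (b \<star> a))
        = (TId T (arr h') \<bullet> c) \<star> (comp g' f' \<bullet> (b \<star> a))"
      using typed by (simp add: T.interchange T.typing pf_simps)
    also have "\<dots> = (c \<bullet> TId T (arr h)) \<star> (?ba \<bullet> comp g f)"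
      unfolding ba(4) using typed by (simp add: T.unit_simps)
    also have "\<dots> = (c \<star> ?ba) \<bullet> (arr h \<rhd> comp g f)"
      using ba(1-3) typed by (simp add: T.interchange T.typing pf_simps)
    also have "comp h' (Cmp C g' f') \<bullet> \<dots>
        = (comp h' (Cmp C g' f') \<bullet> (c \<star> ?ba)) \<bullet> (arr h \<rhd> comp g f)"
      using ba(1-3) typed by (simp add: T.VCmp_VCmp T.Cmp_Cmp T.typing pf_simps C.cat_simps)
    finally show "?r \<bullet> comp h (Cmp C g f) = comp h' (Cmp C g' f') \<bullet> (c \<star> ?ba)"
      by (rule T.VCmp_cancel_right[rotated -1])
        (use r(1-3) ba(1-3) typed in \<open>simp_all add: T.Cmp_Cmp T.typing pf_simps C.cat_simps\<close>)
  qed (use r(1-3) ba(1-3) typed in \<open>simp_all add: C.cat_simps\<close>)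
  then show "HCmp tracks_along \<gamma> (HCmp tracks_along \<beta> \<alpha>) = HCmp tracks_along (HCmp tracks_along \<gamma> \<beta>) \<alpha>"
    using a(1) b(1) c(1) typed by (simp add: C.cat_simps)
next
  fix g f assume "g \<in> Mor tracks_along" "f \<in> Mor tracks_along" "Src tracks_along g = Tgt tracks_along f"
  then have "hcomp (track_cell g g (TId T (arr g))) (track_cell f f (TId T (arr f))) = TId T (arr (Cmp C g f))"
    by (intro hcomp_eqI) (simp_all add: T.typing T.unit_simps pf_simps C.cat_simps)
  then show "HCmp tracks_along (TId tracks_along g) (TId tracks_along f) = TId tracks_along (Cmp tracks_along g f)"
    by simp
next
  fix \<beta> \<alpha> f f' g g'
  assume "\<beta> \<in> tracks tracks_along g g'" "\<alpha> \<in> tracks tracks_along f f'" "Src tracks_along g = Tgt tracks_along f"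
  then show "HCmp tracks_along \<beta> \<alpha> \<in> tracks tracks_along (Cmp tracks_along g f) (Cmp tracks_along g' f')"
    unfolding tracks_along_iff by (auto simp: hcomp C.cat_simps)
qed (auto simp: tracks_along_iff T.typing T.unit_simps T.VCmp_VCmp pf_simps)

sublocale P: track_category tracks_along by (rule track_category_tracks_along)

lemma bijective_on_tracks_val:
  assumes "on_arr F = arr" "on_trk F = val"
  shows "bijective_on_tracks tracks_along T F"
  unfolding bijective_on_tracks_def
proof (intro ballI impI)
  fix f g assume "f \<in> Mor tracks_along" "g \<in> Mor tracks_along" "Src tracks_along f = Src tracks_along g"
    "Tgt tracks_along f = Tgt tracks_along g"
  then have "tracks tracks_along f g = track_cell f g ` tracks T (arr f) (arr g)"
    unfolding set_eq_iff tracks_along_iff by (auto simp: tracks_def)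
  then show "bij_betw (on_trk F) (tracks tracks_along f g) (tracks T (on_arr F f) (on_arr F g))"
    unfolding assms bij_betw_def by (auto simp: inj_on_def image_image)
qed

lemma homotopic_tracks_along:
  assumes "f \<in> Hom C X Y" "g \<in> Hom C X Y" "T.homotopic (arr f) (arr g)"
  shows "P.homotopic f g"
proof -
  obtain a where "a \<in> Trk T" "TSrc T a = arr f" "TTgt T a = arr g" using T.homotopicE[OF assms(3)] .
  then have "track_cell f g a \<in> tracks tracks_along f g"
    unfolding tracks_along_iff using HomD[OF assms(1)] HomD[OF assms(2)] by auto
  then show ?thesis unfolding P.homotopic_def using HomD[OF assms(1)] HomD[OF assms(2)] by auto
qed

abbreviation strict_map :: "(('o, 'a, 't) cell, ('o, 'a, 't) cell, ('o, 'a, 't) cell, 'o, 'a, 't) track_map" where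
  "strict_map \<equiv> \<lparr>on_ob = ob, on_arr = arr, on_trk = val\<rparr>"

lemma abelian_tracks_along: "abelian T \<Longrightarrow> abelian tracks_along"
  by (rule abelian_reflected[OF P.track_category_axioms T.track_category_axioms,
        of "strict_map"])
    (auto simp: bijective_on_tracks_val pf_simps)

definition projection :: "(('o, 'a, 't) cell, ('o, 'a, 't) cell, ('o, 'a, 't) cell, 'o, 'a, 't) lax_map" where
  "projection = \<lparr>on_ob = ob, on_arr = arr, on_trk = val, unit_trk = unit, comp_trk = comp\<rparr>"

lemma lax_functor_projection: "lax_functor tracks_along T projection"
proof (rule lax_functor.intro[OF P.track_category_axioms T.track_category_axioms], rule lax_functor_axioms.intro)
  show "cat_functor (hom_groupoid tracks_along X Y) (hom_groupoid T (on_ob projection X) (on_ob projection Y))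
      (hom_func projection)" if "X \<in> Obj tracks_along" "Y \<in> Obj tracks_along" for X Y
    by (rule hom_cat_functorI[OF P.track_category_axioms T.track_category_axioms that])
      (auto simp: projection_def ob_in arr_in tracks_along_iff tracks_def[of T])
  show "comp_trk projection f' g' \<bullet> (on_trk projection \<beta> \<star> on_trk projection \<alpha>) =
      on_trk projection (HCmp tracks_along \<beta> \<alpha>) \<bullet> comp_trk projection f g"
    if "f \<in> Hom tracks_along Y Z" "f' \<in> Hom tracks_along Y Z" "g \<in> Hom tracks_along X Y" "g' \<in> Hom tracks_along X Y"
      "\<beta> \<in> tracks tracks_along f f'" "\<alpha> \<in> tracks tracks_along g g'" for f f' g g' \<beta> \<alpha> X Y Z
    using that unfolding tracks_along_iff by (auto simp: projection_def hcomp(4) Hom_def)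
qed (auto simp: projection_def ob_in unit_in comp_in left_unit right_unit assoc)

theorem lax_equivalence_projection:
  assumes "\<And>X Y g. X \<in> Obj C \<Longrightarrow> Y \<in> Obj C \<Longrightarrow> g \<in> Hom T (ob X) (ob Y) \<Longrightarrow> \<exists>f \<in> Hom C X Y. T.homotopic (arr f) g"
    and "\<And>Y. Y \<in> Obj T \<Longrightarrow> \<exists>X \<in> Obj C. ob X = Y"
  shows "lax_equivalence tracks_along T projection"
  by (rule lax_equivalenceI[OF lax_functor_projection])
    (use assms in \<open>auto simp: bijective_on_tracks_val projection_def full_up_to_homotopy_def\<close>)

lemma track_functor_projection:
  assumes Idt: "\<And>X. X \<in> Obj C \<Longrightarrow> arr (Idt C X) = Idt T (ob X)"
    and Cmp: "\<And>g f. g \<in> Mor C \<Longrightarrow> f \<in> Mor C \<Longrightarrow> Src C g = Tgt C f \<Longrightarrow> arr (Cmp C g f) = arr g \<cdot> arr f"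
    and comp: "\<And>g f. g \<in> Mor C \<Longrightarrow> f \<in> Mor C \<Longrightarrow> Src C g = Tgt C f \<Longrightarrow> comp g f = TId T (arr g \<cdot> arr f)"
  shows "track_functor tracks_along T strict_map"
proof (rule track_functorI[OF P.track_category_axioms T.track_category_axioms])
  fix \<beta> \<alpha> f f' g g'
  assume "\<beta> \<in> tracks tracks_along g g'" "\<alpha> \<in> tracks tracks_along f f'"
    and gf: "Src tracks_along g = Tgt tracks_along f"
  then obtain b a where
      b: "\<beta> = track_cell g g' b" "g \<in> Mor C" "g' \<in> Mor C" "Src C g = Src C g'" "Tgt C g = Tgt C g'"
        "b \<in> Trk T" "TSrc T b = arr g" "TTgt T b = arr g'"
    and a: "\<alpha> = track_cell f f' a" "f \<in> Mor C" "f' \<in> Mor C" "Src C f = Src C f'" "Tgt C f = Tgt C f'"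
        "a \<in> Trk T" "TSrc T a = arr f" "TTgt T a = arr f'"
    unfolding tracks_along_iff by blast
  have gf': "Src C g' = Tgt C f'" using gf a b by simp
  have "hcomp \<beta> \<alpha> = b \<star> a"
    unfolding a(1) b(1) using a(2-) b(2-) gf'
    by (intro hcomp_eqI) (simp_all add: comp Cmp T.typing T.unit_simps pf_simps)
  then show "on_trk strict_map (HCmp tracks_along \<beta> \<alpha>) =
      (on_trk strict_map \<beta>) \<star> (on_trk strict_map \<alpha>)"
    using a(1) b(1) by simp
qed (auto simp: ob_in arr_in Idt Cmp tracks_along_iff tracks_def[of T])

end

section \<open>Terms and their evaluation\<close>

text \<open>Terms are expressions: the variable \<open>k\<close> is a list of \<open>k\<close> empty expressions, and the application of a
  1-arrow is headed by that 1-arrow, so that the two kinds cannot be confused. Variables are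
  numbers because the entries of a list of objects may repeat.\<close>

fun args :: "('o, 'a, 't) cell \<Rightarrow> ('o, 'a, 't) cell list" where
  "args (Form cs) = cs"
| "args _ = []"

definition var :: "nat \<Rightarrow> ('o, 'a, 't) cell" where
  "var k = Form (replicate k (Form []))"

definition app :: "'a \<Rightarrow> ('o, 'a, 't) cell list \<Rightarrow> ('o, 'a, 't) cell" where
  "app f ts = Form (ArrCell f # ts)"

lemma app_inject [simp]: "app f ts = app g us \<longleftrightarrow> f = g \<and> ts = us"
  unfolding app_def by simp

fun subst :: "('o, 'a, 't) cell list \<Rightarrow> ('o, 'a, 't) cell \<Rightarrow> ('o, 'a, 't) cell" where
  "subst \<sigma> (Form (ArrCell f # ts)) = Form (ArrCell f # map (subst \<sigma>) ts)"
| "subst \<sigma> c = \<sigma> ! length (args c)"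

lemma subst_simps [simp]: "subst \<sigma> (var k) = \<sigma> ! k" "subst \<sigma> (app f ts) = app f (map (subst \<sigma>) ts)"
  unfolding var_def app_def by (cases k) simp_all

definition vars :: "nat \<Rightarrow> ('o, 'a, 't) cell list" where
  "vars n = map var [0..<n]"

text \<open>A choice of lax products \<open>PP Xs\<close> with projections \<open>pp Xs\<close>, and, for every cone \<open>fs\<close> from \<open>W\<close>, of a tuple
  \<open>tup W fs\<close> with tracks \<open>eps W fs k\<close> that show its components to be the entries of \<open>fs\<close>. The factors are
  the targets of \<open>fs\<close>; the source \<open>W\<close> is a parameter of its own since \<open>fs\<close> may be empty. The normalisation
  for one factor makes evaluation strict on unary terms.\<close>

locale chosen_products = track_category T
  for T :: "('o, 'a, 't) track_category" +
  fixes PP :: "'o list \<Rightarrow> 'o" and pp :: "'o list \<Rightarrow> 'a list"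
    and tup :: "'o \<Rightarrow> 'a list \<Rightarrow> 'a" and eps :: "'o \<Rightarrow> 'a list \<Rightarrow> nat \<Rightarrow> 't"
  assumes prod: "set Xs \<subseteq> Obj T \<Longrightarrow> lax_product T Xs (PP Xs) (pp Xs)"
    and tup_in: "W \<in> Obj T \<Longrightarrow> \<forall>f \<in> set fs. f \<in> Mor T \<and> Src T f = W \<Longrightarrow> tup W fs \<in> Hom T W (PP (map (Tgt T) fs))"
    and eps_in: "W \<in> Obj T \<Longrightarrow> \<forall>f \<in> set fs. f \<in> Mor T \<and> Src T f = W \<Longrightarrow> k < length fs \<Longrightarrow>
      eps W fs k \<in> tracks T (Cmp T (pp (map (Tgt T) fs) ! k) (tup W fs)) (fs ! k)"
    and PP_single: "X \<in> Obj T \<Longrightarrow> PP [X] = X" and pp_single: "X \<in> Obj T \<Longrightarrow> pp [X] = [Idt T X]"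
    and tup_single: "f \<in> Mor T \<Longrightarrow> tup (Src T f) [f] = f"
    and eps_single: "f \<in> Mor T \<Longrightarrow> eps (Src T f) [f] 0 = TId T f"
begin

lemma PP_in: "set Xs \<subseteq> Obj T \<Longrightarrow> PP Xs \<in> Obj T"
  and length_pp: "set Xs \<subseteq> Obj T \<Longrightarrow> length (pp Xs) = length Xs"
  and pp_in: "set Xs \<subseteq> Obj T \<Longrightarrow> k < length Xs \<Longrightarrow> pp Xs ! k \<in> Hom T (PP Xs) (Xs ! k)"
  using prod[of Xs] unfolding lax_product_iff cone_iff by auto

definition lift :: "'o list \<Rightarrow> 'a \<Rightarrow> 'a \<Rightarrow> (nat \<Rightarrow> 't) \<Rightarrow> 't" where
  "lift Zs f g \<alpha>s = (THE \<alpha>. \<alpha> \<in> tracks T f g \<and> (\<forall>k < length Zs. pp Zs ! k \<rhd> \<alpha> = \<alpha>s k))"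

lemma lift_ex1:
  assumes Zs: "set Zs \<subseteq> Obj T" and f: "f \<in> Hom T W (PP Zs)" and g: "g \<in> Hom T W (PP Zs)"
    and \<alpha>s: "\<And>k. k < length Zs \<Longrightarrow> \<alpha>s k \<in> tracks T (pp Zs ! k \<cdot> f) (pp Zs ! k \<cdot> g)"
  shows "\<exists>!\<alpha>. \<alpha> \<in> tracks T f g \<and> (\<forall>k < length Zs. pp Zs ! k \<rhd> \<alpha> = \<alpha>s k)"
proof -
  have "lifts_uniquely T (pp Zs) f g"
    using prod[OF Zs] f g Hom_objects[OF f] unfolding lax_product_iff tracks_lift_def by blast
  then show ?thesis using \<alpha>s unfolding lifts_uniquely_def length_pp[OF Zs] by blast
qed

lemma lift:
  assumes "set Zs \<subseteq> Obj T" "f \<in> Hom T W (PP Zs)" "g \<in> Hom T W (PP Zs)"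
    "\<And>k. k < length Zs \<Longrightarrow> \<alpha>s k \<in> tracks T (pp Zs ! k \<cdot> f) (pp Zs ! k \<cdot> g)"
  shows "lift Zs f g \<alpha>s \<in> tracks T f g" "\<And>k. k < length Zs \<Longrightarrow> pp Zs ! k \<rhd> lift Zs f g \<alpha>s = \<alpha>s k"
  using theI'[OF lift_ex1[OF assms], folded lift_def] by auto

lemma pp_faithful:
  assumes Zs: "set Zs \<subseteq> Obj T" and f: "f \<in> Hom T W (PP Zs)"
    and \<alpha>: "\<alpha> \<in> tracks T f g" and \<beta>: "\<beta> \<in> tracks T f g"
    and eq: "\<And>k. k < length Zs \<Longrightarrow> pp Zs ! k \<rhd> \<alpha> = pp Zs ! k \<rhd> \<beta>"
  shows "\<alpha> = \<beta>"
proof -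
  have g: "g \<in> Hom T W (PP Zs)" using f tracksD[OF \<alpha>] by (auto simp: Hom_def typing)
  have "pp Zs ! k \<rhd> \<beta> \<in> tracks T (pp Zs ! k \<cdot> f) (pp Zs ! k \<cdot> g)" if "k < length Zs" for k
    using HomD[OF pp_in[OF Zs that]] tracksD[OF \<beta>] f by (auto simp: tracks_def typing Hom_def)
  from lift_ex1[OF Zs f g this] show ?thesis using \<alpha> \<beta> eq by blast
qed

text \<open>The value of a term whose variables range over \<open>Xs\<close>, as a 1-arrow out of \<open>PP Xs\<close>.\<close>

fun ev :: "'o list \<Rightarrow> ('o, 'a, 't) cell \<Rightarrow> 'a" where
  "ev Xs (Form (ArrCell f # ts)) = f \<cdot> tup (PP Xs) (map (ev Xs) ts)"
| "ev Xs c = pp Xs ! length (args c)"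

definition evs :: "'o list \<Rightarrow> ('o, 'a, 't) cell list \<Rightarrow> 'a" where
  "evs Xs ts = tup (PP Xs) (map (ev Xs) ts)"

definition proj_trk :: "'o list \<Rightarrow> ('o, 'a, 't) cell list \<Rightarrow> nat \<Rightarrow> 't" where
  "proj_trk Xs ts k = eps (PP Xs) (map (ev Xs) ts) k"

lemma ev_simps [simp]: "ev Xs (var k) = pp Xs ! k" "ev Xs (app f ts) = f \<cdot> evs Xs ts"
  unfolding var_def app_def evs_def by (cases k) simp_all

text \<open>\<open>wt Xs t Y\<close>: the term \<open>t\<close> has type \<open>Y\<close> if its variables have the types \<open>Xs\<close>.\<close>

inductive wt :: "'o list \<Rightarrow> ('o, 'a, 't) cell \<Rightarrow> 'o \<Rightarrow> bool" for Xs where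
  wt_var: "k < length Xs \<Longrightarrow> wt Xs (var k) (Xs ! k)"
| wt_app: "list_all2 (wt Xs) ts Zs \<Longrightarrow> set Zs \<subseteq> Obj T \<Longrightarrow> f \<in> Hom T (PP Zs) Y \<Longrightarrow> wt Xs (app f ts) Y"

abbreviation wts :: "'o list \<Rightarrow> ('o, 'a, 't) cell list \<Rightarrow> 'o list \<Rightarrow> bool" where
  "wts Xs ts Ys \<equiv> set Xs \<subseteq> Obj T \<and> set Ys \<subseteq> Obj T \<and> list_all2 (wt Xs) ts Ys"

lemma evs_aux:
  assumes Xs: "set Xs \<subseteq> Obj T" and ts: "list_all2 (\<lambda>t Y. ev Xs t \<in> Hom T (PP Xs) Y) ts Ys"
  shows "evs Xs ts \<in> Hom T (PP Xs) (PP Ys)"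
    and "k < length Ys \<Longrightarrow> proj_trk Xs ts k \<in> tracks T (pp Ys ! k \<cdot> evs Xs ts) (ev Xs (ts ! k))"
proof -
  have 1: "map (Tgt T) (map (ev Xs) ts) = Ys"
    using ts unfolding list_all2_conv_all_nth Hom_def by (auto intro!: nth_equalityI)
  have 2: "\<forall>f \<in> set (map (ev Xs) ts). f \<in> Mor T \<and> Src T f = PP Xs"
    using ts unfolding list_all2_conv_all_nth Hom_def by (auto simp: in_set_conv_nth)
  show "evs Xs ts \<in> Hom T (PP Xs) (PP Ys)"
    using tup_in[OF PP_in[OF Xs] 2] unfolding 1 evs_def .
  show "k < length Ys \<Longrightarrow> proj_trk Xs ts k \<in> tracks T (pp Ys ! k \<cdot> evs Xs ts) (ev Xs (ts ! k))"
    using eps_in[OF PP_in[OF Xs] 2, of k] ts[THEN list_all2_lengthD] unfolding 1 evs_def proj_trk_def by simp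
qed

lemma ev_in: "wt Xs t Y \<Longrightarrow> set Xs \<subseteq> Obj T \<Longrightarrow> ev Xs t \<in> Hom T (PP Xs) Y"
proof (induction rule: wt.induct)
  case (wt_app ts Zs f Y)
  then have "list_all2 (\<lambda>t Y. ev Xs t \<in> Hom T (PP Xs) Y) ts Zs"
    by (auto elim: list_all2_mono)
  from evs_aux(1)[OF wt_app.prems this] show ?case using wt_app Cmp_in by simp
qed (simp add: pp_in)

lemma wtsD: "wts Xs ts Ys \<Longrightarrow> length ts = length Ys \<and> (\<forall>k < length Ys. wt Xs (ts ! k) (Ys ! k))"
  by (simp add: list_all2_conv_all_nth)

lemma wts_ev: "wts Xs ts Ys \<Longrightarrow> list_all2 (\<lambda>t Y. ev Xs t \<in> Hom T (PP Xs) Y) ts Ys"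
  using ev_in by (auto elim: list_all2_mono)

lemma evs_in: "wts Xs ts Ys \<Longrightarrow> evs Xs ts \<in> Hom T (PP Xs) (PP Ys)"
  using evs_aux(1)[OF _ wts_ev] by blast

lemma proj_trk_in: "wts Xs ts Ys \<Longrightarrow> k < length Ys \<Longrightarrow> proj_trk Xs ts k \<in> tracks T (pp Ys ! k \<cdot> evs Xs ts) (ev Xs (ts ! k))"
  using evs_aux(2)[OF _ wts_ev] by blast

lemma wt_subst:
  assumes \<sigma>: "wts Ws \<sigma> Xs"
  shows "wt Xs t Y \<Longrightarrow> wt Ws (subst \<sigma> t) Y"
proof (induction rule: wt.induct)
  case (wt_var k)
  then show ?case using wtsD[OF \<sigma>] by simp
next
  case (wt_app ts Zs f Y)
  then have "list_all2 (wt Ws) (map (subst \<sigma>) ts) Zs" by (simp add: list_all2_conv_all_nth)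
  then show ?case using wt_app wt.wt_app by simp
qed

lemma wts_subst: "wts Ws \<sigma> Xs \<Longrightarrow> wts Xs ts Ys \<Longrightarrow> wts Ws (map (subst \<sigma>) ts) Ys"
  using wt_subst[of Ws Xs \<sigma>] by (simp add: list_all2_conv_all_nth)

lemma subst_subst:
  assumes "length \<sigma> = length Xs"
  shows "wt Xs t Y \<Longrightarrow> subst \<tau> (subst \<sigma> t) = subst (map (subst \<tau>) \<sigma>) t"
proof (induction rule: wt.induct)
  case (wt_app ts Zs f Y)
  then show ?case by (simp add: list_all2_conv_all_nth list_eq_iff_nth_eq)
qed (simp add: assms)

lemma map_subst_subst: "wts Xs ts Ys \<Longrightarrow> length \<sigma> = length Xs \<Longrightarrow>
    map (subst \<tau>) (map (subst \<sigma>) ts) = map (subst (map (subst \<tau>) \<sigma>)) ts"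
  by (auto simp: list_all2_conv_all_nth list_eq_iff_nth_eq intro!: subst_subst)

lemma subst_vars: "wt Xs t Y \<Longrightarrow> subst (vars (length Xs)) t = t"
proof (induction rule: wt.induct)
  case (wt_app ts Zs f Y)
  then show ?case by (simp add: list_all2_conv_all_nth list_eq_iff_nth_eq)
qed (simp add: vars_def)

lemma map_subst_vars: "wts Xs ts Ys \<Longrightarrow> map (subst (vars (length Xs))) ts = ts"
proof (rule map_idI)
  fix t assume "wts Xs ts Ys" "t \<in> set ts"
  then obtain k where "k < length Ys" "t = ts ! k" using wtsD by (metis in_set_conv_nth)
  then show "subst (vars (length Xs)) t = t" using wtsD[OF \<open>wts Xs ts Ys\<close>] subst_vars by blast
qed

lemma map_subst_of_vars: "map (subst \<sigma>) (vars (length \<sigma>)) = \<sigma>"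
  by (rule nth_equalityI) (simp_all add: vars_def)

lemma wts_vars: "set Xs \<subseteq> Obj T \<Longrightarrow> wts Xs (vars (length Xs)) Xs"
  by (simp add: vars_def list_all2_conv_all_nth wt_var)

section \<open>Comparison of substitution with composition\<close>

text \<open>For a substitution \<open>\<sigma>\<close> and a term \<open>t\<close> there is a track from the composite of the values of \<open>t\<close> and \<open>\<sigma>\<close> to
  the value of the substituted term. On variables it is the track that identifies a component of
  the tuple \<open>\<sigma>\<close>. On applications it is a whiskering of the track for the list of arguments, which in turn
  is the unique track with the components prescribed by recursion. The comparison tracks of the
  arguments are a parameter of \<open>tuple_comparison\<close> so that it can serve inside the recursion.\<close>

definition tuple_comparison ::
    "'o list \<Rightarrow> 'o list \<Rightarrow> ('o, 'a, 't) cell list \<Rightarrow> ('o, 'a, 't) cell list \<Rightarrow> (nat \<Rightarrow> 't) \<Rightarrow> 't" where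
  "tuple_comparison Ws Xs \<sigma> ts \<alpha>s =
    lift (map (Tgt T) (map (ev Xs) ts)) (evs Xs ts \<cdot> evs Ws \<sigma>) (evs Ws (map (subst \<sigma>) ts))
      (\<lambda>k. TInv (proj_trk Ws (map (subst \<sigma>) ts) k) \<bullet> \<alpha>s k \<bullet> (proj_trk Xs ts k \<lhd> evs Ws \<sigma>))"

fun comparison :: "'o list \<Rightarrow> 'o list \<Rightarrow> ('o, 'a, 't) cell list \<Rightarrow> ('o, 'a, 't) cell \<Rightarrow> 't" where
  "comparison Ws Xs \<sigma> (Form (ArrCell f # ts)) = f \<rhd> tuple_comparison Ws Xs \<sigma> ts (\<lambda>k. map (comparison Ws Xs \<sigma>) ts ! k)"
| "comparison Ws Xs \<sigma> c = proj_trk Ws \<sigma> (length (args c))"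

definition comparisons :: "'o list \<Rightarrow> 'o list \<Rightarrow> ('o, 'a, 't) cell list \<Rightarrow> ('o, 'a, 't) cell list \<Rightarrow> 't" where
  "comparisons Ws Xs \<sigma> ts = tuple_comparison Ws Xs \<sigma> ts (\<lambda>k. map (comparison Ws Xs \<sigma>) ts ! k)"

lemma comparison_simps [simp]: "comparison Ws Xs \<sigma> (var k) = proj_trk Ws \<sigma> k" "comparison Ws Xs \<sigma> (app f ts) = f \<rhd> comparisons Ws Xs \<sigma> ts"
  unfolding var_def app_def comparisons_def by (cases k) simp_all

lemma comparisons_aux:
  assumes \<sigma>: "wts Ws \<sigma> Xs" and ts: "wts Xs ts Ys"
    and comparison: "\<And>k. k < length Ys \<Longrightarrow> comparison Ws Xs \<sigma> (ts ! k) \<in> tracks T (ev Xs (ts ! k) \<cdot> evs Ws \<sigma>) (ev Ws (subst \<sigma> (ts ! k)))"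
  shows "comparisons Ws Xs \<sigma> ts \<in> tracks T (evs Xs ts \<cdot> evs Ws \<sigma>) (evs Ws (map (subst \<sigma>) ts))"
    and "k < length Ys \<Longrightarrow> proj_trk Ws (map (subst \<sigma>) ts) k \<bullet> (pp Ys ! k \<rhd> comparisons Ws Xs \<sigma> ts)
      = comparison Ws Xs \<sigma> (ts ! k) \<bullet> (proj_trk Xs ts k \<lhd> evs Ws \<sigma>)"
proof -
  note sts = wts_subst[OF \<sigma> ts]
  note len = wtsD[OF ts, THEN conjunct1]
  have Ys: "map (Tgt T) (map (ev Xs) ts) = Ys"
    using wts_ev[OF ts] unfolding list_all2_conv_all_nth Hom_def by (auto intro!: nth_equalityI)
  let ?f = "evs Xs ts \<cdot> evs Ws \<sigma>" and ?g = "evs Ws (map (subst \<sigma>) ts)"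
  let ?\<alpha> = "\<lambda>k. TInv (proj_trk Ws (map (subst \<sigma>) ts) k) \<bullet> map (comparison Ws Xs \<sigma>) ts ! k \<bullet> (proj_trk Xs ts k \<lhd> evs Ws \<sigma>)"
  have f: "?f \<in> Hom T (PP Ws) (PP Ys)" using Cmp_in[OF evs_in[OF ts] evs_in[OF \<sigma>]] .
  have typed: "proj_trk Ws (map (subst \<sigma>) ts) k \<in> Trk T" "TSrc T (proj_trk Ws (map (subst \<sigma>) ts) k) = pp Ys ! k \<cdot> ?g"
    "TTgt T (proj_trk Ws (map (subst \<sigma>) ts) k) = ev Ws (subst \<sigma> (ts ! k))"
    "proj_trk Xs ts k \<lhd> evs Ws \<sigma> \<in> Trk T" "TSrc T (proj_trk Xs ts k \<lhd> evs Ws \<sigma>) = pp Ys ! k \<cdot> ?f"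
    "TTgt T (proj_trk Xs ts k \<lhd> evs Ws \<sigma>) = ev Xs (ts ! k) \<cdot> evs Ws \<sigma>"
    "comparison Ws Xs \<sigma> (ts ! k) \<in> Trk T" "TSrc T (comparison Ws Xs \<sigma> (ts ! k)) = ev Xs (ts ! k) \<cdot> evs Ws \<sigma>"
    "TTgt T (comparison Ws Xs \<sigma> (ts ! k)) = ev Ws (subst \<sigma> (ts ! k))" if k: "k < length Ys" for k
    using tracksD[OF proj_trk_in[OF sts k]] tracksD[OF proj_trk_in[OF ts k]] tracksD[OF comparison[OF k]] len k
      HomD[OF evs_in[OF ts]] HomD[OF evs_in[OF \<sigma>]] HomD[OF pp_in[of Ys k]] ts
    by (simp_all add: typing Cmp_Cmp)
  have \<alpha>: "?\<alpha> k \<in> tracks T (pp Ys ! k \<cdot> ?f) (pp Ys ! k \<cdot> ?g)" if k: "k < length Ys" for k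
    using typed[OF k] len k by (simp add: tracks_def typing)
  have Ys': "set Ys \<subseteq> Obj T" using ts by blast
  have eq: "comparisons Ws Xs \<sigma> ts = lift Ys ?f ?g ?\<alpha>" unfolding comparisons_def tuple_comparison_def Ys ..
  show "comparisons Ws Xs \<sigma> ts \<in> tracks T ?f ?g"
    unfolding eq using lift(1)[where \<alpha>s = ?\<alpha>, OF Ys' f evs_in[OF sts]] \<alpha> by blast
  show "proj_trk Ws (map (subst \<sigma>) ts) k \<bullet> (pp Ys ! k \<rhd> comparisons Ws Xs \<sigma> ts)
      = comparison Ws Xs \<sigma> (ts ! k) \<bullet> (proj_trk Xs ts k \<lhd> evs Ws \<sigma>)" if k: "k < length Ys"
    unfolding eq using lift(2)[where \<alpha>s = ?\<alpha>, OF Ys' f evs_in[OF sts] _ k] \<alpha> typed[OF k] k len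
    by (simp add: TInv_cancel_left typing)
qed

lemma comparison_in:
  assumes \<sigma>: "wts Ws \<sigma> Xs"
  shows "wt Xs t Y \<Longrightarrow> comparison Ws Xs \<sigma> t \<in> tracks T (ev Xs t \<cdot> evs Ws \<sigma>) (ev Ws (subst \<sigma> t))"
proof (induction rule: wt.induct)
  case (wt_var k)
  then show ?case using proj_trk_in[OF \<sigma>] by simp
next
  case (wt_app ts Zs f Y)
  then have ts: "wts Xs ts Zs" using \<sigma> by (auto elim: list_all2_mono)
  have "comparisons Ws Xs \<sigma> ts \<in> tracks T (evs Xs ts \<cdot> evs Ws \<sigma>) (evs Ws (map (subst \<sigma>) ts))"
    by (rule comparisons_aux(1)[OF \<sigma> ts]) (use wt_app.IH in \<open>simp add: list_all2_conv_all_nth\<close>)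
  then show ?case
    using HomD[OF wt_app(3)] HomD[OF evs_in[OF ts]] HomD[OF evs_in[OF \<sigma>]]
    by (auto simp: tracks_def typing Cmp_Cmp)
qed

lemma comparisons_in: "wts Ws \<sigma> Xs \<Longrightarrow> wts Xs ts Ys \<Longrightarrow>
    comparisons Ws Xs \<sigma> ts \<in> tracks T (evs Xs ts \<cdot> evs Ws \<sigma>) (evs Ws (map (subst \<sigma>) ts))"
  using comparisons_aux(1) comparison_in wtsD by metis

lemma comparisons_eq: "wts Ws \<sigma> Xs \<Longrightarrow> wts Xs ts Ys \<Longrightarrow> k < length Ys \<Longrightarrow>
    proj_trk Ws (map (subst \<sigma>) ts) k \<bullet> (pp Ys ! k \<rhd> comparisons Ws Xs \<sigma> ts) = comparison Ws Xs \<sigma> (ts ! k) \<bullet> (proj_trk Xs ts k \<lhd> evs Ws \<sigma>)"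
  using comparisons_aux(2) comparison_in wtsD by metis

text \<open>The list of all variables evaluates to an endomorphism of \<open>PP Xs\<close> whose components are the projections,
  hence to the identity up to this track.\<close>

definition unit_comparison :: "'o list \<Rightarrow> 't" where
  "unit_comparison Xs = lift Xs (Idt T (PP Xs)) (evs Xs (vars (length Xs))) (\<lambda>k. TInv (proj_trk Xs (vars (length Xs)) k))"

lemma unit_comparison:
  assumes Xs: "set Xs \<subseteq> Obj T"
  shows unit_comparison_in: "unit_comparison Xs \<in> tracks T (Idt T (PP Xs)) (evs Xs (vars (length Xs)))"
    and unit_comparison_eq: "k < length Xs \<Longrightarrow> proj_trk Xs (vars (length Xs)) k \<bullet> (pp Xs ! k \<rhd> unit_comparison Xs) = TId T (pp Xs ! k)"
proof -
  let ?e = "\<lambda>k. proj_trk Xs (vars (length Xs)) k"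
  note v = wts_vars[OF Xs]
  have e: "?e k \<in> Trk T \<and> TSrc T (?e k) = pp Xs ! k \<cdot> evs Xs (vars (length Xs)) \<and> TTgt T (?e k) = pp Xs ! k"
    if "k < length Xs" for k
    using tracksD[OF proj_trk_in[OF v that]] that by (simp add: vars_def)
  have \<alpha>: "TInv (?e k) \<in> tracks T (pp Xs ! k \<cdot> Idt T (PP Xs)) (pp Xs ! k \<cdot> evs Xs (vars (length Xs)))"
    if "k < length Xs" for k
    using e[OF that] HomD[OF pp_in[OF Xs that]] by (simp add: tracks_def typing unit_simps)
  note l = lift[where \<alpha>s = "\<lambda>k. TInv (?e k)", OF Xs Idt_in[OF PP_in[OF Xs]] evs_in[OF v] \<alpha>, folded unit_comparison_def]
  show "unit_comparison Xs \<in> tracks T (Idt T (PP Xs)) (evs Xs (vars (length Xs)))" using l(1) by blast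
  show "k < length Xs \<Longrightarrow> ?e k \<bullet> (pp Xs ! k \<rhd> unit_comparison Xs) = TId T (pp Xs ! k)"
    using l(2)[of k] e[of k] by (simp add: typing unit_simps)
qed

text \<open>Uniqueness of lifts, in the form in which the three coherence laws below are proved: components are
  compared after passing to the entries of the tuple, where \<open>comparisons_eq\<close> computes them.\<close>

lemma proj_trk_faithful:
  assumes ts: "wts Xs ts Ys" and f: "f \<in> Hom T (PP Xs) (PP Ys)"
    and \<alpha>: "\<alpha> \<in> tracks T f (evs Xs ts)" and \<beta>: "\<beta> \<in> tracks T f (evs Xs ts)"
    and eq: "\<And>k. k < length Ys \<Longrightarrow> proj_trk Xs ts k \<bullet> (pp Ys ! k \<rhd> \<alpha>) = proj_trk Xs ts k \<bullet> (pp Ys ! k \<rhd> \<beta>)"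
  shows "\<alpha> = \<beta>"
proof (rule pp_faithful[OF _ f \<alpha> \<beta>])
  show Ys: "set Ys \<subseteq> Obj T" using ts by blast
  show "pp Ys ! k \<rhd> \<alpha> = pp Ys ! k \<rhd> \<beta>" if k: "k < length Ys" for k
    by (rule VCmp_cancel_left[OF _ _ _ _ _ eq[OF k]])
      (use tracksD[OF proj_trk_in[OF ts k]] HomD[OF pp_in[OF Ys k]] tracksD[OF \<alpha>] tracksD[OF \<beta>] HomD[OF f] in
        \<open>simp_all add: typing\<close>)
qed

lemma comparisons_vars:
  assumes \<sigma>: "wts Ws \<sigma> Xs"
  shows "comparisons Ws Xs \<sigma> (vars (length Xs)) \<bullet> (unit_comparison Xs \<lhd> evs Ws \<sigma>) = TId T (evs Ws \<sigma>)"
proof -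
  have Xs: "set Xs \<subseteq> Obj T" and len: "length \<sigma> = length Xs" using \<sigma> wtsD by auto
  note v = wts_vars[OF Xs]
  note sv = map_subst_of_vars[of \<sigma>, unfolded len]
  note E\<sigma> = HomD[OF evs_in[OF \<sigma>]] and Ev = HomD[OF evs_in[OF v]]
  note c = tracksD[OF comparisons_in[OF \<sigma> v], unfolded sv] and u = tracksD[OF unit_comparison_in[OF Xs]]
  note o = PP_in[OF Xs]
  show ?thesis
  proof (rule proj_trk_faithful[OF \<sigma> evs_in[OF \<sigma>]])
    show "comparisons Ws Xs \<sigma> (vars (length Xs)) \<bullet> (unit_comparison Xs \<lhd> evs Ws \<sigma>) \<in> tracks T (evs Ws \<sigma>) (evs Ws \<sigma>)"
      "TId T (evs Ws \<sigma>) \<in> tracks T (evs Ws \<sigma>) (evs Ws \<sigma>)"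
      using c u E\<sigma> Ev o by (simp_all add: tracks_def typing unit_simps)
    fix k assume k: "k < length Xs"
    note p = HomD[OF pp_in[OF Xs k]] and e = tracksD[OF proj_trk_in[OF \<sigma> k]] and ev = tracksD[OF proj_trk_in[OF v k]]
    have varsk: "vars (length Xs) ! k = var k" using k by (simp add: vars_def)
    have "proj_trk Ws \<sigma> k \<bullet> (pp Xs ! k \<rhd> (comparisons Ws Xs \<sigma> (vars (length Xs)) \<bullet> (unit_comparison Xs \<lhd> evs Ws \<sigma>)))
        = (proj_trk Ws \<sigma> k \<bullet> (pp Xs ! k \<rhd> comparisons Ws Xs \<sigma> (vars (length Xs)))) \<bullet> ((pp Xs ! k \<rhd> unit_comparison Xs) \<lhd> evs Ws \<sigma>)"
      using c u E\<sigma> Ev o p e by (simp add: lw_VCmp lw_rw VCmp_VCmp typing unit_simps)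
    also have "\<dots> = proj_trk Ws \<sigma> k \<bullet> (proj_trk Xs (vars (length Xs)) k \<lhd> evs Ws \<sigma>) \<bullet> ((pp Xs ! k \<rhd> unit_comparison Xs) \<lhd> evs Ws \<sigma>)"
      using comparisons_eq[OF \<sigma> v k] u E\<sigma> Ev o p e ev unfolding sv varsk
      by (simp add: VCmp_VCmp typing unit_simps Cmp_Cmp)
    also have "(proj_trk Xs (vars (length Xs)) k \<lhd> evs Ws \<sigma>) \<bullet> ((pp Xs ! k \<rhd> unit_comparison Xs) \<lhd> evs Ws \<sigma>)
        = (proj_trk Xs (vars (length Xs)) k \<bullet> (pp Xs ! k \<rhd> unit_comparison Xs)) \<lhd> evs Ws \<sigma>"
      using u E\<sigma> Ev o p ev by (simp add: rw_VCmp typing unit_simps)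
    finally show "proj_trk Ws \<sigma> k \<bullet> (pp Xs ! k \<rhd> (comparisons Ws Xs \<sigma> (vars (length Xs)) \<bullet> (unit_comparison Xs \<lhd> evs Ws \<sigma>)))
        = proj_trk Ws \<sigma> k \<bullet> (pp Xs ! k \<rhd> TId T (evs Ws \<sigma>))"
      using unit_comparison_eq[OF Xs k] E\<sigma> p by (simp add: unit_simps)
  qed
qed

text \<open>Here and for associativity the law for lists is first derived from the law for the entries, which is
  the form in which it is needed as an induction step for terms.\<close>

lemma comparisons_unit_right_aux:
  assumes ts: "wts Xs ts Ys"
    and comparison: "\<And>k. k < length Ys \<Longrightarrow>
      comparison Xs Xs (vars (length Xs)) (ts ! k) \<bullet> (ev Xs (ts ! k) \<rhd> unit_comparison Xs) = TId T (ev Xs (ts ! k))"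
  shows "comparisons Xs Xs (vars (length Xs)) ts \<bullet> (evs Xs ts \<rhd> unit_comparison Xs) = TId T (evs Xs ts)"
proof -
  have Xs: "set Xs \<subseteq> Obj T" and Ys: "set Ys \<subseteq> Obj T" using ts by auto
  note v = wts_vars[OF Xs]
  note E = HomD[OF evs_in[OF ts]] and Ev = HomD[OF evs_in[OF v]]
  note c = tracksD[OF comparisons_in[OF v ts], unfolded map_subst_vars[OF ts]] and u = tracksD[OF unit_comparison_in[OF Xs]]
  note o = PP_in[OF Xs]
  show ?thesis
  proof (rule proj_trk_faithful[OF ts evs_in[OF ts]])
    show "comparisons Xs Xs (vars (length Xs)) ts \<bullet> (evs Xs ts \<rhd> unit_comparison Xs) \<in> tracks T (evs Xs ts) (evs Xs ts)"
      "TId T (evs Xs ts) \<in> tracks T (evs Xs ts) (evs Xs ts)"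
      using c u E Ev o by (simp_all add: tracks_def typing unit_simps)
    fix k assume k: "k < length Ys"
    note p = HomD[OF pp_in[OF Ys k]] and e = tracksD[OF proj_trk_in[OF ts k]]
    have wk: "wt Xs (ts ! k) (Ys ! k)" using wtsD[OF ts] k by blast
    note ck = tracksD[OF comparison_in[OF v wk], unfolded subst_vars[OF wk]] and evk = HomD[OF ev_in[OF wk Xs]]
    have "proj_trk Xs ts k \<bullet> (pp Ys ! k \<rhd> (comparisons Xs Xs (vars (length Xs)) ts \<bullet> (evs Xs ts \<rhd> unit_comparison Xs)))
        = (proj_trk Xs ts k \<bullet> (pp Ys ! k \<rhd> comparisons Xs Xs (vars (length Xs)) ts)) \<bullet> (pp Ys ! k \<cdot> evs Xs ts \<rhd> unit_comparison Xs)"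
      using c u E Ev o p e by (simp add: lw_VCmp lw_lw VCmp_VCmp typing unit_simps Cmp_Cmp)
    also have "\<dots> = comparison Xs Xs (vars (length Xs)) (ts ! k) \<bullet> (proj_trk Xs ts k \<lhd> evs Xs (vars (length Xs))) \<bullet>
        (pp Ys ! k \<cdot> evs Xs ts \<rhd> unit_comparison Xs)"
      using comparisons_eq[OF v ts k] u E Ev o p e ck unfolding map_subst_vars[OF ts]
      by (simp add: VCmp_VCmp typing unit_simps Cmp_Cmp)
    also have "(proj_trk Xs ts k \<lhd> evs Xs (vars (length Xs))) \<bullet> (pp Ys ! k \<cdot> evs Xs ts \<rhd> unit_comparison Xs)
        = (ev Xs (ts ! k) \<rhd> unit_comparison Xs) \<bullet> proj_trk Xs ts k"
      using HCmp_lr[of "proj_trk Xs ts k" "unit_comparison Xs"] HCmp_rl[of "proj_trk Xs ts k" "unit_comparison Xs"] u E p e o evk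
      by (simp add: typing unit_simps)
    also have "comparison Xs Xs (vars (length Xs)) (ts ! k) \<bullet> (ev Xs (ts ! k) \<rhd> unit_comparison Xs) \<bullet> proj_trk Xs ts k
        = (comparison Xs Xs (vars (length Xs)) (ts ! k) \<bullet> (ev Xs (ts ! k) \<rhd> unit_comparison Xs)) \<bullet> proj_trk Xs ts k"
      using u E Ev p e o evk ck by (simp add: VCmp_VCmp typing unit_simps Cmp_Cmp)
    finally show "proj_trk Xs ts k \<bullet> (pp Ys ! k \<rhd> (comparisons Xs Xs (vars (length Xs)) ts \<bullet> (evs Xs ts \<rhd> unit_comparison Xs)))
        = proj_trk Xs ts k \<bullet> (pp Ys ! k \<rhd> TId T (evs Xs ts))"
      unfolding comparison[OF k] using e p E evk by (simp add: unit_simps)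
  qed
qed

lemma comparison_unit_right:
  assumes Xs: "set Xs \<subseteq> Obj T"
  shows "wt Xs t Y \<Longrightarrow> comparison Xs Xs (vars (length Xs)) t \<bullet> (ev Xs t \<rhd> unit_comparison Xs) = TId T (ev Xs t)"
proof (induction rule: wt.induct)
  case (wt_var k)
  then show ?case using unit_comparison_eq[OF Xs] by simp
next
  case (wt_app ts Zs f Y)
  then have ts: "wts Xs ts Zs" using Xs by (auto elim: list_all2_mono)
  have "comparisons Xs Xs (vars (length Xs)) ts \<bullet> (evs Xs ts \<rhd> unit_comparison Xs) = TId T (evs Xs ts)"
    by (rule comparisons_unit_right_aux[OF ts]) (use wt_app.IH in \<open>simp add: list_all2_conv_all_nth\<close>)
  then have "f \<rhd> (comparisons Xs Xs (vars (length Xs)) ts \<bullet> (evs Xs ts \<rhd> unit_comparison Xs)) = f \<rhd> TId T (evs Xs ts)" by simp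
  then show ?case
    using HomD[OF wt_app(3)] HomD[OF evs_in[OF ts]] HomD[OF evs_in[OF wts_vars[OF Xs]]] PP_in[OF Xs]
      tracksD[OF comparisons_in[OF wts_vars[OF Xs] ts]] tracksD[OF unit_comparison_in[OF Xs]]
    by (simp add: lw_VCmp lw_lw unit_simps typing)
qed

lemma comparisons_unit_right:
  "wts Xs ts Ys \<Longrightarrow> comparisons Xs Xs (vars (length Xs)) ts \<bullet> (evs Xs ts \<rhd> unit_comparison Xs) = TId T (evs Xs ts)"
  using comparisons_unit_right_aux comparison_unit_right wtsD by metis

text \<open>Both composites have, at the entry \<open>k\<close>, a component that starts with the track identifying the \<open>k\<close>-th
  component of \<open>ts\<close>; moving that track to the front by exchange leaves the law for the term \<open>ts ! k\<close>.\<close>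

lemma comparisons_assoc_aux:
  assumes \<tau>: "wts Vs \<tau> Ws" and \<sigma>: "wts Ws \<sigma> Xs" and ts: "wts Xs ts Ys"
    and comparison: "\<And>k. k < length Ys \<Longrightarrow>
      comparison Vs Ws \<tau> (subst \<sigma> (ts ! k)) \<bullet> (comparison Ws Xs \<sigma> (ts ! k) \<lhd> evs Vs \<tau>) =
      comparison Vs Xs (map (subst \<tau>) \<sigma>) (ts ! k) \<bullet> (ev Xs (ts ! k) \<rhd> comparisons Vs Ws \<tau> \<sigma>)"
  shows "comparisons Vs Ws \<tau> (map (subst \<sigma>) ts) \<bullet> (comparisons Ws Xs \<sigma> ts \<lhd> evs Vs \<tau>) =
    comparisons Vs Xs (map (subst \<tau>) \<sigma>) ts \<bullet> (evs Xs ts \<rhd> comparisons Vs Ws \<tau> \<sigma>)"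
proof -
  have Xs: "set Xs \<subseteq> Obj T" and Ys: "set Ys \<subseteq> Obj T" and len: "length \<sigma> = length Xs" "length ts = length Ys"
    using ts wtsD[OF \<sigma>] wtsD[OF ts] by auto
  let ?\<sigma>\<tau> = "map (subst \<tau>) \<sigma>" and ?t\<sigma> = "map (subst \<sigma>) ts"
  note \<sigma>\<tau> = wts_subst[OF \<tau> \<sigma>] and t\<sigma> = wts_subst[OF \<sigma> ts]
  note t\<sigma>\<tau> = wts_subst[OF \<sigma>\<tau> ts]
  note ss = map_subst_subst[OF ts len(1), of \<tau>]
  note E\<tau> = HomD[OF evs_in[OF \<tau>]] and E\<sigma> = HomD[OF evs_in[OF \<sigma>]] and Et = HomD[OF evs_in[OF ts]]
    and E\<sigma>\<tau> = HomD[OF evs_in[OF \<sigma>\<tau>]] and Et\<sigma> = HomD[OF evs_in[OF t\<sigma>]] and Et\<sigma>\<tau> = HomD[OF evs_in[OF t\<sigma>\<tau>]]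
  note c\<tau>\<sigma> = tracksD[OF comparisons_in[OF \<tau> \<sigma>]] and c\<sigma>t = tracksD[OF comparisons_in[OF \<sigma> ts]]
    and c\<sigma>\<tau>t = tracksD[OF comparisons_in[OF \<sigma>\<tau> ts]] and c\<tau>t\<sigma> = tracksD[OF comparisons_in[OF \<tau> t\<sigma>], unfolded ss]
  note typed = E\<tau> E\<sigma> Et E\<sigma>\<tau> Et\<sigma> Et\<sigma>\<tau> c\<tau>\<sigma> c\<sigma>t c\<sigma>\<tau>t c\<tau>t\<sigma>
  show ?thesis
  proof (rule proj_trk_faithful[OF t\<sigma>\<tau> Cmp_in[OF evs_in[OF ts] Cmp_in[OF evs_in[OF \<sigma>] evs_in[OF \<tau>]]]])
    show "comparisons Vs Ws \<tau> ?t\<sigma> \<bullet> (comparisons Ws Xs \<sigma> ts \<lhd> evs Vs \<tau>) \<in>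
        tracks T (evs Xs ts \<cdot> evs Ws \<sigma> \<cdot> evs Vs \<tau>) (evs Vs (map (subst ?\<sigma>\<tau>) ts))"
      "comparisons Vs Xs ?\<sigma>\<tau> ts \<bullet> (evs Xs ts \<rhd> comparisons Vs Ws \<tau> \<sigma>) \<in>
        tracks T (evs Xs ts \<cdot> evs Ws \<sigma> \<cdot> evs Vs \<tau>) (evs Vs (map (subst ?\<sigma>\<tau>) ts))"
      using typed by (simp_all add: tracks_def typing Cmp_Cmp)
    fix k assume k: "k < length Ys"
    have wk: "wt Xs (ts ! k) (Ys ! k)" using wtsD[OF ts] k by blast
    have t\<sigma>k: "?t\<sigma> ! k = subst \<sigma> (ts ! k)" "map (subst ?\<sigma>\<tau>) ts ! k = subst ?\<sigma>\<tau> (ts ! k)" using k len by simp_all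
    note ssk = subst_subst[OF len(1) wk, of \<tau>]
    note p = HomD[OF pp_in[OF Ys k]] and e = tracksD[OF proj_trk_in[OF ts k]]
      and e\<sigma> = tracksD[OF proj_trk_in[OF t\<sigma> k], unfolded t\<sigma>k] and e\<sigma>\<tau> = tracksD[OF proj_trk_in[OF t\<sigma>\<tau> k], unfolded t\<sigma>k]
      and evk = HomD[OF ev_in[OF wk Xs]]
      and ck = tracksD[OF comparison_in[OF \<sigma> wk]]
      and ck2 = tracksD[OF comparison_in[OF \<tau> wt_subst[OF \<sigma> wk]], unfolded ssk]
      and ck3 = tracksD[OF comparison_in[OF \<sigma>\<tau> wk]]
    have ev2: "ev Ws (subst \<sigma> (ts ! k)) \<in> Mor T \<and> Src T (ev Ws (subst \<sigma> (ts ! k))) = PP Ws"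
      using HomD[OF ev_in[OF wt_subst[OF \<sigma> wk]]] \<sigma> by blast
    note typed = typed p e e\<sigma> e\<sigma>\<tau> evk ck ck2 ck3 ev2
    have "proj_trk Vs (map (subst ?\<sigma>\<tau>) ts) k \<bullet> (pp Ys ! k \<rhd> (comparisons Vs Ws \<tau> ?t\<sigma> \<bullet> (comparisons Ws Xs \<sigma> ts \<lhd> evs Vs \<tau>)))
        = (proj_trk Vs (map (subst ?\<sigma>\<tau>) ts) k \<bullet> (pp Ys ! k \<rhd> comparisons Vs Ws \<tau> ?t\<sigma>)) \<bullet> ((pp Ys ! k \<rhd> comparisons Ws Xs \<sigma> ts) \<lhd> evs Vs \<tau>)"
      using typed by (simp add: lw_VCmp lw_rw VCmp_VCmp typing Cmp_Cmp)
    also have "\<dots> = (comparison Vs Ws \<tau> (subst \<sigma> (ts ! k)) \<bullet> (proj_trk Ws ?t\<sigma> k \<lhd> evs Vs \<tau>)) \<bullet> ((pp Ys ! k \<rhd> comparisons Ws Xs \<sigma> ts) \<lhd> evs Vs \<tau>)"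
      using comparisons_eq[OF \<tau> t\<sigma> k] unfolding ss t\<sigma>k by simp
    also have "\<dots> = comparison Vs Ws \<tau> (subst \<sigma> (ts ! k)) \<bullet> ((proj_trk Ws ?t\<sigma> k \<bullet> (pp Ys ! k \<rhd> comparisons Ws Xs \<sigma> ts)) \<lhd> evs Vs \<tau>)"
      using typed by (simp add: rw_VCmp VCmp_VCmp typing Cmp_Cmp)
    also have "\<dots> = comparison Vs Ws \<tau> (subst \<sigma> (ts ! k)) \<bullet> (comparison Ws Xs \<sigma> (ts ! k) \<bullet> (proj_trk Xs ts k \<lhd> evs Ws \<sigma>)) \<lhd> evs Vs \<tau>"
      unfolding comparisons_eq[OF \<sigma> ts k] ..
    also have "\<dots> = (comparison Vs Ws \<tau> (subst \<sigma> (ts ! k)) \<bullet> (comparison Ws Xs \<sigma> (ts ! k) \<lhd> evs Vs \<tau>)) \<bullet> (proj_trk Xs ts k \<lhd> (evs Ws \<sigma> \<cdot> evs Vs \<tau>))"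
      using typed by (simp add: rw_VCmp rw_rw VCmp_VCmp typing Cmp_Cmp)
    also have "\<dots> = comparison Vs Xs ?\<sigma>\<tau> (ts ! k) \<bullet> (ev Xs (ts ! k) \<rhd> comparisons Vs Ws \<tau> \<sigma>) \<bullet> (proj_trk Xs ts k \<lhd> (evs Ws \<sigma> \<cdot> evs Vs \<tau>))"
      unfolding comparison[OF k] using typed by (simp add: VCmp_VCmp typing Cmp_Cmp)
    also have "(ev Xs (ts ! k) \<rhd> comparisons Vs Ws \<tau> \<sigma>) \<bullet> (proj_trk Xs ts k \<lhd> (evs Ws \<sigma> \<cdot> evs Vs \<tau>))
        = (proj_trk Xs ts k \<lhd> evs Vs ?\<sigma>\<tau>) \<bullet> (pp Ys ! k \<cdot> evs Xs ts \<rhd> comparisons Vs Ws \<tau> \<sigma>)"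
      using HCmp_lr[of "proj_trk Xs ts k" "comparisons Vs Ws \<tau> \<sigma>"] HCmp_rl[of "proj_trk Xs ts k" "comparisons Vs Ws \<tau> \<sigma>"] typed
      by (simp add: typing)
    also have "comparison Vs Xs ?\<sigma>\<tau> (ts ! k) \<bullet> \<dots>
        = (comparison Vs Xs ?\<sigma>\<tau> (ts ! k) \<bullet> (proj_trk Xs ts k \<lhd> evs Vs ?\<sigma>\<tau>)) \<bullet> (pp Ys ! k \<cdot> evs Xs ts \<rhd> comparisons Vs Ws \<tau> \<sigma>)"
      using typed by (simp add: VCmp_VCmp typing Cmp_Cmp)
    also have "\<dots> = (proj_trk Vs (map (subst ?\<sigma>\<tau>) ts) k \<bullet> (pp Ys ! k \<rhd> comparisons Vs Xs ?\<sigma>\<tau> ts)) \<bullet> (pp Ys ! k \<cdot> evs Xs ts \<rhd> comparisons Vs Ws \<tau> \<sigma>)"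
      unfolding comparisons_eq[OF \<sigma>\<tau> ts k] ..
    also have "\<dots> = proj_trk Vs (map (subst ?\<sigma>\<tau>) ts) k \<bullet> (pp Ys ! k \<rhd> (comparisons Vs Xs ?\<sigma>\<tau> ts \<bullet> (evs Xs ts \<rhd> comparisons Vs Ws \<tau> \<sigma>)))"
      using typed by (simp add: lw_VCmp lw_lw VCmp_VCmp typing Cmp_Cmp)
    finally show "proj_trk Vs (map (subst ?\<sigma>\<tau>) ts) k \<bullet> (pp Ys ! k \<rhd> (comparisons Vs Ws \<tau> ?t\<sigma> \<bullet> (comparisons Ws Xs \<sigma> ts \<lhd> evs Vs \<tau>)))
        = proj_trk Vs (map (subst ?\<sigma>\<tau>) ts) k \<bullet> (pp Ys ! k \<rhd> (comparisons Vs Xs ?\<sigma>\<tau> ts \<bullet> (evs Xs ts \<rhd> comparisons Vs Ws \<tau> \<sigma>)))" .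
  qed
qed

lemma comparison_assoc:
  assumes \<tau>: "wts Vs \<tau> Ws" and \<sigma>: "wts Ws \<sigma> Xs"
  shows "wt Xs t Y \<Longrightarrow> comparison Vs Ws \<tau> (subst \<sigma> t) \<bullet> (comparison Ws Xs \<sigma> t \<lhd> evs Vs \<tau>) =
    comparison Vs Xs (map (subst \<tau>) \<sigma>) t \<bullet> (ev Xs t \<rhd> comparisons Vs Ws \<tau> \<sigma>)"
proof (induction rule: wt.induct)
  case (wt_var k)
  then show ?case using comparisons_eq[OF \<tau> \<sigma>] wtsD[OF \<sigma>] by simp
next
  case (wt_app ts Zs f Y)
  then have ts: "wts Xs ts Zs" using \<sigma> by (auto elim: list_all2_mono)
  let ?\<sigma>\<tau> = "map (subst \<tau>) \<sigma>" and ?t\<sigma> = "map (subst \<sigma>) ts"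
  have "comparisons Vs Ws \<tau> ?t\<sigma> \<bullet> (comparisons Ws Xs \<sigma> ts \<lhd> evs Vs \<tau>) = comparisons Vs Xs ?\<sigma>\<tau> ts \<bullet> (evs Xs ts \<rhd> comparisons Vs Ws \<tau> \<sigma>)"
    by (rule comparisons_assoc_aux[OF \<tau> \<sigma> ts]) (use wt_app.IH in \<open>simp add: list_all2_conv_all_nth\<close>)
  then have "f \<rhd> (comparisons Vs Ws \<tau> ?t\<sigma> \<bullet> (comparisons Ws Xs \<sigma> ts \<lhd> evs Vs \<tau>))
      = f \<rhd> (comparisons Vs Xs ?\<sigma>\<tau> ts \<bullet> (evs Xs ts \<rhd> comparisons Vs Ws \<tau> \<sigma>))" by simp
  then show ?case
    using HomD[OF wt_app(3)] HomD[OF evs_in[OF ts]] HomD[OF evs_in[OF \<sigma>]] HomD[OF evs_in[OF \<tau>]]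
      HomD[OF evs_in[OF wts_subst[OF \<sigma> ts]]]
      tracksD[OF comparisons_in[OF \<sigma> ts]] tracksD[OF comparisons_in[OF \<tau> \<sigma>]] tracksD[OF comparisons_in[OF wts_subst[OF \<tau> \<sigma>] ts]]
      tracksD[OF comparisons_in[OF \<tau> wts_subst[OF \<sigma> ts]]]
    by (simp add: lw_VCmp lw_lw lw_rw typing Cmp_Cmp)
qed

lemma comparisons_assoc:
  assumes "wts Vs \<tau> Ws" "wts Ws \<sigma> Xs" "wts Xs ts Ys"
  shows "comparisons Vs Ws \<tau> (map (subst \<sigma>) ts) \<bullet> (comparisons Ws Xs \<sigma> ts \<lhd> evs Vs \<tau>) =
    comparisons Vs Xs (map (subst \<tau>) \<sigma>) ts \<bullet> (evs Xs ts \<rhd> comparisons Vs Ws \<tau> \<sigma>)"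
  by (rule comparisons_assoc_aux[OF assms]) (use comparison_assoc[OF assms(1,2)] wtsD[OF assms(3)] in blast)

end

section \<open>The category of terms\<close>

definition obj :: "'o list \<Rightarrow> ('o, 'a, 't) cell" where
  "obj Xs = Form (map ObjCell Xs)"

definition objs :: "('o, 'a, 't) cell \<Rightarrow> 'o list" where
  "objs c = map (\<lambda>c. case c of ObjCell X \<Rightarrow> X | _ \<Rightarrow> undefined) (args c)"

text \<open>A list of terms is typed by many lists of objects, so both ends are recorded.\<close>

definition arrow :: "'o list \<Rightarrow> 'o list \<Rightarrow> ('o, 'a, 't) cell list \<Rightarrow> ('o, 'a, 't) cell" where
  "arrow Ws Ys ts = Form [obj Ws, obj Ys, Form ts]"

definition terms :: "('o, 'a, 't) cell \<Rightarrow> ('o, 'a, 't) cell list" where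
  "terms c = args (part 2 c)"

lemma objs_obj [simp]: "objs (obj Xs) = Xs"
  unfolding objs_def obj_def by (simp add: comp_def)

lemma obj_inject [simp]: "obj Xs = obj Ys \<longleftrightarrow> Xs = Ys"
  by (metis objs_obj)

lemma arrow_simps [simp]:
  "part 0 (arrow Ws Ys ts) = obj Ws" "part (Suc 0) (arrow Ws Ys ts) = obj Ys" "terms (arrow Ws Ys ts) = ts"
  "arrow Ws Ys ts = arrow Ws' Ys' ts' \<longleftrightarrow> Ws = Ws' \<and> Ys = Ys' \<and> ts = ts'"
  unfolding terms_def arrow_def part_def by auto

context chosen_products
begin

definition Terms :: "(('o, 'a, 't) cell, ('o, 'a, 't) cell) category" where
  "Terms =
    \<lparr>Obj = obj ` {Xs. set Xs \<subseteq> Obj T},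
     Mor = {arrow Ws Ys ts | Ws Ys ts. wts Ws ts Ys},
     Src = part 0,
     Tgt = part 1,
     Idt = (\<lambda>X. arrow (objs X) (objs X) (vars (length (objs X)))),
     Cmp = (\<lambda>g f. arrow (objs (part 0 f)) (objs (part 1 g)) (map (subst (terms f)) (terms g)))\<rparr>"

lemma Terms_simps:
  "X \<in> Obj Terms \<longleftrightarrow> (\<exists>Xs. X = obj Xs \<and> set Xs \<subseteq> Obj T)"
  "f \<in> Mor Terms \<longleftrightarrow> (\<exists>Ws Ys ts. f = arrow Ws Ys ts \<and> wts Ws ts Ys)"
  "Src Terms (arrow Ws Ys ts) = obj Ws" "Tgt Terms (arrow Ws Ys ts) = obj Ys"
  "Idt Terms (obj Xs) = arrow Xs Xs (vars (length Xs))"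
  "Cmp Terms (arrow Xs Ys ts) (arrow Ws Xs' \<sigma>) = arrow Ws Ys (map (subst \<sigma>) ts)"
  unfolding Terms_def by auto

lemma Hom_Terms: "f \<in> Hom Terms X Y \<longleftrightarrow> (\<exists>Ws Ys ts. X = obj Ws \<and> Y = obj Ys \<and> f = arrow Ws Ys ts \<and> wts Ws ts Ys)"
  unfolding Hom_def by (auto simp: Terms_simps)

lemma Hom_TermsE:
  assumes "f \<in> Hom Terms X Y"
  obtains Ws Ys ts where "X = obj Ws" "Y = obj Ys" "f = arrow Ws Ys ts" "wts Ws ts Ys"
  using assms unfolding Hom_Terms by blast

lemma category_Terms: "category Terms"
proof
  show "Src Terms f \<in> Obj Terms" "Tgt Terms f \<in> Obj Terms" if "f \<in> Mor Terms" for f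
    using that by (auto simp: Terms_simps)
  show "Idt Terms X \<in> Hom Terms X X" if "X \<in> Obj Terms" for X
    using that wts_vars by (auto simp: Terms_simps Hom_Terms)
  show "Cmp Terms g f \<in> Hom Terms X Z" if "g \<in> Hom Terms Y Z" "f \<in> Hom Terms X Y" for g f X Y Z
    using that wts_subst by (auto elim!: Hom_TermsE simp: Terms_simps Hom_Terms)
  show "Cmp Terms (Idt Terms Y) f = f" if "f \<in> Hom Terms X Y" for f X Y
    using that map_subst_of_vars[of "terms f"]
    by (auto elim!: Hom_TermsE simp: Terms_simps dest!: list_all2_lengthD)
  show "Cmp Terms f (Idt Terms X) = f" if "f \<in> Hom Terms X Y" for f X Y
    using that map_subst_vars by (auto elim!: Hom_TermsE simp: Terms_simps)
  show "Cmp Terms h (Cmp Terms g f) = Cmp Terms (Cmp Terms h g) f"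
    if hgf: "h \<in> Hom Terms Y Z" "g \<in> Hom Terms X Y" "f \<in> Hom Terms W X" for h g f W X Y Z
  proof -
    obtain Ys Zs ts where h: "Y = obj Ys" "h = arrow Ys Zs ts" "wts Ys ts Zs" using Hom_TermsE[OF hgf(1)] .
    obtain Xs \<sigma> where g: "X = obj Xs" "g = arrow Xs Ys \<sigma>" "wts Xs \<sigma> Ys"
      using Hom_TermsE[OF hgf(2)] h(1) by (metis obj_inject)
    obtain Ws \<tau> where f: "f = arrow Ws Xs \<tau>" using Hom_TermsE[OF hgf(3)] g(1) by (metis obj_inject)
    have "length \<sigma> = length Ys" using g(3) wtsD by blast
    then show ?thesis using map_subst_subst[OF h(3)] unfolding h(2) g(2) f by (simp add: Terms_simps)
  qed
qed

definition tob :: "('o, 'a, 't) cell \<Rightarrow> 'o" where "tob X = PP (objs X)"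

definition tarr :: "('o, 'a, 't) cell \<Rightarrow> 'a" where "tarr f = evs (objs (part 0 f)) (terms f)"

definition tunit :: "('o, 'a, 't) cell \<Rightarrow> 't" where "tunit X = unit_comparison (objs X)"

definition tcomp :: "('o, 'a, 't) cell \<Rightarrow> ('o, 'a, 't) cell \<Rightarrow> 't" where
  "tcomp g f = comparisons (objs (part 0 f)) (objs (part 0 g)) (terms f) (terms g)"

lemma pseudofunctor_Terms: "pseudofunctor Terms T tob tarr tunit tcomp"
proof (rule pseudofunctor.intro[OF category_Terms track_category_axioms], rule pseudofunctor_axioms.intro)
  show "tob X \<in> Obj T" if "X \<in> Obj Terms" for X
    using that PP_in by (auto simp: Terms_simps tob_def)
  show "tarr f \<in> Hom T (tob X) (tob Y)" if "f \<in> Hom Terms X Y" for f X Y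
    using that evs_in by (auto elim!: Hom_TermsE simp: tob_def tarr_def)
  show "tunit X \<in> tracks T (Idt T (tob X)) (tarr (Idt Terms X))" if "X \<in> Obj Terms" for X
    using that unit_comparison_in by (auto simp: Terms_simps tob_def tarr_def tunit_def)
  show "tcomp f g \<in> tracks T (tarr f \<cdot> tarr g) (tarr (Cmp Terms f g))"
    if "f \<in> Hom Terms Y Z" "g \<in> Hom Terms X Y" for f g X Y Z
    using that comparisons_in by (auto elim!: Hom_TermsE simp: Terms_simps tarr_def tcomp_def)
  show "tcomp (Idt Terms Y) f \<bullet> (tunit Y \<lhd> tarr f) = TId T (tarr f)" if "f \<in> Hom Terms X Y" for f X Y
    using that comparisons_vars by (auto elim!: Hom_TermsE simp: Terms_simps tarr_def tcomp_def tunit_def)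
  show "tcomp f (Idt Terms X) \<bullet> (tarr f \<rhd> tunit X) = TId T (tarr f)" if "f \<in> Hom Terms X Y" for f X Y
    using that comparisons_unit_right by (auto elim!: Hom_TermsE simp: Terms_simps tarr_def tcomp_def tunit_def)
  show "tcomp f (Cmp Terms g h) \<bullet> (tarr f \<rhd> tcomp g h) = tcomp (Cmp Terms f g) h \<bullet> (tcomp f g \<lhd> tarr h)"
    if "f \<in> Hom Terms Y Z" "g \<in> Hom Terms X Y" "h \<in> Hom Terms W X" for f g h W X Y Z
    using that comparisons_assoc by (auto elim!: Hom_TermsE simp: Terms_simps tarr_def tcomp_def)
qed

sublocale terms: pseudofunctor Terms T tob tarr tunit tcomp
  by (rule pseudofunctor_Terms)

abbreviation T' :: "('o, 'a, 't) cell_track_category" where "T' \<equiv> terms.tracks_along"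

lemma homotopic_into_product:
  assumes Zs: "set Zs \<subseteq> Obj T" and f: "f \<in> Hom T W (PP Zs)" and g: "g \<in> Hom T W (PP Zs)"
    and h: "\<And>k. k < length Zs \<Longrightarrow> homotopic (pp Zs ! k \<cdot> f) (pp Zs ! k \<cdot> g)"
  shows "homotopic f g"
proof -
  have "\<forall>k. \<exists>\<alpha>. k < length Zs \<longrightarrow> \<alpha> \<in> tracks T (pp Zs ! k \<cdot> f) (pp Zs ! k \<cdot> g)"
    using h unfolding homotopic_def by blast
  then obtain \<alpha>s where "\<And>k. k < length Zs \<Longrightarrow> \<alpha>s k \<in> tracks T (pp Zs ! k \<cdot> f) (pp Zs ! k \<cdot> g)"
    using choice[of "\<lambda>k \<alpha>. k < length Zs \<longrightarrow> \<alpha> \<in> tracks T (pp Zs ! k \<cdot> f) (pp Zs ! k \<cdot> g)"] by blast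
  from lift(1)[OF Zs f g this] show ?thesis
    using HomD[OF f] HomD[OF g] unfolding homotopic_def by blast
qed

text \<open>A 1-arrow into a chosen product is homotopic to any other with homotopic components, and the
  component \<open>pp Ys ! k \<cdot> g\<close> is, up to the unit track, the value of that 1-arrow applied to all variables.\<close>

lemma Terms_full:
  assumes X: "X \<in> Obj Terms" and Y: "Y \<in> Obj Terms" and g: "g \<in> Hom T (tob X) (tob Y)"
  shows "\<exists>f \<in> Hom Terms X Y. homotopic (tarr f) g"
proof -
  obtain Xs Ys where Xs: "X = obj Xs" "set Xs \<subseteq> Obj T" and Ys: "Y = obj Ys" "set Ys \<subseteq> Obj T"
    using X Y by (auto simp: Terms_simps)
  have g: "g \<in> Hom T (PP Xs) (PP Ys)" using g Xs Ys by (simp add: tob_def)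
  define ts :: "('o, 'a, 't) cell list" where "ts = map (\<lambda>k. app (pp Ys ! k \<cdot> g) (vars (length Xs))) [0..<length Ys]"
  have ts: "wts Xs ts Ys"
    using Xs(2) Ys(2) wts_vars[OF Xs(2)] Cmp_in[OF pp_in[OF Ys(2)] g]
    by (auto simp: ts_def list_all2_conv_all_nth[of "wt Xs" "map _ _"] intro!: wt_app)
  have "homotopic (evs Xs ts) g"
  proof (rule homotopic_into_product[OF Ys(2) evs_in[OF ts] g])
    fix k assume k: "k < length Ys"
    note p = HomD[OF pp_in[OF Ys(2) k]] and u = tracksD[OF unit_comparison_in[OF Xs(2)]]
    have "homotopic (pp Ys ! k \<cdot> evs Xs ts) ((pp Ys ! k \<cdot> g) \<cdot> evs Xs (vars (length Xs)))"
      using tracksD[OF proj_trk_in[OF ts k]] k by (intro homotopicI[of "proj_trk Xs ts k"]) (auto simp: ts_def)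
    also have "homotopic \<dots> (pp Ys ! k \<cdot> g)"
      by (rule homotopic_sym, rule homotopicI[of "pp Ys ! k \<cdot> g \<rhd> unit_comparison Xs"])
        (use p u HomD[OF g] PP_in[OF Xs(2)] in \<open>simp_all add: typing unit_simps\<close>)
    finally show "homotopic (pp Ys ! k \<cdot> evs Xs ts) (pp Ys ! k \<cdot> g)" .
  qed
  then show ?thesis
    using ts Xs Ys by (intro bexI[of _ "arrow Xs Ys ts"]) (auto simp: tarr_def Hom_Terms)
qed

lemma tob_single: "X \<in> Obj T \<Longrightarrow> tob (obj [X]) = X"
  by (simp add: tob_def PP_single)

theorem lax_equivalence_T': "lax_equivalence T' T terms.projection"
  by (rule terms.lax_equivalence_projection[OF Terms_full])
    (auto simp: Terms_simps intro!: exI[of _ "obj [_]"] tob_single)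

section \<open>Strong products of lists of objects\<close>

lemma
  assumes Ws: "set Ws \<subseteq> Obj T" and t: "wt Ws t Y"
  shows evs_single: "evs Ws [t] = ev Ws t" and proj_trk_single: "proj_trk Ws [t] 0 = TId T (ev Ws t)"
  using tup_single[of "ev Ws t"] eps_single[of "ev Ws t"] HomD[OF ev_in[OF t Ws]]
  unfolding evs_def proj_trk_def by simp_all

lemma comparisons_single:
  assumes \<sigma>: "wts Ws \<sigma> Xs" and t: "wt Xs t Y" and Y: "Y \<in> Obj T"
  shows "comparisons Ws Xs \<sigma> [t] = comparison Ws Xs \<sigma> t"
proof -
  have ts: "wts Xs [t] [Y]" using \<sigma> t Y by simp
  have Ws: "set Ws \<subseteq> Obj T" and Xs: "set Xs \<subseteq> Obj T" using \<sigma> by auto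
  note t\<sigma> = wt_subst[OF \<sigma> t]
  show ?thesis
    using comparisons_eq[OF \<sigma> ts, of 0] pp_single[OF Y] tracksD[OF comparisons_in[OF \<sigma> ts]] tracksD[OF comparison_in[OF \<sigma> t]]
      HomD[OF ev_in[OF t Xs]] HomD[OF ev_in[OF t\<sigma> Ws]] HomD[OF evs_in[OF \<sigma>]]
    by (simp add: evs_single[OF Xs t] proj_trk_single[OF Xs t] evs_single[OF Ws t\<sigma>] proj_trk_single[OF Ws t\<sigma>] typing unit_simps)
qed

definition coord :: "'o list \<Rightarrow> nat \<Rightarrow> ('o, 'a, 't) cell" where
  "coord Ys j = arrow Ys [Ys ! j] [var j]"

lemma coord_in: "set Ys \<subseteq> Obj T \<Longrightarrow> j < length Ys \<Longrightarrow> coord Ys j \<in> Hom Terms (obj Ys) (obj [Ys ! j])"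
  unfolding coord_def Hom_Terms using wt_var nth_mem by fastforce

text \<open>The values of the coordinate projections are the projections of the chosen product, and conjugation with
  the tracks \<open>proj_trk\<close> translates the lifting problem in \<open>T'\<close> into the one for the chosen product.\<close>

lemma coord_lift:
  assumes ts: "wts Ws ts Ys" and ss: "wts Ws ss Ys"
  shows "lifts_uniquely T' (map (coord Ys) [0..<length Ys]) (arrow Ws Ys ts) (arrow Ws Ys ss)"
proof -
  let ?f = "arrow Ws Ys ts" and ?g = "arrow Ws Ys ss"
  have Ws: "set Ws \<subseteq> Obj T" and Ys: "set Ys \<subseteq> Obj T" using ts by auto
  have f: "?f \<in> Mor Terms" and g: "?g \<in> Mor Terms" using ts ss by (auto simp: Terms_simps)
  have fg[simp]: "tarr ?f = evs Ws ts" "tarr ?g = evs Ws ss" by (simp_all add: tarr_def)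
  have coordD: "tarr (coord Ys j) = pp Ys ! j" "coord Ys j \<in> Mor Terms"
    "Src Terms (coord Ys j) = obj Ys" "Tgt Terms (coord Ys j) = obj [Ys ! j]" if j: "j < length Ys" for j
    using evs_single[OF Ys wt_var[OF j]] HomD[OF coord_in[OF Ys j]] by (simp_all add: tarr_def coord_def)
  have comp: "tarr (Cmp Terms (coord Ys j) (arrow Ws Ys us)) = ev Ws (us ! j)"
    "Cmp Terms (coord Ys j) (arrow Ws Ys us) \<in> Mor Terms"
    "tcomp (coord Ys j) (arrow Ws Ys us) = proj_trk Ws us j"
    if us: "wts Ws us Ys" and j: "j < length Ys" for us j
  proof -
    have w: "wt Ws (us ! j) (Ys ! j)" using wtsD[OF us] j by blast
    have Yj: "Ys ! j \<in> Obj T" using Ys j nth_mem by blast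
    show "tarr (Cmp Terms (coord Ys j) (arrow Ws Ys us)) = ev Ws (us ! j)"
      using evs_single[OF Ws w] by (simp add: coord_def Terms_simps tarr_def)
    show "Cmp Terms (coord Ys j) (arrow Ws Ys us) \<in> Mor Terms"
      using w Ws Yj by (simp add: coord_def Terms_simps)
    show "tcomp (coord Ys j) (arrow Ws Ys us) = proj_trk Ws us j"
      using comparisons_single[OF us wt_var[OF j] Yj] by (simp add: coord_def tcomp_def)
  qed
  have whisker: "HCmp T' (TId T' (coord Ys j)) (track_cell ?f ?g x) =
      track_cell (Cmp Terms (coord Ys j) ?f) (Cmp Terms (coord Ys j) ?g) a \<longleftrightarrow>
      pp Ys ! j \<rhd> x = TInv (proj_trk Ws ss j) \<bullet> a \<bullet> proj_trk Ws ts j"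
    if j: "j < length Ys" and x: "x \<in> tracks T (evs Ws ts) (evs Ws ss)"
      and a: "a \<in> tracks T (ev Ws (ts ! j)) (ev Ws (ss ! j))" for j x a
  proof -
    let ?q = "coord Ys j"
    let ?h = "terms.hcomp (track_cell ?q ?q (TId T (tarr ?q))) (track_cell ?f ?g x)"
    note t = tracksD[OF x] tracksD[OF a] HomD[OF pp_in[OF Ys j]] HomD[OF evs_in[OF ts]] HomD[OF evs_in[OF ss]]
      tracksD[OF proj_trk_in[OF ts j]] tracksD[OF proj_trk_in[OF ss j]]
    note cj = coordD[OF j] comp[OF ts j] comp[OF ss j]
    have h: "?h \<in> Trk T" "TSrc T ?h = ev Ws (ts ! j)" "TTgt T ?h = ev Ws (ss ! j)"
      "?h \<bullet> proj_trk Ws ts j = proj_trk Ws ss j \<bullet> (pp Ys ! j \<rhd> x)"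
      using terms.hcomp[of ?q ?q ?f ?g "TId T (tarr ?q)" x] f g cj t by (simp_all add: typing Terms_simps)
    have "?h = a \<longleftrightarrow> proj_trk Ws ss j \<bullet> (pp Ys ! j \<rhd> x) = a \<bullet> proj_trk Ws ts j"
      unfolding h(4)[symmetric] using VCmp_cancel_right[of "proj_trk Ws ts j" ?h a] h(1-3) t by auto
    also have "\<dots> \<longleftrightarrow> pp Ys ! j \<rhd> x = TInv (proj_trk Ws ss j) \<bullet> a \<bullet> proj_trk Ws ts j"
    proof
      assume "proj_trk Ws ss j \<bullet> (pp Ys ! j \<rhd> x) = a \<bullet> proj_trk Ws ts j"
      then have "TInv (proj_trk Ws ss j) \<bullet> proj_trk Ws ss j \<bullet> (pp Ys ! j \<rhd> x) = TInv (proj_trk Ws ss j) \<bullet> a \<bullet> proj_trk Ws ts j" by simp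
      then show "pp Ys ! j \<rhd> x = TInv (proj_trk Ws ss j) \<bullet> a \<bullet> proj_trk Ws ts j"
        using t by (simp add: TInv_cancel_left typing)
    next
      assume "pp Ys ! j \<rhd> x = TInv (proj_trk Ws ss j) \<bullet> a \<bullet> proj_trk Ws ts j"
      then show "proj_trk Ws ss j \<bullet> (pp Ys ! j \<rhd> x) = a \<bullet> proj_trk Ws ts j"
        using t by (simp add: TInv_cancel_left typing)
    qed
    finally show ?thesis by simp
  qed
  show ?thesis
    unfolding lifts_uniquely_def
  proof (intro allI impI)
    fix \<alpha>s
    assume "\<forall>j < length (map (coord Ys) [0..<length Ys]). \<alpha>s j \<in>
      tracks T' (Cmp T' (map (coord Ys) [0..<length Ys] ! j) ?f) (Cmp T' (map (coord Ys) [0..<length Ys] ! j) ?g)"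
    then have "\<exists>a. \<alpha>s j = track_cell (Cmp Terms (coord Ys j) ?f) (Cmp Terms (coord Ys j) ?g) a \<and>
        a \<in> tracks T (ev Ws (ts ! j)) (ev Ws (ss ! j))" if "j < length Ys" for j
      using that comp(1)[OF ts that] comp(1)[OF ss that] unfolding terms.tracks_along_iff by (auto simp: tracks_def)
    then obtain a where a: "\<And>j. j < length Ys \<Longrightarrow>
        \<alpha>s j = track_cell (Cmp Terms (coord Ys j) ?f) (Cmp Terms (coord Ys j) ?g) (a j) \<and>
        a j \<in> tracks T (ev Ws (ts ! j)) (ev Ws (ss ! j))" by metis
    have "TInv (proj_trk Ws ss j) \<bullet> a j \<bullet> proj_trk Ws ts j \<in> tracks T (pp Ys ! j \<cdot> evs Ws ts) (pp Ys ! j \<cdot> evs Ws ss)"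
      if "j < length Ys" for j
      using tracksD[OF a[OF that, THEN conjunct2]] tracksD[OF proj_trk_in[OF ts that]] tracksD[OF proj_trk_in[OF ss that]]
      by (simp add: tracks_def typing)
    from lift_ex1[OF Ys evs_in[OF ts] evs_in[OF ss] this]
    have ex1: "\<exists>!x. x \<in> tracks T (evs Ws ts) (evs Ws ss) \<and> (\<forall>j < length Ys. pp Ys ! j \<rhd> x = TInv (proj_trk Ws ss j) \<bullet> a j \<bullet> proj_trk Ws ts j)" .
    then obtain x where x: "x \<in> tracks T (evs Ws ts) (evs Ws ss)"
      "\<forall>j < length Ys. pp Ys ! j \<rhd> x = TInv (proj_trk Ws ss j) \<bullet> a j \<bullet> proj_trk Ws ts j" by blast
    have mem: "\<alpha> \<in> tracks T' ?f ?g \<longleftrightarrow> (\<exists>y. \<alpha> = track_cell ?f ?g y \<and> y \<in> tracks T (evs Ws ts) (evs Ws ss))" for \<alpha>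
      unfolding terms.tracks_along_iff using f g by (auto simp: tracks_def Terms_simps)
    have eqs: "HCmp T' (TId T' (map (coord Ys) [0..<length Ys] ! j)) (track_cell ?f ?g y) = \<alpha>s j \<longleftrightarrow>
        pp Ys ! j \<rhd> y = TInv (proj_trk Ws ss j) \<bullet> a j \<bullet> proj_trk Ws ts j"
      if "j < length Ys" "y \<in> tracks T (evs Ws ts) (evs Ws ss)" for j y
      using whisker[OF that] a[OF that(1)] that(1) by simp
    show "\<exists>!\<alpha>. \<alpha> \<in> tracks T' ?f ?g \<and> (\<forall>j < length (map (coord Ys) [0..<length Ys]).
        HCmp T' (TId T' (map (coord Ys) [0..<length Ys] ! j)) \<alpha> = \<alpha>s j)"
    proof (rule ex1I[of _ "track_cell ?f ?g x"])
      show "track_cell ?f ?g x \<in> tracks T' ?f ?g \<and> (\<forall>j < length (map (coord Ys) [0..<length Ys]).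
          HCmp T' (TId T' (map (coord Ys) [0..<length Ys] ! j)) (track_cell ?f ?g x) = \<alpha>s j)"
        using mem x eqs by simp
      fix \<alpha> assume \<alpha>: "\<alpha> \<in> tracks T' ?f ?g \<and> (\<forall>j < length (map (coord Ys) [0..<length Ys]).
          HCmp T' (TId T' (map (coord Ys) [0..<length Ys] ! j)) \<alpha> = \<alpha>s j)"
      then obtain y where y: "\<alpha> = track_cell ?f ?g y" "y \<in> tracks T (evs Ws ts) (evs Ws ss)" using mem by blast
      then have "\<forall>j < length Ys. pp Ys ! j \<rhd> y = TInv (proj_trk Ws ss j) \<bullet> a j \<bullet> proj_trk Ws ts j"
        using \<alpha> eqs by simp
      then show "\<alpha> = track_cell ?f ?g x" using ex1 x y by blast
    qed
  qed
qed

end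

text \<open>Start positions of the parts in a concatenation of lists of lengths \<open>ns\<close>.\<close>

definition offset :: "nat list \<Rightarrow> nat \<Rightarrow> nat" where
  "offset ns i = sum_list (take i ns)"

lemma nth_concat_offset:
  "i < length xss \<Longrightarrow> m < length (xss ! i) \<Longrightarrow>
    offset (map length xss) i + m < length (concat xss) \<and> concat xss ! (offset (map length xss) i + m) = xss ! i ! m"
proof (induction xss arbitrary: i)
  case (Cons xs xss)
  then show ?case by (cases i) (auto simp: offset_def nth_append)
qed simp

lemma offset_cases:
  "j < sum_list ns \<Longrightarrow> \<exists>i < length ns. \<exists>m < ns ! i. j = offset ns i + m"
proof (induction ns arbitrary: j)
  case (Cons n ns)
  show ?case
  proof (cases "j < n")
    case True
    then show ?thesis by (intro exI[of _ 0]) (simp add: offset_def)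
  next
    case False
    then have "j - n < sum_list ns" using Cons.prems by simp
    from Cons.IH[OF this] obtain i m where "i < length ns" "m < ns ! i" "j - n = offset ns i + m" by blast
    then show ?thesis using False by (intro exI[of _ "Suc i"]) (auto simp: offset_def intro!: exI[of _ m])
  qed
qed simp

context chosen_products
begin

definition block :: "'o list list \<Rightarrow> nat \<Rightarrow> ('o, 'a, 't) cell" where
  "block Xss i = arrow (concat Xss) (Xss ! i)
    (map (\<lambda>m. var (offset (map length Xss) i + m)) [0..<length (Xss ! i)])"

text \<open>A list of terms is determined by its blocks, which gives the bijection on 1-arrows. For tracks,
  \<open>coord_lift\<close> is applied twice: the coordinates of the concatenation give the lift and its uniqueness, and the coordinates
  of each block show that it has the prescribed blocks.\<close>

theorem strong_product_blocks:
  assumes Xss: "\<forall>Xs \<in> set Xss. set Xs \<subseteq> Obj T"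
  shows "strong_product T' (map obj Xss) (obj (concat Xss)) (map (block Xss) [0..<length Xss])"
    and "lax_product T' (map obj Xss) (obj (concat Xss)) (map (block Xss) [0..<length Xss])"
proof -
  let ?C = "concat Xss" and ?ps = "map (block Xss) [0..<length Xss]" and ?off = "offset (map length Xss)"
  have C: "set ?C \<subseteq> Obj T" using Xss by auto
  have Xi: "set (Xss ! i) \<subseteq> Obj T" if "i < length Xss" for i using Xss that nth_mem by blast
  have off: "?off i + m < length ?C" "?C ! (?off i + m) = Xss ! i ! m"
    if "i < length Xss" "m < length (Xss ! i)" for i m
    using nth_concat_offset[OF that] by auto
  have off_cases: "\<exists>i < length Xss. \<exists>m < length (Xss ! i). j = ?off i + m" if "j < length ?C" for j
    using offset_cases[of j "map length Xss"] that by (auto simp: length_concat)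
  have block: "block Xss i \<in> Hom Terms (obj ?C) (obj (Xss ! i))" if i: "i < length Xss" for i
  proof -
    have "wt ?C (var (?off i + m)) (Xss ! i ! m)" if "m < length (Xss ! i)" for m
      using wt_var[of "?off i + m" ?C] off[OF i that] by simp
    then show ?thesis using C Xi[OF i] unfolding block_def Hom_Terms by (auto simp: list_all2_conv_all_nth)
  qed
  have block_Cmp: "Cmp Terms (block Xss i) (arrow Ws ?C ts) =
      arrow Ws (Xss ! i) (map (\<lambda>m. ts ! (?off i + m)) [0..<length (Xss ! i)])" for i Ws ts
    unfolding block_def by (simp add: Terms_simps comp_def)
  have cone: "cone T' (map obj Xss) (obj ?C) ?ps"
    unfolding cone_iff using block C by (auto simp: Terms_simps)
  have unique: "\<exists>!h. h \<in> Hom T' Y (obj ?C) \<and> (\<forall>i < length (map obj Xss). Cmp T' (?ps ! i) h = fs ! i)"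
    if Y: "Y \<in> Obj T'" and fs: "length fs = length (map obj Xss)"
      "\<forall>i < length (map obj Xss). fs ! i \<in> Hom T' Y (map obj Xss ! i)" for Y fs
  proof -
    obtain Ws where Ws: "Y = obj Ws" using Y by (auto simp: Terms_simps)
    have "\<forall>i. \<exists>ts. i < length Xss \<longrightarrow> fs ! i = arrow Ws (Xss ! i) ts \<and> wts Ws ts (Xss ! i)"
      using fs(2) by (auto simp: Ws Hom_Terms)
    then obtain tss where tss: "\<And>i. i < length Xss \<Longrightarrow> fs ! i = arrow Ws (Xss ! i) (tss i) \<and> wts Ws (tss i) (Xss ! i)"
      by metis
    have len: "length (tss i) = length (Xss ! i)" if "i < length Xss" for i using wtsD tss[OF that] by blast
    let ?c = "concat (map tss [0..<length Xss])"
    have lens: "map length (map tss [0..<length Xss]) = map length Xss"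
      using len by (auto intro: nth_equalityI)
    have c_nth: "?c ! (?off i + m) = tss i ! m" if "i < length Xss" "m < length (Xss ! i)" for i m
      using nth_concat_offset[of i "map tss [0..<length Xss]" m] that len[OF that(1)] unfolding lens by simp
    have c_len: "length ?c = length ?C" by (simp only: length_concat lens)
    have "wt Ws (?c ! j) (?C ! j)" if j: "j < length ?C" for j
    proof -
      obtain i m where im: "i < length Xss" "m < length (Xss ! i)" "j = ?off i + m" using off_cases[OF j] by blast
      then show ?thesis using c_nth[OF im(1,2)] off[OF im(1,2)] tss[OF im(1)] wtsD by metis
    qed
    moreover have "set Ws \<subseteq> Obj T" using Y Ws by (auto simp: Terms_simps)
    ultimately have c: "wts Ws ?c ?C" using C c_len by (simp add: list_all2_conv_all_nth)
    show ?thesis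
    proof (rule ex1I[of _ "arrow Ws ?C ?c"])
      have "map (\<lambda>m. ?c ! (?off i + m)) [0..<length (Xss ! i)] = tss i" if "i < length Xss" for i
        using c_nth[OF that] len[OF that] by (auto intro: nth_equalityI)
      then show "arrow Ws ?C ?c \<in> Hom T' Y (obj ?C) \<and> (\<forall>i < length (map obj Xss). Cmp T' (?ps ! i) (arrow Ws ?C ?c) = fs ! i)"
        using c tss by (auto simp: Ws Hom_Terms block_Cmp)
    next
      fix h assume h: "h \<in> Hom T' Y (obj ?C) \<and> (\<forall>i < length (map obj Xss). Cmp T' (?ps ! i) h = fs ! i)"
      then obtain ts where ts: "h = arrow Ws ?C ts" "wts Ws ts ?C" by (auto simp: Ws Hom_Terms)
      have im: "ts ! (?off i + m) = tss i ! m" if i: "i < length Xss" and m: "m < length (Xss ! i)" for i m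
      proof -
        have "map (\<lambda>m. ts ! (?off i + m)) [0..<length (Xss ! i)] = tss i"
          using h[THEN conjunct2, rule_format, of i] i tss[OF i] by (simp add: ts(1) block_Cmp)
        then have "map (\<lambda>m. ts ! (?off i + m)) [0..<length (Xss ! i)] ! m = tss i ! m" by simp
        then show ?thesis using m by simp
      qed
      have "ts = ?c"
      proof (rule nth_equalityI)
        show "length ts = length ?c" using wtsD[OF ts(2)] c_len by simp
        fix j assume "j < length ts"
        then obtain i m where "i < length Xss" "m < length (Xss ! i)" "j = ?off i + m"
          using off_cases wtsD[OF ts(2)] by metis
        then show "ts ! j = ?c ! j" using im c_nth by simp
      qed
      then show "h = arrow Ws ?C ?c" using ts by simp
    qed
  qed
  have coord_block: "Cmp Terms (coord (Xss ! i) m) (block Xss i) = coord ?C (?off i + m)"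
    if "i < length Xss" "m < length (Xss ! i)" for i m
    using that off[OF that] unfolding coord_def block_def by (simp add: Terms_simps)
  have lift: "tracks_lift T' (obj ?C) ?ps Y" if Y: "Y \<in> Obj T'" for Y
    unfolding tracks_lift_def
  proof (intro ballI)
    obtain Ws where Ws: "Y = obj Ws" using Y by (auto simp: Terms_simps)
    fix f g assume "f \<in> Hom T' Y (obj ?C)" "g \<in> Hom T' Y (obj ?C)"
    then obtain ts ss where f: "f = arrow Ws ?C ts" "wts Ws ts ?C" and g: "g = arrow Ws ?C ss" "wts Ws ss ?C"
      by (auto simp: Ws Hom_Terms)
    have fM: "f \<in> Mor Terms" "Tgt Terms f = obj ?C" and gM: "g \<in> Mor Terms" "Tgt Terms g = obj ?C"
      using f g by (auto simp: Terms_simps)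
    note whole = coord_lift[OF f(2) g(2), folded f(1) g(1)]
    have parts: "lifts_uniquely T' (map (coord (Xss ! i)) [0..<length (Xss ! i)])
        (Cmp T' (block Xss i) f) (Cmp T' (block Xss i) g)" if i: "i < length Xss" for i
    proof -
      have "f \<in> Hom Terms (obj Ws) (obj ?C)" "g \<in> Hom Terms (obj Ws) (obj ?C)"
        using f g unfolding Hom_Terms by blast+
      then have "Cmp Terms (block Xss i) f \<in> Hom Terms (obj Ws) (obj (Xss ! i))"
        "Cmp Terms (block Xss i) g \<in> Hom Terms (obj Ws) (obj (Xss ! i))"
        using terms.C.Cmp_in[OF block[OF i]] by blast+
      then show ?thesis by (auto elim!: Hom_TermsE intro: coord_lift)
    qed
    have coordD: "coord (Xss ! i) m \<in> Mor Terms" "Src Terms (coord (Xss ! i) m) = obj (Xss ! i)"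
      "block Xss i \<in> Mor Terms" "Src Terms (block Xss i) = obj ?C" "Tgt Terms (block Xss i) = obj (Xss ! i)"
      if "i < length Xss" "m < length (Xss ! i)" for i m
      using HomD[OF coord_in[OF Xi[OF that(1)] that(2)]] HomD[OF block[OF that(1)]] by simp_all
    have blockD: "block Xss i \<in> Mor Terms" "Src Terms (block Xss i) = obj ?C" "Tgt Terms (block Xss i) = obj (Xss ! i)"
      if "i < length Xss" for i
      using HomD[OF block[OF that]] by simp_all
    show "lifts_uniquely T' ?ps f g"
      unfolding lifts_uniquely_def
    proof (intro allI impI)
      fix \<alpha>s assume "\<forall>i < length ?ps. \<alpha>s i \<in> tracks T' (Cmp T' (?ps ! i) f) (Cmp T' (?ps ! i) g)"
      then have \<alpha>s: "\<alpha>s i \<in> tracks T' (Cmp T' (block Xss i) f) (Cmp T' (block Xss i) g)" if "i < length Xss" for i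
        using that by simp
      let ?bss = "map (\<lambda>i. map (\<lambda>m. HCmp T' (TId T' (coord (Xss ! i) m)) (\<alpha>s i)) [0..<length (Xss ! i)]) [0..<length Xss]"
      have lens: "map length ?bss = map length Xss" by (auto intro: nth_equalityI)
      have b: "concat ?bss ! (?off i + m) = HCmp T' (TId T' (coord (Xss ! i) m)) (\<alpha>s i)"
        if "i < length Xss" "m < length (Xss ! i)" for i m
        using nth_concat_offset[of i ?bss m] that unfolding lens by simp
      have "concat ?bss ! j \<in> tracks T' (Cmp T' (coord ?C j) f) (Cmp T' (coord ?C j) g)" if j: "j < length ?C" for j
      proof -
        obtain i m where im: "i < length Xss" "m < length (Xss ! i)" "j = ?off i + m" using off_cases[OF j] by blast
        have "HCmp T' (TId T' (coord (Xss ! i) m)) (\<alpha>s i) \<in>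
            tracks T' (Cmp T' (coord (Xss ! i) m) (Cmp T' (block Xss i) f)) (Cmp T' (coord (Xss ! i) m) (Cmp T' (block Xss i) g))"
          using tracksD[OF \<alpha>s[OF im(1)]] coordD[OF im(1,2)] fM gM unfolding tracks_def mem_Collect_eq
          by (simp del: terms.tracks_along_sel(7-11) add: terms.P.typing terms.C.cat_simps)
        moreover have "Cmp T' (coord (Xss ! i) m) (Cmp T' (block Xss i) f) = Cmp T' (coord ?C j) f"
          "Cmp T' (coord (Xss ! i) m) (Cmp T' (block Xss i) g) = Cmp T' (coord ?C j) g"
          using coordD[OF im(1,2)] fM gM coord_block[OF im(1,2)] im(3) by (simp_all add: terms.C.Cmp_Cmp[symmetric])
        ultimately show ?thesis unfolding im(3) b[OF im(1,2)] by (simp only:)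
      qed
      then have "\<forall>j < length (map (coord ?C) [0..<length ?C]). concat ?bss ! j \<in>
          tracks T' (Cmp T' (map (coord ?C) [0..<length ?C] ! j) f) (Cmp T' (map (coord ?C) [0..<length ?C] ! j) g)"
        by simp
      from whole[unfolded lifts_uniquely_def, THEN spec, THEN mp, OF this]
      have ex1: "\<exists>!\<beta>. \<beta> \<in> tracks T' f g \<and> (\<forall>j < length ?C. HCmp T' (TId T' (coord ?C j)) \<beta> = concat ?bss ! j)"
        by (simp del: terms.tracks_along_sel(7-11))
      then obtain \<beta> where \<beta>: "\<beta> \<in> tracks T' f g" "\<forall>j < length ?C. HCmp T' (TId T' (coord ?C j)) \<beta> = concat ?bss ! j"
        by blast
      have whisker: "HCmp T' (TId T' (coord ?C (?off i + m))) \<gamma> =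
          HCmp T' (TId T' (coord (Xss ! i) m)) (HCmp T' (TId T' (block Xss i)) \<gamma>)"
        if "\<gamma> \<in> tracks T' f g" "i < length Xss" "m < length (Xss ! i)" for \<gamma> i m
        using terms.P.lw_lw[of \<gamma> "block Xss i" "coord (Xss ! i) m"] tracksD[OF that(1)] coordD[OF that(2,3)] fM
          coord_block[OF that(2,3)]
        by (simp del: terms.tracks_along_sel(7-11))
      have block_tracks: "HCmp T' (TId T' (block Xss i)) \<gamma> \<in> tracks T' (Cmp T' (block Xss i) f) (Cmp T' (block Xss i) g)"
        if "\<gamma> \<in> tracks T' f g" "i < length Xss" for \<gamma> i
        using tracksD[OF that(1)] blockD[OF that(2)] fM gM unfolding tracks_def mem_Collect_eq
        by (simp del: terms.tracks_along_sel(7-11) add: terms.P.typing)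
      have equiv: "(\<forall>j < length ?C. HCmp T' (TId T' (coord ?C j)) \<gamma> = concat ?bss ! j) \<longleftrightarrow>
          (\<forall>i < length Xss. HCmp T' (TId T' (block Xss i)) \<gamma> = \<alpha>s i)" if \<gamma>: "\<gamma> \<in> tracks T' f g" for \<gamma>
      proof
        assume l: "\<forall>j < length ?C. HCmp T' (TId T' (coord ?C j)) \<gamma> = concat ?bss ! j"
        show "\<forall>i < length Xss. HCmp T' (TId T' (block Xss i)) \<gamma> = \<alpha>s i"
        proof (intro allI impI)
          fix i assume i: "i < length Xss"
          have *: "HCmp T' (TId T' (coord (Xss ! i) m)) (HCmp T' (TId T' (block Xss i)) \<gamma>) =
              HCmp T' (TId T' (coord (Xss ! i) m)) (\<alpha>s i)" if m: "m < length (Xss ! i)" for m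
            unfolding whisker[OF \<gamma> i m, symmetric] b[OF i m, symmetric] using l off(1)[OF i m] by blast
          have "\<forall>m < length (map (coord (Xss ! i)) [0..<length (Xss ! i)]).
              HCmp T' (TId T' (map (coord (Xss ! i)) [0..<length (Xss ! i)] ! m)) (\<alpha>s i) \<in>
              tracks T' (Cmp T' (map (coord (Xss ! i)) [0..<length (Xss ! i)] ! m) (Cmp T' (block Xss i) f))
                (Cmp T' (map (coord (Xss ! i)) [0..<length (Xss ! i)] ! m) (Cmp T' (block Xss i) g))"
            using tracksD[OF \<alpha>s[OF i]] coordD[OF i] fM gM unfolding tracks_def mem_Collect_eq
            by (simp del: terms.tracks_along_sel(7-11) add: terms.P.typing terms.C.cat_simps)
          from parts[OF i, unfolded lifts_uniquely_def, THEN spec, THEN mp, OF this]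
          show "HCmp T' (TId T' (block Xss i)) \<gamma> = \<alpha>s i"
            using * block_tracks[OF \<gamma> i] \<alpha>s[OF i]
            by (simp del: terms.tracks_along_sel) blast
        qed
      next
        assume r: "\<forall>i < length Xss. HCmp T' (TId T' (block Xss i)) \<gamma> = \<alpha>s i"
        show "\<forall>j < length ?C. HCmp T' (TId T' (coord ?C j)) \<gamma> = concat ?bss ! j"
        proof (intro allI impI)
          fix j assume "j < length ?C"
          then obtain i m where im: "i < length Xss" "m < length (Xss ! i)" "j = ?off i + m" using off_cases by blast
          show "HCmp T' (TId T' (coord ?C j)) \<gamma> = concat ?bss ! j"
            unfolding im(3) whisker[OF \<gamma> im(1,2)] b[OF im(1,2)] r[rule_format, OF im(1)] ..
        qed
      qed
      have "\<exists>!\<beta>. \<beta> \<in> tracks T' f g \<and> (\<forall>i < length Xss. HCmp T' (TId T' (block Xss i)) \<beta> = \<alpha>s i)"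
        using ex1 equiv by (metis (no_types, lifting))
      then show "\<exists>!\<beta>. \<beta> \<in> tracks T' f g \<and> (\<forall>i < length ?ps. HCmp T' (TId T' (?ps ! i)) \<beta> = \<alpha>s i)"
        by (simp del: terms.tracks_along_sel(7-11))
    qed
  qed
  show "strong_product T' (map obj Xss) (obj (concat Xss)) ?ps"
    by (rule terms.P.strong_productI(1)[OF cone lift unique])
  show "lax_product T' (map obj Xss) (obj (concat Xss)) ?ps"
    by (rule terms.P.strong_productI(2)[OF cone lift unique])
qed

theorem strong_track_theory_T': "strong_track_theory T'"
proof -
  have ex: "\<exists>P ps. strong_product T' Xs P ps \<and> lax_product T' Xs P ps" if "set Xs \<subseteq> Obj T'" for Xs
  proof -
    have "Xs = map obj (map objs Xs)" "\<forall>Xs \<in> set (map objs Xs). set Xs \<subseteq> Obj T"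
      using that by (auto simp: Terms_simps subset_iff intro!: map_idI[symmetric])
    then show ?thesis using strong_product_blocks by metis
  qed
  then show ?thesis
    unfolding strong_track_theory_def track_theory_def using terms.P.track_category_axioms by blast
qed

end

section \<open>Restriction to subcategories\<close>

abbreviation inclusion_map :: "('o, 'a, 't, 'o, 'a, 't) track_map" where
  "inclusion_map \<equiv> \<lparr>on_ob = (\<lambda>X. X), on_arr = (\<lambda>f. f), on_trk = (\<lambda>\<alpha>. \<alpha>)\<rparr>"

context pseudofunctor
begin

text \<open>The comparison tracks are kept, so horizontal composites agree and the inclusion is strict.\<close>

lemma
  assumes C': "C' = C\<lparr>Obj := obs, Mor := arrs\<rparr>" and obs: "obs \<subseteq> Obj C" and arrs: "arrs \<subseteq> Mor C"
    and ends: "\<And>f. f \<in> arrs \<Longrightarrow> Src C f \<in> obs \<and> Tgt C f \<in> obs"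
    and Idt: "\<And>X. X \<in> obs \<Longrightarrow> Idt C X \<in> arrs"
    and Cmp: "\<And>g f. g \<in> arrs \<Longrightarrow> f \<in> arrs \<Longrightarrow> Src C g = Tgt C f \<Longrightarrow> Cmp C g f \<in> arrs"
  shows pseudofunctor_restrict: "pseudofunctor C' T ob arr unit comp"
    and track_functor_inclusion: "track_functor (pseudofunctor.tracks_along C' T arr comp) tracks_along
      inclusion_map"
    and bijective_on_tracks_inclusion: "bijective_on_tracks (pseudofunctor.tracks_along C' T arr comp) tracks_along
      inclusion_map"
proof -
  have sel: "Obj C' = obs" "Mor C' = arrs" "Src C' = Src C" "Tgt C' = Tgt C" "Idt C' = Idt C" "Cmp C' = Cmp C"
    unfolding C' by simp_all
  have Hom: "f \<in> Hom C' X Y \<longleftrightarrow> f \<in> arrs \<and> f \<in> Hom C X Y" for f X Y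
    using arrs by (auto simp: Hom_def sel)
  have C'_cat: "category C'"
  proof
    show "Src C' f \<in> Obj C'" "Tgt C' f \<in> Obj C'" if "f \<in> Mor C'" for f
      using that ends by (simp_all add: sel)
    show "Idt C' X \<in> Hom C' X X" if "X \<in> Obj C'" for X
      using that Idt obs C.Idt_in unfolding Hom sel by blast
    show "Cmp C' g f \<in> Hom C' X Z" if "g \<in> Hom C' Y Z" "f \<in> Hom C' X Y" for g f X Y Z
      using that Cmp[of g f] C.Cmp_in unfolding Hom sel by (auto simp: Hom_def C.cat_simps)
    show "Cmp C' (Idt C' Y) f = f" "Cmp C' f (Idt C' X) = f" if "f \<in> Hom C' X Y" for f X Y
      using that C.Idt_left C.Idt_right unfolding Hom sel by blast+
    show "Cmp C' h (Cmp C' g f) = Cmp C' (Cmp C' h g) f"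
      if "h \<in> Hom C' Y Z" "g \<in> Hom C' X Y" "f \<in> Hom C' W X" for h g f W X Y Z
      using that C.Cmp_assoc unfolding Hom sel by blast
  qed
  show pf: "pseudofunctor C' T ob arr unit comp"
    by (rule pseudofunctor.intro[OF C'_cat T.track_category_axioms], rule pseudofunctor_axioms.intro)
      (use obs in \<open>auto simp: Hom sel ob_in arr_in unit_in comp_in left_unit right_unit assoc\<close>)
  interpret R: pseudofunctor C' T ob arr unit comp by (rule pf)
  have tracks: "tracks R.tracks_along f g = tracks tracks_along f g" if "f \<in> arrs" "g \<in> arrs" for f g
    unfolding set_eq_iff R.tracks_along_iff tracks_along_iff using that arrs by (auto simp: sel)
  have sub: "\<alpha> \<in> tracks tracks_along f g \<and> f \<in> arrs \<and> g \<in> arrs" if "\<alpha> \<in> tracks R.tracks_along f g" for \<alpha> f g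
  proof -
    have "f \<in> arrs \<and> g \<in> arrs" using that unfolding R.tracks_along_iff sel by blast
    then show ?thesis using that tracks by blast
  qed
  show "track_functor R.tracks_along tracks_along inclusion_map"
    by (rule track_functorI[OF R.P.track_category_axioms P.track_category_axioms])
      (use obs sub in \<open>auto simp: Hom sel R.hcomp_def hcomp_def\<close>)
  show "bijective_on_tracks R.tracks_along tracks_along inclusion_map"
    unfolding bijective_on_tracks_def using tracks by (simp add: sel bij_betw_def)
qed

text \<open>Lift the identity of the common value in both directions; the composites have values homotopic to
  identities, and the pulled back tracks reflect homotopies.\<close>

lemma homotopy_equivalent_same_image:
  assumes full: "\<And>X Y g. X \<in> Obj C \<Longrightarrow> Y \<in> Obj C \<Longrightarrow> g \<in> Hom T (ob X) (ob Y) \<Longrightarrow> \<exists>f \<in> Hom C X Y. T.homotopic (arr f) g"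
    and X: "X \<in> Obj C" and Y: "Y \<in> Obj C" and eq: "ob X = ob Y"
  shows "homotopy_equivalent tracks_along X Y"
proof -
  have id: "Idt T (ob X) \<in> Hom T (ob X) (ob Y)" "Idt T (ob X) \<in> Hom T (ob Y) (ob X)"
    using T.Idt_in[OF ob_in[OF X]] eq by simp_all
  obtain u where u: "u \<in> Hom C X Y" "T.homotopic (arr u) (Idt T (ob X))" using full[OF X Y id(1)] by blast
  obtain v where v: "v \<in> Hom C Y X" "T.homotopic (arr v) (Idt T (ob X))" using full[OF Y X id(2)] by blast
  have inv: "P.homotopic (Cmp C b a) (Idt C A)"
    if a: "a \<in> Hom C A B" "T.homotopic (arr a) (Idt T (ob X))" and b: "b \<in> Hom C B A" "T.homotopic (arr b) (Idt T (ob X))"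
      and A: "A \<in> Obj C" "ob A = ob X" for a b A B
  proof (rule homotopic_tracks_along[OF C.Cmp_in[OF b(1) a(1)] C.Idt_in[OF A(1)]])
    note t = HomD[OF a(1)] HomD[OF b(1)]
    have "T.homotopic (arr (Cmp C b a)) (Cmp T (arr b) (arr a))"
      using t by (intro T.homotopic_sym[OF T.homotopicI[of "comp b a"]]) (simp_all add: pf_simps)
    also have "T.homotopic (Cmp T (arr b) (arr a)) (Cmp T (Idt T (ob X)) (Idt T (ob X)))"
      using t by (intro T.homotopic_Cmp[OF b(2) a(2)]) (simp add: pf_simps)
    also have "Cmp T (Idt T (ob X)) (Idt T (ob X)) = Idt T (ob X)"
      using ob_in[OF X] by (simp add: T.typing T.unit_simps)
    also have "T.homotopic (Idt T (ob X)) (arr (Idt C A))"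
      using A by (intro T.homotopicI[of "unit A"]) (simp_all add: pf_simps)
    finally show "T.homotopic (arr (Cmp C b a)) (arr (Idt C A))" .
  qed
  show ?thesis
    using P.homotopy_equivalent_iff[of X Y] X Y u(1) v(1) inv[OF u v X] inv[OF v u Y] eq by auto
qed

end

section \<open>The strict part: unary terms\<close>

context chosen_products
begin

text \<open>Terms in which every application has one argument. Their 1-arrows start at a one-element list,
  whose chosen product is the entry itself.\<close>

inductive unary :: "'o \<Rightarrow> ('o, 'a, 't) cell \<Rightarrow> 'o \<Rightarrow> bool" for X where
  unary_var: "X \<in> Obj T \<Longrightarrow> unary X (var 0) X"
| unary_app: "unary X t Y \<Longrightarrow> f \<in> Hom T Y Z \<Longrightarrow> unary X (app f [t]) Z"

lemma unary_wts: "unary X t Y \<Longrightarrow> wts [X] [t] [Y]"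
proof (induction rule: unary.induct)
  case unary_var
  then show ?case using wt_var[of 0 "[X]"] by simp
next
  case (unary_app t Y f Z)
  then show ?case using wt_app[of "[X]" "[t]" "[Y]" f Z] PP_single[of Y] Hom_objects[OF unary_app(2)] by simp
qed

lemma unary_subst: "unary X t Y \<Longrightarrow> unary W s X \<Longrightarrow> unary W (subst [s] t) Y"
  by (induction rule: unary.induct) (auto intro: unary.intros)

lemma ev_unary:
  "X \<in> Obj T \<Longrightarrow> ev [X] (var 0) = Idt T X"
  "unary X t Y \<Longrightarrow> ev [X] (app f [t]) = f \<cdot> ev [X] t"
  using pp_single evs_single[of "[X]" t Y] unary_wts[of X t Y] by simp_all

lemma ev_unary_in: "unary X t Y \<Longrightarrow> ev [X] t \<in> Hom T X Y"
  using ev_in[of "[X]" t Y] unary_wts[of X t Y] PP_single[of X] by simp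

text \<open>All tracks that enter the comparison track are identities, and the unique lift of an identity along the
  identity projection is an identity.\<close>

lemma unary_strict:
  "unary X t Y \<Longrightarrow> unary W s X \<Longrightarrow> ev [W] (subst [s] t) = ev [X] t \<cdot> ev [W] s \<and>
    comparison [W] [X] [s] t = TId T (ev [X] t \<cdot> ev [W] s)"
proof (induction rule: unary.induct)
  case unary_var
  note s = HomD[OF ev_unary_in[OF unary_var(2)]]
  show ?case using ev_unary(1)[OF unary_var(1)] proj_trk_single[of "[W]" s X] unary_wts[OF unary_var(2)] s
    by (simp add: unit_simps)
next
  case (unary_app t Y f Z)
  note s = HomD[OF ev_unary_in[OF unary_app(4)]] and t = HomD[OF ev_unary_in[OF unary_app(1)]]
  note ts = unary_subst[OF unary_app(1,4)]
  have "comparisons [W] [X] [s] [t] = comparison [W] [X] [s] t"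
    using comparisons_single[of "[W]" "[X]" "[s]" t Y] unary_wts[OF unary_app(4)] unary_wts[OF unary_app(1)] by simp
  then show ?case
    using unary_app ev_unary(2)[OF unary_app(1), of f] ev_unary(2)[OF ts, of f] HomD[OF unary_app(2)] s t
    by (simp add: Cmp_Cmp lw_TId typing)
qed

definition unary_objects :: "('o, 'a, 't) cell set" where
  "unary_objects = {obj [X] | X. X \<in> Obj T}"

definition unary_arrows :: "('o, 'a, 't) cell set" where
  "unary_arrows = {arrow [X] [Y] [t] | X Y t. unary X t Y}"

abbreviation Unary :: "(('o, 'a, 't) cell, ('o, 'a, 't) cell) category" where
  "Unary \<equiv> Terms\<lparr>Obj := unary_objects, Mor := unary_arrows\<rparr>"

lemma vars_one: "vars (Suc 0) = [var 0]"
  unfolding vars_def by simp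

lemma Unary_closed:
  "unary_objects \<subseteq> Obj Terms" "unary_arrows \<subseteq> Mor Terms"
  "\<And>f. f \<in> unary_arrows \<Longrightarrow> Src Terms f \<in> unary_objects \<and> Tgt Terms f \<in> unary_objects"
  "\<And>X. X \<in> unary_objects \<Longrightarrow> Idt Terms X \<in> unary_arrows"
  "\<And>g f. g \<in> unary_arrows \<Longrightarrow> f \<in> unary_arrows \<Longrightarrow> Src Terms g = Tgt Terms f \<Longrightarrow> Cmp Terms g f \<in> unary_arrows"
proof -
  show "unary_objects \<subseteq> Obj Terms" by (auto simp: unary_objects_def Terms_simps)
  show "unary_arrows \<subseteq> Mor Terms" using unary_wts by (fastforce simp: unary_arrows_def Terms_simps)
  show "Src Terms f \<in> unary_objects \<and> Tgt Terms f \<in> unary_objects" if "f \<in> unary_arrows" for f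
    using that unary_wts by (fastforce simp: unary_arrows_def unary_objects_def Terms_simps)
  show "Idt Terms X \<in> unary_arrows" if "X \<in> unary_objects" for X
    using that unary_var by (auto simp: unary_arrows_def unary_objects_def Terms_simps vars_one)
  show "Cmp Terms g f \<in> unary_arrows" if "g \<in> unary_arrows" "f \<in> unary_arrows" "Src Terms g = Tgt Terms f" for g f
    using that unary_subst by (auto simp: unary_arrows_def Terms_simps)
qed

sublocale unary: pseudofunctor Unary T tob tarr tunit tcomp
  by (rule terms.pseudofunctor_restrict[OF refl Unary_closed])

abbreviation T'' :: "('o, 'a, 't) cell_track_category" where "T'' \<equiv> unary.tracks_along"

lemma mem_unary_objects: "A \<in> unary_objects \<longleftrightarrow> (\<exists>X \<in> Obj T. A = obj [X])"
  by (auto simp: unary_objects_def)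

lemma mem_unary_arrows: "arrow [X] [Y] [t] \<in> unary_arrows \<longleftrightarrow> unary X t Y"
  by (auto simp: unary_arrows_def)

lemma Hom_Unary: "f \<in> Hom Unary A B \<longleftrightarrow> f \<in> unary_arrows \<and> Src Terms f = A \<and> Tgt Terms f = B"
  by (auto simp: Hom_def)

lemma tarr_unary: "unary X t Y \<Longrightarrow> tarr (arrow [X] [Y] [t]) = ev [X] t"
  using evs_single[of "[X]" t Y] unary_wts[of X t Y] by (simp add: tarr_def)

lemma unary_generator:
  assumes "f \<in> Hom T X Y"
  shows "unary X (app f [var 0]) Y" and "ev [X] (app f [var 0]) = f"
proof -
  have X: "X \<in> Obj T" using Hom_objects[OF assms] by blast
  show "unary X (app f [var 0]) Y" using unary_app[OF unary_var[OF X] assms] .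
  show "ev [X] (app f [var 0]) = f"
    using ev_unary(2)[OF unary_var[OF X], of f] ev_unary(1)[OF X] HomD[OF assms] by (simp add: unit_simps)
qed

lemma homotopy_equivalent_refl: "X \<in> Obj T \<Longrightarrow> homotopy_equivalent T X X"
  using homotopy_equivalent_iff[of X X] Idt_in[of X] homotopic_refl[of "Idt T X"]
  by (auto simp: typing unit_simps intro!: bexI[of _ "Idt T X"])

text \<open>Every 1-arrow \<open>f\<close> of \<open>T\<close> is the value of the unary term \<open>f x\<close>, and every object that of a one-element list.\<close>

theorem weak_equivalence_T''_T:
  "weak_equivalence T'' T unary.strict_map"
  unfolding weak_equivalence_iff
proof (intro conjI ballI)
  show "track_functor T'' T unary.strict_map"
  proof (rule unary.track_functor_projection)
    show "tarr (Idt Unary X) = Idt T (tob X)" if "X \<in> Obj Unary" for X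
      using that tarr_unary[OF unary_var] ev_unary(1)
      by (auto simp: unary_objects_def Terms_simps vars_one tob_single)
    fix g f assume "g \<in> Mor Unary" "f \<in> Mor Unary" "Src Unary g = Tgt Unary f"
    then obtain W s X t Y where f: "f = arrow [W] [X] [s]" "unary W s X" and g: "g = arrow [X] [Y] [t]" "unary X t Y"
      by (auto simp: unary_arrows_def Terms_simps)
    have "tcomp g f = comparison [W] [X] [s] t"
      using comparisons_single[of "[W]" "[X]" "[s]" t Y] unary_wts[OF f(2)] unary_wts[OF g(2)]
      by (simp add: f(1) g(1) tcomp_def)
    then show "tarr (Cmp Unary g f) = tarr g \<cdot> tarr f" "tcomp g f = TId T (tarr g \<cdot> tarr f)"
      using unary_strict[OF g(2) f(2)] tarr_unary[OF f(2)] tarr_unary[OF g(2)] tarr_unary[OF unary_subst[OF g(2) f(2)]]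
      by (simp_all add: f(1) g(1) Terms_simps)
  qed
  show "bijective_on_tracks T'' T unary.strict_map"
    by (rule unary.bijective_on_tracks_val) simp_all
  show "full_up_to_homotopy T'' T unary.strict_map"
    unfolding full_up_to_homotopy_def
  proof (intro ballI)
    fix A B g assume "A \<in> Obj T''" "B \<in> Obj T''"
      and g: "g \<in> Hom T (on_ob unary.strict_map A) (on_ob unary.strict_map B)"
    then obtain X Y where X: "A = obj [X]" "X \<in> Obj T" and Y: "B = obj [Y]" "Y \<in> Obj T"
      by (auto simp: mem_unary_objects)
    have g: "g \<in> Hom T X Y" using g X Y by (simp add: tob_single)
    show "\<exists>f \<in> Hom T'' A B. homotopic (on_arr unary.strict_map f) g"
      using unary_generator[OF g] tarr_unary[OF unary_generator(1)[OF g]] homotopic_refl HomD[OF g]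
      by (intro bexI[of _ "arrow [X] [Y] [app g [var 0]]"]) (auto simp: X Y Hom_Unary mem_unary_arrows Terms_simps)
  qed
  show "\<exists>X \<in> Obj T''. homotopy_equivalent T Y (on_ob unary.strict_map X)"
    if Y: "Y \<in> Obj T" for Y
    using homotopy_equivalent_refl[OF Y] tob_single[OF Y] Y
    by (intro bexI[of _ "obj [Y]"]) (auto simp: mem_unary_objects)
qed

text \<open>A 1-arrow of \<open>T'\<close> between one-element lists is homotopic to the unary term that its value generates, since
  the two have the same value.\<close>

theorem weak_equivalence_T''_T':
  "weak_equivalence T'' T' inclusion_map"
  unfolding weak_equivalence_iff
proof (intro conjI ballI)
  show "track_functor T'' T' inclusion_map" by (rule terms.track_functor_inclusion[OF refl Unary_closed])
  show "bijective_on_tracks T'' T' inclusion_map" by (rule terms.bijective_on_tracks_inclusion[OF refl Unary_closed])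
  show "full_up_to_homotopy T'' T' inclusion_map"
    unfolding full_up_to_homotopy_def
  proof (intro ballI)
    fix A B g assume "A \<in> Obj T''" "B \<in> Obj T''" and g: "g \<in> Hom T' (on_ob inclusion_map A) (on_ob inclusion_map B)"
    then obtain X Y where X: "A = obj [X]" "X \<in> Obj T" and Y: "B = obj [Y]" "Y \<in> Obj T"
      by (auto simp: mem_unary_objects)
    have g: "g \<in> Hom Terms (obj [X]) (obj [Y])" using g X Y by simp
    have h: "tarr g \<in> Hom T X Y" using terms.arr_in[OF g] X Y by (simp add: tob_single)
    let ?f = "arrow [X] [Y] [app (tarr g) [var 0]]"
    have f: "?f \<in> unary_arrows" using unary_generator(1)[OF h] by (auto simp: unary_arrows_def)
    then have f': "?f \<in> Hom Terms (obj [X]) (obj [Y])"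
      using Unary_closed(2) by (auto simp: Hom_def Terms_simps)
    have "terms.P.homotopic ?f g"
      using terms.homotopic_tracks_along[OF f' g] tarr_unary[OF unary_generator(1)[OF h]] unary_generator(2)[OF h]
        homotopic_refl HomD[OF h] by simp
    then show "\<exists>f \<in> Hom T'' A B. terms.P.homotopic (on_arr inclusion_map f) g"
      using f by (intro bexI[of _ ?f]) (auto simp: X Y Hom_Unary Terms_simps)
  qed
  show "\<exists>X \<in> Obj T''. homotopy_equivalent T' Y (on_ob inclusion_map X)" if Y: "Y \<in> Obj T'" for Y
  proof -
    obtain Ys where Ys: "Y = obj Ys" "set Ys \<subseteq> Obj T" using Y by (auto simp: Terms_simps)
    have P: "PP Ys \<in> Obj T" using PP_in[OF Ys(2)] .
    have "homotopy_equivalent T' Y (obj [PP Ys])"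
      by (rule terms.homotopy_equivalent_same_image[OF Terms_full])
        (use Ys P in \<open>auto simp: Terms_simps tob_def PP_single\<close>)
    then show ?thesis using P by (intro bexI[of _ "obj [PP Ys]"]) (auto simp: mem_unary_objects)
  qed
qed

text \<open>The candidate for the product of one-element lists is the one-element list on the chosen product, with the
  projections read as unary terms; its image in \<open>T\<close> is a lax product, and \<open>T'' \<rightarrow> T\<close> reflects these.\<close>

theorem track_theory_T'': "track_theory T''"
  unfolding track_theory_def
proof (intro conjI allI impI)
  show "track_category T''" by (rule unary.P.track_category_axioms)
  fix As assume "set As \<subseteq> Obj T''"
  then have As: "As = map (\<lambda>X. obj [X]) (map tob As)" "set (map tob As) \<subseteq> Obj T"
    by (auto simp: mem_unary_objects tob_single subset_iff intro!: map_idI[symmetric])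
  define Xs where "Xs = map tob As"
  have Xs: "set Xs \<subseteq> Obj T" and As: "As = map (\<lambda>X. obj [X]) Xs" using As unfolding Xs_def by auto
  let ?g = "\<lambda>k. arrow [PP Xs] [Xs ! k] [app (pp Xs ! k) [var 0]]"
  have p: "pp Xs ! k \<in> Hom T (PP Xs) (Xs ! k)" if "k < length Xs" for k using pp_in[OF Xs that] .
  have "map tob As = Xs" unfolding As using Xs by (auto simp: tob_single subset_iff intro!: map_idI)
  moreover have "map tarr (map ?g [0..<length Xs]) = pp Xs"
    using length_pp[OF Xs] tarr_unary[OF unary_generator(1)[OF p]] unary_generator(2)[OF p]
    by (intro nth_equalityI) auto
  ultimately have lax: "lax_product T (map (on_ob unary.strict_map) As) (on_ob unary.strict_map (obj [PP Xs])) (map (on_arr unary.strict_map) (map ?g [0..<length Xs]))"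
    using prod[OF Xs] tob_single[OF PP_in[OF Xs]] by simp
  have "cone T'' As (obj [PP Xs]) (map ?g [0..<length Xs])"
    unfolding cone_iff using unary_generator(1)[OF p] PP_in[OF Xs]
    by (auto simp: As Hom_Unary mem_unary_objects mem_unary_arrows Terms_simps)
  from weak_equivalence_reflects_lax_products[OF weak_equivalenceD[OF weak_equivalence_T''_T] this lax]
  show "\<exists>P ps. lax_product T'' As P ps" by blast
qed

end

section \<open>Strictification\<close>

lemma (in track_category) lax_product_single:
  assumes X: "X \<in> Obj T" shows "lax_product T [X] X [Idt T X]"
  unfolding lax_product_iff
proof (intro conjI ballI)
  show "cone T [X] X [Idt T X]" using Idt_in[OF X] X by (simp add: cone_iff)
  show "cones_lift T [X] X [Idt T X] Y" for Y
    unfolding cones_lift_def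
  proof (intro allI impI; elim conjE)
    fix fs assume "length fs = length [X]" "\<forall>k < length [X]. fs ! k \<in> Hom T Y ([X] ! k)"
    then show "\<exists>h \<in> Hom T Y X. \<forall>k < length [X]. homotopic ([Idt T X] ! k \<cdot> h) (fs ! k)"
      by (intro bexI[of _ "fs ! 0"]) (auto simp: Hom_def unit_simps intro: homotopic_refl)
  qed
  show "tracks_lift T X [Idt T X] Y" for Y
    unfolding tracks_lift_def lifts_uniquely_def
  proof (intro ballI allI impI)
    fix f g \<alpha>s assume f: "f \<in> Hom T Y X" and g: "g \<in> Hom T Y X"
      and "\<forall>k < length [Idt T X]. \<alpha>s k \<in> tracks T ([Idt T X] ! k \<cdot> f) ([Idt T X] ! k \<cdot> g)"
    then have \<alpha>: "\<alpha>s 0 \<in> tracks T f g" using HomD[OF f] HomD[OF g] by (simp add: unit_simps)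
    have "Idt T X \<rhd> \<alpha> = \<alpha>" if "\<alpha> \<in> tracks T f g" for \<alpha>
      using tracksD[OF that] HomD[OF f] by (simp add: unit_simps)
    then show "\<exists>!\<alpha>. \<alpha> \<in> tracks T f g \<and> (\<forall>k < length [Idt T X]. [Idt T X] ! k \<rhd> \<alpha> = \<alpha>s k)"
      using \<alpha> by (intro ex1I[of _ "\<alpha>s 0"]) auto
  qed
qed

text \<open>One-element lists may be treated separately because an object with its identity is a lax product of
  itself.\<close>

theorem chosen_products_exist:
  assumes "track_theory T"
  shows "\<exists>PP pp tup eps. chosen_products T PP pp tup eps"
proof -
  interpret track_category T using assms unfolding track_theory_def by blast
  have "\<exists>P ps. (set Xs \<subseteq> Obj T \<longrightarrow> lax_product T Xs P ps) \<and> (\<forall>X. Xs = [X] \<longrightarrow> P = X \<and> ps = [Idt T X])" for Xs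
    using assms lax_product_single unfolding track_theory_def
    by (cases "\<exists>X. Xs = [X]") auto
  then obtain PP pp where lax: "\<And>Xs. set Xs \<subseteq> Obj T \<Longrightarrow> lax_product T Xs (PP Xs) (pp Xs)"
    and single: "\<And>X. PP [X] = X \<and> pp [X] = [Idt T X]" by metis
  have "\<exists>h e. (W \<in> Obj T \<longrightarrow> (\<forall>f \<in> set fs. f \<in> Mor T \<and> Src T f = W) \<longrightarrow> h \<in> Hom T W (PP (map (Tgt T) fs)) \<and>
      (\<forall>k < length fs. e k \<in> tracks T (pp (map (Tgt T) fs) ! k \<cdot> h) (fs ! k))) \<and>
      (\<forall>f. fs = [f] \<longrightarrow> h = f \<and> e 0 = TId T f)" for W fs
  proof (cases "\<exists>f. fs = [f]")
    case True
    then obtain f where f: "fs = [f]" by blast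
    show ?thesis
      unfolding f using single[of "Tgt T f"]
      by (intro exI[of _ f] exI[of _ "\<lambda>_. TId T f"]) (auto simp: Hom_def tracks_def typing unit_simps)
  next
    case False
    show ?thesis
    proof (cases "W \<in> Obj T \<and> (\<forall>f \<in> set fs. f \<in> Mor T \<and> Src T f = W)")
      case True
      have "set (map (Tgt T) fs) \<subseteq> Obj T" using True Tgt_in by auto
      from lax[OF this] True have "cones_lift T (map (Tgt T) fs) (PP (map (Tgt T) fs)) (pp (map (Tgt T) fs)) W"
        unfolding lax_product_iff by blast
      moreover have "\<forall>k < length fs. fs ! k \<in> Hom T W (map (Tgt T) fs ! k)" using True by (simp add: Hom_def)
      ultimately obtain h where h: "h \<in> Hom T W (PP (map (Tgt T) fs))"
        "\<forall>k < length fs. homotopic (pp (map (Tgt T) fs) ! k \<cdot> h) (fs ! k)"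
        unfolding cones_lift_def by auto
      have "\<forall>k. \<exists>\<alpha>. k < length fs \<longrightarrow> \<alpha> \<in> tracks T (pp (map (Tgt T) fs) ! k \<cdot> h) (fs ! k)"
        using h(2) unfolding homotopic_def by blast
      then obtain e where "\<And>k. k < length fs \<Longrightarrow> e k \<in> tracks T (pp (map (Tgt T) fs) ! k \<cdot> h) (fs ! k)"
        using choice[of "\<lambda>k \<alpha>. k < length fs \<longrightarrow> \<alpha> \<in> tracks T (pp (map (Tgt T) fs) ! k \<cdot> h) (fs ! k)"] by blast
      then show ?thesis using h(1) False by blast
    qed (use False in blast)
  qed
  then have "\<forall>W fs. \<exists>h e. (W \<in> Obj T \<longrightarrow> (\<forall>f \<in> set fs. f \<in> Mor T \<and> Src T f = W) \<longrightarrow> h \<in> Hom T W (PP (map (Tgt T) fs)) \<and>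
      (\<forall>k < length fs. e k \<in> tracks T (pp (map (Tgt T) fs) ! k \<cdot> h) (fs ! k))) \<and>
      (\<forall>f. fs = [f] \<longrightarrow> h = f \<and> e 0 = TId T f)" by blast
  then obtain tup eps where te: "\<And>W fs. (W \<in> Obj T \<longrightarrow> (\<forall>f \<in> set fs. f \<in> Mor T \<and> Src T f = W) \<longrightarrow>
      tup W fs \<in> Hom T W (PP (map (Tgt T) fs)) \<and>
      (\<forall>k < length fs. eps W fs k \<in> tracks T (pp (map (Tgt T) fs) ! k \<cdot> tup W fs) (fs ! k))) \<and>
      (\<forall>f. fs = [f] \<longrightarrow> tup W fs = f \<and> eps W fs 0 = TId T f)"
    by (auto simp only: choice_iff)
  have "chosen_products T PP pp tup eps"
    by unfold_locales (use lax single te in auto)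
  then show ?thesis by blast
qed

theorem theorem6p2p2:
  fixes T :: "('o, 'a, 't) track_category"
  assumes "track_theory T" and "abelian T"
  shows "\<exists>(T' :: ('o, 'a, 't) cell_track_category) (T'' :: ('o, 'a, 't) cell_track_category) F G L.
    strong_track_theory T' \<and> abelian T' \<and>
    track_theory T'' \<and> abelian T'' \<and>
    weak_equivalence T'' T F \<and> weak_equivalence T'' T' G \<and>
    lax_equivalence T' T L \<and>
    equivalent_track_theories (rename ObjCell ArrCell TrkCell T) T'"
proof -
  obtain PP pp tup eps where "chosen_products T PP pp tup eps" using chosen_products_exist[OF assms(1)] by blast
  then interpret chosen_products T PP pp tup eps .
  let ?U = "rename ObjCell ArrCell TrkCell T :: ('o, 'a, 't) cell_track_category"
  have inj: "inj ObjCell" "inj ArrCell" "inj TrkCell" by (simp_all add: inj_def)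
  have U: "track_theory ?U" by (rule track_theory_rename[OF track_category_axioms inj assms(1)])
  have T': "track_theory T'" using strong_track_theory_T' unfolding strong_track_theory_def by blast
  note F = weak_equivalence_T''_T and G = weak_equivalence_T''_T'
  let ?E = "\<lambda>U V :: ('o, 'a, 't) cell_track_category. \<exists>F. equivalence_of_track_theories U V F"
  have "?E T'' ?U"
    using equivalence_of_track_theoriesI[OF track_theory_T'' U
        weak_equivalence_comp[OF F weak_equivalence_rename[OF track_category_axioms inj]]] by blast
  then have "equivclp ?E ?U T''" by (rule equivclp_sym[OF r_into_equivclp])
  moreover have "?E T'' T'"
    using equivalence_of_track_theoriesI[OF track_theory_T'' T' G] by blast
  then have "equivclp ?E T'' T'" by (rule r_into_equivclp)
  ultimately have "equivclp ?E ?U T'" by (rule equivclp_trans)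
  then have "equivalent_track_theories ?U T'"
    unfolding equivalent_track_theories_def using U T' by blast
  then show ?thesis
    using strong_track_theory_T' terms.abelian_tracks_along[OF assms(2)] track_theory_T''
      unary.abelian_tracks_along[OF assms(2)] F G lax_equivalence_T' by blast
qed

end
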